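(* Let $\mathcal T$ be an essentially small triangulated category with suspension $\Sigma$. For a pair of thick subcategories $\mathcal U,\mathcal V\subseteq\mathcal T$ the following are equivalent. (1) The pair $\mathcal U,\mathcal V$ is commuting, that is, any morphism between objects of $\mathcal U$ and $\mathcal V$ (in either direction) factors through an object of $\mathcal U\wedge\mathcal V$. (2) For each pair of objects $X,Y\in\mathcal T$ there exists a canonical long exact sequence $$\cdots\to \mathrm{Hom}_{\mathcal T/(\mathcal U\wedge\mathcal V)}(X,Y)\to \mathrm{Hom}_{\mathcal T/\mathcal U}(X,Y)\oplus\mathrm{Hom}_{\mathcal T/\mathcal V}(X,Y)\to\mathrm{Hom}_{\mathcal T/(\mathcal U\vee\mathcal V)}(X,Y)\to\mathrm{Hom}_{\mathcal T/(\mathcal U\wedge\mathcal V)}(X,\Sigma Y)\to\cdots$$ in which the maps $\mathrm{Hom}_{\mathcal T/(\mathcal U\wedge\mathcal V)}(X,\Sigma^nY)\to \mathrm{Hom}_{\mathcal T/\mathcal U}(X,\Sigma^nY)\oplus\mathrm{Hom}_{\mathcal T/\mathcal V}(X,\Sigma^nY)$, $n\in\mathbb Z$, are those induced by the inclusions $\mathcal U\wedge\mathcal V\subseteq\mathcal U$ and $\mathcal U\wedge\mathcal V\subseteq\mathcal V$.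
   Context: A thick subcategory is a full triangulated subcategory closed under direct summands. For thick subcategories, $\mathcal U\wedge\mathcal V$ denotes the intersection and $\mathcal U\vee\mathcal V$ the smallest thick subcategory containing both $\mathcal U$ and $\mathcal V$. For a thick subcategory $\mathcal S$, $\mathcal T/\mathcal S$ is the Verdier quotient (same objects as $\mathcal T$). An inclusion $\mathcal S_1\subseteq\mathcal S_2$ induces a functor $\mathcal T/\mathcal S_1\to\mathcal T/\mathcal S_2$ and hence maps $\mathrm{Hom}_{\mathcal T/\mathcal S_1}(X,Y)\to\mathrm{Hom}_{\mathcal T/\mathcal S_2}(X,Y)$. The long exact sequence continues in both directions by replacing $Y$ with $\Sigma^nY$, $n\in\mathbb Z$. *)

theory Defs
  imports "HOL-Algebra.Coset"
begin

section \<open>Preadditive and additive categories\<close>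

text \<open>
  Morphisms form a single type and carry their source and target, so hom-sets are disjoint.
  Objects form a set in a HOL type, which plays the role of smallness.
\<close>

record ('o, 'm) cat_struct =
  Ob :: "'o set"
  Arr :: "'m set"
  src :: "'m \<Rightarrow> 'o"
  tgt :: "'m \<Rightarrow> 'o"
  ident :: "'o \<Rightarrow> 'm"
  comp :: "'m \<Rightarrow> 'm \<Rightarrow> 'm" (infixr "\<cdot>\<index>" 75)
  plus_arr :: "'m \<Rightarrow> 'm \<Rightarrow> 'm"
  zero_arr :: "'o \<Rightarrow> 'o \<Rightarrow> 'm"

definition Hom :: "('o, 'm, 'z) cat_struct_scheme \<Rightarrow> 'o \<Rightarrow> 'o \<Rightarrow> 'm set" where
  "Hom C X Y = {f \<in> Arr C. src C f = X \<and> tgt C f = Y}"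

definition hom_group :: "('o, 'm, 'z) cat_struct_scheme \<Rightarrow> 'o \<Rightarrow> 'o \<Rightarrow> 'm monoid" where
  "hom_group C X Y = \<lparr>carrier = Hom C X Y, mult = plus_arr C, one = zero_arr C X Y\<rparr>"

definition neg_arr :: "('o, 'm, 'z) cat_struct_scheme \<Rightarrow> 'm \<Rightarrow> 'm" where
  "neg_arr C f = inv\<^bsub>hom_group C (src C f) (tgt C f)\<^esub> f"

locale category =
  fixes C :: "('o, 'm, 'z) cat_struct_scheme" (structure)
  assumes src_Ob: "f \<in> Arr C \<Longrightarrow> src C f \<in> Ob C"
    and tgt_Ob: "f \<in> Arr C \<Longrightarrow> tgt C f \<in> Ob C"
    and ident_Hom: "X \<in> Ob C \<Longrightarrow> ident C X \<in> Hom C X X"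
    and comp_Hom: "\<lbrakk>f \<in> Hom C X Y; g \<in> Hom C Y Z\<rbrakk> \<Longrightarrow> g \<cdot> f \<in> Hom C X Z"
    and comp_ident: "f \<in> Hom C X Y \<Longrightarrow> f \<cdot> ident C X = f"
    and ident_comp: "f \<in> Hom C X Y \<Longrightarrow> ident C Y \<cdot> f = f"
    and comp_assoc: "\<lbrakk>f \<in> Hom C W X; g \<in> Hom C X Y; h \<in> Hom C Y Z\<rbrakk>
      \<Longrightarrow> (h \<cdot> g) \<cdot> f = h \<cdot> (g \<cdot> f)"

definition is_iso :: "('o, 'm, 'z) cat_struct_scheme \<Rightarrow> 'm \<Rightarrow> bool" where
  "is_iso C f \<longleftrightarrow> f \<in> Arr C \<and> (\<exists>g \<in> Hom C (tgt C f) (src C f).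
      g \<cdot>\<^bsub>C\<^esub> f = ident C (src C f) \<and> f \<cdot>\<^bsub>C\<^esub> g = ident C (tgt C f))"

definition is_zero_object :: "('o, 'm, 'z) cat_struct_scheme \<Rightarrow> 'o \<Rightarrow> bool" where
  "is_zero_object C Z \<longleftrightarrow>
     Z \<in> Ob C \<and> (\<forall>X \<in> Ob C. (\<exists>!f. f \<in> Hom C X Z) \<and> (\<exists>!f. f \<in> Hom C Z X))"

locale preadditive_category = category +
  assumes hom_comm_group: "\<lbrakk>X \<in> Ob C; Y \<in> Ob C\<rbrakk> \<Longrightarrow> comm_group (hom_group C X Y)"
    and comp_plus_left: "\<lbrakk>f \<in> Hom C X Y; g \<in> Hom C Y Z; g' \<in> Hom C Y Z\<rbrakk>
      \<Longrightarrow> plus_arr C g g' \<cdot> f = plus_arr C (g \<cdot> f) (g' \<cdot> f)"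
    and comp_plus_right: "\<lbrakk>f \<in> Hom C X Y; f' \<in> Hom C X Y; g \<in> Hom C Y Z\<rbrakk>
      \<Longrightarrow> g \<cdot> plus_arr C f f' = plus_arr C (g \<cdot> f) (g \<cdot> f')"

text \<open>\<open>B\<close> is the direct sum of \<open>X\<close> and \<open>Y\<close> with injections \<open>i, j\<close> and projections \<open>p, q\<close>.\<close>

definition is_biproduct ::
    "('o, 'm, 'z) cat_struct_scheme \<Rightarrow> 'o \<Rightarrow> 'o \<Rightarrow> 'o \<Rightarrow> 'm \<Rightarrow> 'm \<Rightarrow> 'm \<Rightarrow> 'm \<Rightarrow> bool" where
  "is_biproduct C X Y B i j p q \<longleftrightarrow>
     X \<in> Ob C \<and> Y \<in> Ob C \<and> B \<in> Ob C \<and>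
     i \<in> Hom C X B \<and> j \<in> Hom C Y B \<and> p \<in> Hom C B X \<and> q \<in> Hom C B Y \<and>
     p \<cdot>\<^bsub>C\<^esub> i = ident C X \<and> q \<cdot>\<^bsub>C\<^esub> j = ident C Y \<and>
     p \<cdot>\<^bsub>C\<^esub> j = zero_arr C Y X \<and> q \<cdot>\<^bsub>C\<^esub> i = zero_arr C X Y \<and>
     plus_arr C (i \<cdot>\<^bsub>C\<^esub> p) (j \<cdot>\<^bsub>C\<^esub> q) = ident C B"

locale additive_category = preadditive_category +
  assumes ex_zero_object: "\<exists>Z. is_zero_object C Z"
    and ex_biproduct: "\<lbrakk>X \<in> Ob C; Y \<in> Ob C\<rbrakk> \<Longrightarrow> \<exists>B i j p q. is_biproduct C X Y B i j p q"


section \<open>Triangulated categories\<close>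

record ('o, 'm) tri_struct = "('o, 'm) cat_struct" +
  susp :: "'o \<Rightarrow> 'o"
  susp_arr :: "'m \<Rightarrow> 'm"
  exact_tri :: "('m \<times> 'm \<times> 'm) set"

definition is_triangle :: "('o, 'm, 'z) tri_struct_scheme \<Rightarrow> 'm \<Rightarrow> 'm \<Rightarrow> 'm \<Rightarrow> bool" where
  "is_triangle T f g h \<longleftrightarrow> f \<in> Arr T \<and> g \<in> Arr T \<and> h \<in> Arr T \<and>
     tgt T f = src T g \<and> tgt T g = src T h \<and> tgt T h = susp T (src T f)"

text \<open>The suspension is an additive autoequivalence, not necessarily invertible on the nose.\<close>

locale suspended_category = additive_category T for T :: "('o, 'm, 'z) tri_struct_scheme" (structure) +
  assumes susp_Ob: "X \<in> Ob T \<Longrightarrow> susp T X \<in> Ob T"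
    and susp_bij: "\<lbrakk>X \<in> Ob T; Y \<in> Ob T\<rbrakk>
      \<Longrightarrow> bij_betw (susp_arr T) (Hom T X Y) (Hom T (susp T X) (susp T Y))"
    and susp_ident: "X \<in> Ob T \<Longrightarrow> susp_arr T (ident T X) = ident T (susp T X)"
    and susp_comp: "\<lbrakk>f \<in> Hom T X Y; g \<in> Hom T Y Z\<rbrakk>
      \<Longrightarrow> susp_arr T (g \<cdot> f) = susp_arr T g \<cdot> susp_arr T f"
    and susp_plus: "\<lbrakk>f \<in> Hom T X Y; g \<in> Hom T X Y\<rbrakk>
      \<Longrightarrow> susp_arr T (plus_arr T f g) = plus_arr T (susp_arr T f) (susp_arr T g)"
    and susp_ess_surj: "Y \<in> Ob T \<Longrightarrow> \<exists>X \<in> Ob T. \<exists>e \<in> Hom T (susp T X) Y. is_iso T e"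

locale triangulated_category = suspended_category +
  assumes exact_is_triangle: "(f, g, h) \<in> exact_tri T \<Longrightarrow> is_triangle T f g h"
    and TR1_iso: "\<lbrakk>(f, g, h) \<in> exact_tri T; is_triangle T f' g' h';
        a \<in> Hom T (src T f) (src T f'); b \<in> Hom T (src T g) (src T g');
        c \<in> Hom T (src T h) (src T h'); is_iso T a; is_iso T b; is_iso T c;
        b \<cdot> f = f' \<cdot> a; c \<cdot> g = g' \<cdot> b; susp_arr T a \<cdot> h = h' \<cdot> c\<rbrakk>
      \<Longrightarrow> (f', g', h') \<in> exact_tri T"
    and TR1_ident: "\<lbrakk>X \<in> Ob T; is_zero_object T Z\<rbrakk>
      \<Longrightarrow> (ident T X, zero_arr T X Z, zero_arr T Z (susp T X)) \<in> exact_tri T"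
    and TR1_ex: "f \<in> Arr T \<Longrightarrow> \<exists>g h. (f, g, h) \<in> exact_tri T"
    and TR2: "is_triangle T f g h
      \<Longrightarrow> (f, g, h) \<in> exact_tri T \<longleftrightarrow> (g, h, neg_arr T (susp_arr T f)) \<in> exact_tri T"
    and TR3: "\<lbrakk>(f, g, h) \<in> exact_tri T; (f', g', h') \<in> exact_tri T;
        a \<in> Hom T (src T f) (src T f'); b \<in> Hom T (src T g) (src T g'); b \<cdot> f = f' \<cdot> a\<rbrakk>
      \<Longrightarrow> \<exists>c \<in> Hom T (src T h) (src T h'). c \<cdot> g = g' \<cdot> b \<and> susp_arr T a \<cdot> h = h' \<cdot> c"
    and TR4: "\<lbrakk>(f1, f2, f3) \<in> exact_tri T; (g1, g2, g3) \<in> exact_tri T;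
        (h1, h2, h3) \<in> exact_tri T; tgt T f1 = src T g1; h1 = g1 \<cdot> f1\<rbrakk>
      \<Longrightarrow> \<exists>k1 k2 k3. (k1, k2, k3) \<in> exact_tri T \<and>
            k1 \<in> Hom T (tgt T f2) (tgt T h2) \<and> k2 \<in> Hom T (tgt T h2) (tgt T g2) \<and>
            k1 \<cdot> f2 = h2 \<cdot> g1 \<and> h3 \<cdot> k1 = f3 \<and>
            k2 \<cdot> h2 = g2 \<and> g3 \<cdot> k2 = susp_arr T f1 \<cdot> h3 \<and>
            k3 = susp_arr T f2 \<cdot> g3"


section \<open>Thick subcategories\<close>

text \<open>Full subcategories are given by their sets of objects.\<close>

definition triangulated_subcategory :: "('o, 'm, 'z) tri_struct_scheme \<Rightarrow> 'o set \<Rightarrow> bool" where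
  "triangulated_subcategory T S \<longleftrightarrow> S \<subseteq> Ob T \<and> (\<forall>Z. is_zero_object T Z \<longrightarrow> Z \<in> S) \<and>
     (\<forall>X \<in> Ob T. X \<in> S \<longleftrightarrow> susp T X \<in> S) \<and>
     (\<forall>(f, g, h) \<in> exact_tri T.
        (src T f \<in> S \<and> src T g \<in> S \<longrightarrow> src T h \<in> S) \<and>
        (src T g \<in> S \<and> src T h \<in> S \<longrightarrow> src T f \<in> S) \<and>
        (src T f \<in> S \<and> src T h \<in> S \<longrightarrow> src T g \<in> S))"

definition thick :: "('o, 'm, 'z) tri_struct_scheme \<Rightarrow> 'o set \<Rightarrow> bool" where
  "thick T S \<longleftrightarrow> triangulated_subcategory T S \<and>
     (\<forall>X Y B i j p q. is_biproduct T X Y B i j p q \<and> B \<in> S \<longrightarrow> X \<in> S)"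

definition thick_join :: "('o, 'm, 'z) tri_struct_scheme \<Rightarrow> 'o set \<Rightarrow> 'o set \<Rightarrow> 'o set" where
  "thick_join T U V = \<Inter>{S. thick T S \<and> U \<subseteq> S \<and> V \<subseteq> S}"

definition factors_through :: "('o, 'm, 'z) cat_struct_scheme \<Rightarrow> 'm \<Rightarrow> 'o set \<Rightarrow> bool" where
  "factors_through C f S \<longleftrightarrow>
     (\<exists>W \<in> S. \<exists>g \<in> Hom C (src C f) W. \<exists>h \<in> Hom C W (tgt C f). f = h \<cdot>\<^bsub>C\<^esub> g)"

definition commuting_pair :: "('o, 'm, 'z) tri_struct_scheme \<Rightarrow> 'o set \<Rightarrow> 'o set \<Rightarrow> bool" where
  "commuting_pair T U V \<longleftrightarrow>
     (\<forall>X \<in> U. \<forall>Y \<in> V. \<forall>f \<in> Hom T X Y \<union> Hom T Y X. factors_through T f (U \<inter> V))"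


section \<open>Verdier quotients\<close>

text \<open>
  A morphism from \<open>X\<close> to \<open>Y\<close> in the Verdier quotient is a class of fractions \<open>(s, f)\<close>,
  read as \<open>X \<leftarrow> X' \<rightarrow> Y\<close> with first leg \<open>s\<close> (a morphism whose cone lies in \<open>S\<close>) and second leg \<open>f\<close>.
\<close>

definition cone_in :: "('o, 'm, 'z) tri_struct_scheme \<Rightarrow> 'o set \<Rightarrow> 'm set" where
  "cone_in T S = {s. \<exists>g h. (s, g, h) \<in> exact_tri T \<and> tgt T g \<in> S}"

definition fractions ::
    "('o, 'm, 'z) tri_struct_scheme \<Rightarrow> 'o set \<Rightarrow> 'o \<Rightarrow> 'o \<Rightarrow> ('m \<times> 'm) set" where
  "fractions T S X Y = {(s, f). s \<in> cone_in T S \<and> f \<in> Arr T \<and>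
     src T s = src T f \<and> tgt T s = X \<and> tgt T f = Y}"

definition frac_equiv ::
    "('o, 'm, 'z) tri_struct_scheme \<Rightarrow> 'o set \<Rightarrow> 'm \<times> 'm \<Rightarrow> 'm \<times> 'm \<Rightarrow> bool" where
  "frac_equiv T S = (\<lambda>(s, f) (t, g). \<exists>W \<in> Ob T.
     \<exists>a \<in> Hom T W (src T s). \<exists>b \<in> Hom T W (src T t).
       s \<cdot>\<^bsub>T\<^esub> a = t \<cdot>\<^bsub>T\<^esub> b \<and> s \<cdot>\<^bsub>T\<^esub> a \<in> cone_in T S \<and> f \<cdot>\<^bsub>T\<^esub> a = g \<cdot>\<^bsub>T\<^esub> b)"

definition frac_class ::
    "('o, 'm, 'z) tri_struct_scheme \<Rightarrow> 'o set \<Rightarrow> 'm \<times> 'm \<Rightarrow> ('m \<times> 'm) set" where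
  "frac_class T S p =
     {q \<in> fractions T S (tgt T (fst p)) (tgt T (snd p)). frac_equiv T S p q}"

text \<open>
  Operations on classes are unions over representatives of the resulting classes, all of which
  coincide. Composition completes \<open>X' \<rightarrow> Y \<leftarrow> Y'\<close> to a commutative square whose leg into \<open>X'\<close> has
  its cone in \<open>S\<close>; addition brings two fractions to a common denominator.
\<close>

definition quot_comp :: "('o, 'm, 'z) tri_struct_scheme \<Rightarrow> 'o set \<Rightarrow>
    ('m \<times> 'm) set \<Rightarrow> ('m \<times> 'm) set \<Rightarrow> ('m \<times> 'm) set" where
  "quot_comp T S d c = \<Union>{frac_class T S (s \<cdot>\<^bsub>T\<^esub> t', g \<cdot>\<^bsub>T\<^esub> f') | s f t g t' f' W.
     (s, f) \<in> c \<and> (t, g) \<in> d \<and> t' \<in> Hom T W (src T f) \<and> t' \<in> cone_in T S \<and>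
     f' \<in> Hom T W (src T t) \<and> f \<cdot>\<^bsub>T\<^esub> t' = t \<cdot>\<^bsub>T\<^esub> f'}"

definition quot_plus :: "('o, 'm, 'z) tri_struct_scheme \<Rightarrow> 'o set \<Rightarrow>
    ('m \<times> 'm) set \<Rightarrow> ('m \<times> 'm) set \<Rightarrow> ('m \<times> 'm) set" where
  "quot_plus T S c d =
     \<Union>{frac_class T S (s \<cdot>\<^bsub>T\<^esub> a, plus_arr T (f \<cdot>\<^bsub>T\<^esub> a) (g \<cdot>\<^bsub>T\<^esub> b)) | s f t g a b W.
     (s, f) \<in> c \<and> (t, g) \<in> d \<and> a \<in> Hom T W (src T s) \<and> b \<in> Hom T W (src T t) \<and>
     s \<cdot>\<^bsub>T\<^esub> a = t \<cdot>\<^bsub>T\<^esub> b \<and> s \<cdot>\<^bsub>T\<^esub> a \<in> cone_in T S}"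

definition quot ::
    "('o, 'm, 'z) tri_struct_scheme \<Rightarrow> 'o set \<Rightarrow> ('o, ('m \<times> 'm) set) cat_struct" where
  "quot T S =
    \<lparr>Ob = Ob T,
     Arr = {frac_class T S p | p X Y. p \<in> fractions T S X Y},
     src = (\<lambda>c. THE X. \<exists>(s, f) \<in> c. X = tgt T s),
     tgt = (\<lambda>c. THE Y. \<exists>(s, f) \<in> c. Y = tgt T f),
     ident = (\<lambda>X. frac_class T S (ident T X, ident T X)),
     comp = quot_comp T S,
     plus_arr = quot_plus T S,
     zero_arr = (\<lambda>X Y. frac_class T S (ident T X, zero_arr T X Y))\<rparr>"

definition quot_functor ::
    "('o, 'm, 'z) tri_struct_scheme \<Rightarrow> 'o set \<Rightarrow> 'm \<Rightarrow> ('m \<times> 'm) set" where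
  "quot_functor T S f = frac_class T S (ident T (src T f), f)"

text \<open>
  For an inclusion of thick subcategories into \<open>S\<close>, the induced functor to the quotient by \<open>S\<close>
  is the identity on objects and on representing fractions.
\<close>

definition induced ::
    "('o, 'm, 'z) tri_struct_scheme \<Rightarrow> 'o set \<Rightarrow> ('m \<times> 'm) set \<Rightarrow> ('m \<times> 'm) set" where
  "induced T S c = (\<Union>p \<in> c. frac_class T S p)"


section \<open>Integral powers of the suspension\<close>

text \<open>Negative powers use a chosen quasi-inverse on objects, with a chosen isomorphism.\<close>

definition desusp :: "('o, 'm, 'z) tri_struct_scheme \<Rightarrow> 'o \<Rightarrow> 'o" where
  "desusp T Y = (SOME X. X \<in> Ob T \<and> (\<exists>e \<in> Hom T (susp T X) Y. is_iso T e))"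

definition susp_desusp_iso :: "('o, 'm, 'z) tri_struct_scheme \<Rightarrow> 'o \<Rightarrow> 'm" where
  "susp_desusp_iso T Y = (SOME e. e \<in> Hom T (susp T (desusp T Y)) Y \<and> is_iso T e)"

definition shift :: "('o, 'm, 'z) tri_struct_scheme \<Rightarrow> int \<Rightarrow> 'o \<Rightarrow> 'o" where
  "shift T n Y = (if n \<ge> 0 then (susp T ^^ nat n) Y else (desusp T ^^ nat (- n)) Y)"

text \<open>The isomorphism from \<open>susp T (shift T n Y)\<close> to \<open>shift T (n + 1) Y\<close>.\<close>

definition shift_iso :: "('o, 'm, 'z) tri_struct_scheme \<Rightarrow> int \<Rightarrow> 'o \<Rightarrow> 'm" where
  "shift_iso T n Y = (if n \<ge> 0 then ident T (shift T (n + 1) Y)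
     else susp_desusp_iso T (shift T (n + 1) Y))"


section \<open>The Mayer--Vietoris sequence\<close>

text \<open>Exactness of \<open>\<dots> \<rightarrow> A n \<rightarrow> B n \<rightarrow> C n \<rightarrow> A (n + 1) \<rightarrow> \<dots>\<close> as a sequence of abelian groups.\<close>

definition long_exact :: "(int \<Rightarrow> 'a monoid) \<Rightarrow> (int \<Rightarrow> 'b monoid) \<Rightarrow> (int \<Rightarrow> 'c monoid) \<Rightarrow>
    (int \<Rightarrow> 'a \<Rightarrow> 'b) \<Rightarrow> (int \<Rightarrow> 'b \<Rightarrow> 'c) \<Rightarrow> (int \<Rightarrow> 'c \<Rightarrow> 'a) \<Rightarrow> bool" where
  "long_exact A B C \<alpha> \<beta> \<delta> \<longleftrightarrow> (\<forall>n.
     comm_group (A n) \<and> comm_group (B n) \<and> comm_group (C n) \<and>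
     \<alpha> n \<in> hom (A n) (B n) \<and> \<beta> n \<in> hom (B n) (C n) \<and> \<delta> n \<in> hom (C n) (A (n + 1)) \<and>
     \<alpha> n ` carrier (A n) = kernel (B n) (C n) (\<beta> n) \<and>
     \<beta> n ` carrier (B n) = kernel (C n) (A (n + 1)) (\<delta> n) \<and>
     \<delta> n ` carrier (C n) = kernel (A (n + 1)) (B (n + 1)) (\<alpha> (n + 1)))"

definition mv_restrict :: "('o, 'm, 'z) tri_struct_scheme \<Rightarrow> 'o set \<Rightarrow> 'o set \<Rightarrow>
    ('m \<times> 'm) set \<Rightarrow> ('m \<times> 'm) set \<times> ('m \<times> 'm) set" where
  "mv_restrict T U V x = (induced T U x, induced T V x)"

definition mv_diff :: "('o, 'm, 'z) tri_struct_scheme \<Rightarrow> 'o set \<Rightarrow> 'o set \<Rightarrow>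
    ('m \<times> 'm) set \<times> ('m \<times> 'm) set \<Rightarrow> ('m \<times> 'm) set" where
  "mv_diff T U V = (\<lambda>(x, y). plus_arr (quot T (thick_join T U V))
     (induced T (thick_join T U V) x)
     (neg_arr (quot T (thick_join T U V)) (induced T (thick_join T U V) y)))"

text \<open>
  A candidate connecting morphism is a family of maps from \<open>Hom(X, Y)\<close> in the quotient by the join
  to \<open>Hom(X, \<Sigma>Y)\<close> in the quotient by the meet, natural in both arguments. (Naturality with respect
  to morphisms of \<open>T\<close> amounts to naturality with respect to morphisms of the quotient by the meet.)
\<close>

definition natural_connecting :: "('o, 'm, 'z) tri_struct_scheme \<Rightarrow> 'o set \<Rightarrow> 'o set \<Rightarrow>
    ('o \<Rightarrow> 'o \<Rightarrow> ('m \<times> 'm) set \<Rightarrow> ('m \<times> 'm) set) \<Rightarrow> bool" where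
  "natural_connecting T U V \<delta> \<longleftrightarrow>
     (let M = U \<inter> V; J = thick_join T U V in
      (\<forall>X \<in> Ob T. \<forall>Y \<in> Ob T.
         \<delta> X Y \<in> hom (hom_group (quot T J) X Y) (hom_group (quot T M) X (susp T Y))) \<and>
      (\<forall>X \<in> Ob T. \<forall>X' \<in> Ob T. \<forall>Y \<in> Ob T. \<forall>Y' \<in> Ob T.
       \<forall>a \<in> Hom T X' X. \<forall>b \<in> Hom T Y Y'. \<forall>x \<in> Hom (quot T J) X Y.
         \<delta> X' Y' (quot_functor T J b \<cdot>\<^bsub>quot T J\<^esub> x \<cdot>\<^bsub>quot T J\<^esub> quot_functor T J a) =
         quot_functor T M (susp_arr T b) \<cdot>\<^bsub>quot T M\<^esub> \<delta> X Y x \<cdot>\<^bsub>quot T M\<^esub> quot_functor T M a))"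

text \<open>
  The connecting maps in all degrees come from the one family \<open>\<delta>\<close>, evaluated at the shifts of \<open>Y\<close>.
\<close>

definition mayer_vietoris_exact :: "('o, 'm, 'z) tri_struct_scheme \<Rightarrow> 'o set \<Rightarrow> 'o set \<Rightarrow>
    ('o \<Rightarrow> 'o \<Rightarrow> ('m \<times> 'm) set \<Rightarrow> ('m \<times> 'm) set) \<Rightarrow> 'o \<Rightarrow> 'o \<Rightarrow> bool" where
  "mayer_vietoris_exact T U V \<delta> X Y \<longleftrightarrow>
     long_exact
       (\<lambda>n. hom_group (quot T (U \<inter> V)) X (shift T n Y))
       (\<lambda>n. hom_group (quot T U) X (shift T n Y) \<times>\<times> hom_group (quot T V) X (shift T n Y))
       (\<lambda>n. hom_group (quot T (thick_join T U V)) X (shift T n Y))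
       (\<lambda>n. mv_restrict T U V)
       (\<lambda>n. mv_diff T U V)
       (\<lambda>n x. quot_functor T (U \<inter> V) (shift_iso T n Y) \<cdot>\<^bsub>quot T (U \<inter> V)\<^esub> \<delta> X (shift T n Y) x)"

end

(*
  Write M, J for the meet and the join, and S(A) for the morphisms with cone in A.
  Commutation lets one swap factors, S(U) S(V) = S(V) S(U), by the octahedral axiom; hence the objects
  fitting into triangles  V' -> E -> U'  form a triangulated subcategory, J consists of their retracts,
  and the products p = u a = v b (u, b in S(U), a, v in S(V)) are cofinal in S(J).
  In T/M there are no nonzero maps between U and V, so every E in J carries a unique endomorphism e_E in
  T/M such that e_E factors through V and 1 - e_E through U, and e_E is natural in E.  For a fraction
  f s^-1 with exact triangle  s, q: X -> E, h: E -> Sigma X'  the connecting map is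
  Sigma f . h . e_E . q.  Naturality of e makes it well defined and natural, and exactness follows by
  evaluating it on the cofinal p = u a = v b, using that Hom in T/M is cohomological.
  Conversely, a map f between U and V dies in T/U and T/V, so by exactness it comes from a Hom group of
  T/J with one argument in J, which is zero; so f vanishes in T/M, that is, it factors through M.
*)
theory Submission
  imports Defs
begin

text \<open>T/M is never shown to be triangulated. Two facts replace that structure: the quotient
  functor sends an exact triangle to a sequence of weak cokernels, and the suspension is fully
  faithful on T/M, so that extensions found one suspension up can be brought back down. The obvious
  recipe for the connecting map, to write p = u a = v b and use the cones of a and v, depends on the
  chosen square. The endomorphism e_E removes the choice: J/M behaves like the product of U/M and
  V/M, e_E is the projection to the second factor, and every morphism commutes with it because its
  components from U to V and from V to U vanish. Hence any of the non-unique fillers given by TR3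
  will do. The explicit square returns only as a formula for evaluating the connecting map when
  exactness is proved. The suspension is only essentially surjective on objects. Fibres are
  therefore built after replacing a cone by an isomorphic suspended object.\<close>

notation plus_arr (infixl "\<boxplus>\<index>" 65)
notation zero_arr ("\<zero>\<index>")

section \<open>Computing with typed arrows\<close>

lemma Hom_iff: "f \<in> Hom C X Y \<longleftrightarrow> f \<in> Arr C \<and> src C f = X \<and> tgt C f = Y"
  by (simp add: Hom_def)

context category
begin

lemma comp_Arr [simp]: "\<lbrakk>f \<in> Arr C; g \<in> Arr C; tgt C f = src C g\<rbrakk> \<Longrightarrow> g \<cdot> f \<in> Arr C"
  and src_comp [simp]: "\<lbrakk>f \<in> Arr C; g \<in> Arr C; tgt C f = src C g\<rbrakk> \<Longrightarrow> src C (g \<cdot> f) = src C f"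
  and tgt_comp [simp]: "\<lbrakk>f \<in> Arr C; g \<in> Arr C; tgt C f = src C g\<rbrakk> \<Longrightarrow> tgt C (g \<cdot> f) = tgt C g"
  using comp_Hom[of f "src C f" "tgt C f" g "tgt C g"] by (auto simp: Hom_iff)

lemma ident_Arr [simp]: "X \<in> Ob C \<Longrightarrow> ident C X \<in> Arr C"
  and src_ident [simp]: "X \<in> Ob C \<Longrightarrow> src C (ident C X) = X"
  and tgt_ident [simp]: "X \<in> Ob C \<Longrightarrow> tgt C (ident C X) = X"
  using ident_Hom[of X] by (auto simp: Hom_iff)

lemma comp_ident_Arr [simp]: "\<lbrakk>f \<in> Arr C; src C f = X\<rbrakk> \<Longrightarrow> f \<cdot> ident C X = f"
  and ident_comp_Arr [simp]: "\<lbrakk>f \<in> Arr C; tgt C f = X\<rbrakk> \<Longrightarrow> ident C X \<cdot> f = f"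
  using comp_ident[of f "src C f" "tgt C f"] ident_comp[of f "src C f" "tgt C f"]
  by (auto simp: Hom_iff)

lemma comp_assoc_Arr [simp]:
  "\<lbrakk>f \<in> Arr C; g \<in> Arr C; h \<in> Arr C; tgt C f = src C g; tgt C g = src C h\<rbrakk>
    \<Longrightarrow> (h \<cdot> g) \<cdot> f = h \<cdot> (g \<cdot> f)"
  using comp_assoc[of f "src C f" "src C g" g "src C h" h "tgt C h"] by (auto simp: Hom_iff)

declare src_Ob [simp] tgt_Ob [simp]

text \<open>The simplifier nests composites to the right, which hides a known composite
  \<open>h \<cdot> g\<close> inside \<open>h \<cdot> (g \<cdot> f)\<close>; this form of the rule
  finds it there.\<close>

lemma comp_reduce:
  "\<lbrakk>h \<cdot> g = k; f \<in> Arr C; g \<in> Arr C; h \<in> Arr C; tgt C f = src C g; tgt C g = src C h\<rbrakk>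
    \<Longrightarrow> h \<cdot> (g \<cdot> f) = k \<cdot> f"
  by (metis comp_assoc_Arr)

lemma is_isoE:
  assumes "is_iso C e"
  obtains e' where "e' \<in> Arr C" "src C e' = tgt C e" "tgt C e' = src C e"
    "e' \<cdot> e = ident C (src C e)" "e \<cdot> e' = ident C (tgt C e)"
  using assms by (auto simp: is_iso_def Hom_iff)

lemma is_isoI:
  "\<lbrakk>e \<in> Arr C; e' \<in> Arr C; src C e' = tgt C e; tgt C e' = src C e;
    e' \<cdot> e = ident C (src C e); e \<cdot> e' = ident C (tgt C e)\<rbrakk> \<Longrightarrow> is_iso C e"
  by (auto simp: is_iso_def Hom_iff)

lemma is_iso_Arr [simp]: "is_iso C e \<Longrightarrow> e \<in> Arr C"
  by (simp add: is_iso_def)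

lemma is_iso_ident [simp]: "X \<in> Ob C \<Longrightarrow> is_iso C (ident C X)"
  by (rule is_isoI[where e' = "ident C X"]) auto

lemma iso_cancel_right:
  assumes "is_iso C e" "f \<in> Arr C" "g \<in> Arr C" "src C f = tgt C e" "src C g = tgt C e" "f \<cdot> e = g \<cdot> e"
  shows "f = g"
proof -
  obtain e' where e': "e' \<in> Arr C" "src C e' = tgt C e" "tgt C e' = src C e" "e \<cdot> e' = ident C (tgt C e)"
    using assms(1) by (rule is_isoE)
  have "(f \<cdot> e) \<cdot> e' = (g \<cdot> e) \<cdot> e'"
    by (simp only: assms(6))
  then show ?thesis using assms(1-5) e' by simp
qed

lemma iso_cancel_left:
  assumes "is_iso C e" "f \<in> Arr C" "g \<in> Arr C" "tgt C f = src C e" "tgt C g = src C e" "e \<cdot> f = e \<cdot> g"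
  shows "f = g"
proof -
  obtain e' where e': "e' \<in> Arr C" "src C e' = tgt C e" "tgt C e' = src C e" "e' \<cdot> e = ident C (src C e)"
    using assms(1) by (rule is_isoE)
  have "(e' \<cdot> e) \<cdot> f = (e' \<cdot> e) \<cdot> g"
    using assms e'(1-3) by simp
  then show ?thesis using assms e' by simp
qed

lemma zero_object_Ob [simp]: "is_zero_object C Z \<Longrightarrow> Z \<in> Ob C"
  by (simp add: is_zero_object_def)

lemma zero_object_unique_to:
  "\<lbrakk>is_zero_object C (tgt C f); f \<in> Arr C; g \<in> Arr C; src C f = src C g; tgt C f = tgt C g\<rbrakk> \<Longrightarrow> f = g"
  unfolding is_zero_object_def Hom_iff by (metis src_Ob)

end

section \<open>Arithmetic in the groups of morphisms\<close>

context preadditive_category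
begin

lemma hom_group_simps [simp]:
  "carrier (hom_group C X Y) = Hom C X Y" "mult (hom_group C X Y) = plus_arr C"
  "one (hom_group C X Y) = \<zero> X Y"
  by (simp_all add: hom_group_def)

lemma zero_Arr [simp]: "\<lbrakk>X \<in> Ob C; Y \<in> Ob C\<rbrakk> \<Longrightarrow> \<zero> X Y \<in> Arr C"
  and src_zero [simp]: "\<lbrakk>X \<in> Ob C; Y \<in> Ob C\<rbrakk> \<Longrightarrow> src C (\<zero> X Y) = X"
  and tgt_zero [simp]: "\<lbrakk>X \<in> Ob C; Y \<in> Ob C\<rbrakk> \<Longrightarrow> tgt C (\<zero> X Y) = Y"
  using monoid.one_closed[OF comm_group.axioms(2)[OF hom_comm_group, THEN group.is_monoid], of X Y]
  by (auto simp: Hom_iff)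

lemma hom_group_group: "\<lbrakk>X \<in> Ob C; Y \<in> Ob C\<rbrakk> \<Longrightarrow> group (hom_group C X Y)"
  using hom_comm_group comm_group.axioms(2) by blast

lemma plus_Arr [simp]: "\<lbrakk>f \<in> Arr C; g \<in> Arr C; src C f = src C g; tgt C f = tgt C g\<rbrakk> \<Longrightarrow> f \<boxplus> g \<in> Arr C"
  and src_plus [simp]: "\<lbrakk>f \<in> Arr C; g \<in> Arr C; src C f = src C g; tgt C f = tgt C g\<rbrakk> \<Longrightarrow> src C (f \<boxplus> g) = src C f"
  and tgt_plus [simp]: "\<lbrakk>f \<in> Arr C; g \<in> Arr C; src C f = src C g; tgt C f = tgt C g\<rbrakk> \<Longrightarrow> tgt C (f \<boxplus> g) = tgt C f"
  using monoid.m_closed[OF group.is_monoid[OF hom_group_group], of "src C f" "tgt C f" f g]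
  by (auto simp: Hom_iff)

lemma neg_Arr [simp]: "f \<in> Arr C \<Longrightarrow> neg_arr C f \<in> Arr C"
  and src_neg [simp]: "f \<in> Arr C \<Longrightarrow> src C (neg_arr C f) = src C f"
  and tgt_neg [simp]: "f \<in> Arr C \<Longrightarrow> tgt C (neg_arr C f) = tgt C f"
  using group.inv_closed[OF hom_group_group, of "src C f" "tgt C f" f]
  by (auto simp: Hom_iff neg_arr_def)

lemma plus_assoc:
  "\<lbrakk>f \<in> Arr C; g \<in> Arr C; h \<in> Arr C; src C f = src C g; tgt C f = tgt C g; src C h = src C g; tgt C h = tgt C g\<rbrakk>
    \<Longrightarrow> (f \<boxplus> g) \<boxplus> h = f \<boxplus> (g \<boxplus> h)"
  using monoid.m_assoc[OF group.is_monoid[OF hom_group_group], of "src C f" "tgt C f" f g h]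
  by (auto simp: Hom_iff)

lemma plus_comm:
  "\<lbrakk>f \<in> Arr C; g \<in> Arr C; src C f = src C g; tgt C f = tgt C g\<rbrakk> \<Longrightarrow> f \<boxplus> g = g \<boxplus> f"
  using comm_monoid.m_comm[OF comm_group.axioms(1)[OF hom_comm_group], of "src C f" "tgt C f" f g]
  by (auto simp: Hom_iff)

lemma plus_zero [simp]: "\<lbrakk>f \<in> Arr C; src C f = X; tgt C f = Y\<rbrakk> \<Longrightarrow> f \<boxplus> \<zero> X Y = f"
  and zero_plus [simp]: "\<lbrakk>f \<in> Arr C; src C f = X; tgt C f = Y\<rbrakk> \<Longrightarrow> \<zero> X Y \<boxplus> f = f"
  using monoid.r_one[OF group.is_monoid[OF hom_group_group], of "src C f" "tgt C f" f]
   monoid.l_one[OF group.is_monoid[OF hom_group_group], of "src C f" "tgt C f" f]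
  by (auto simp: Hom_iff)

lemma plus_neg [simp]: "f \<in> Arr C \<Longrightarrow> f \<boxplus> neg_arr C f = \<zero> (src C f) (tgt C f)"
  and neg_plus [simp]: "f \<in> Arr C \<Longrightarrow> neg_arr C f \<boxplus> f = \<zero> (src C f) (tgt C f)"
  using group.r_inv[OF hom_group_group, of "src C f" "tgt C f" f]
   group.l_inv[OF hom_group_group, of "src C f" "tgt C f" f]
  by (auto simp: Hom_iff neg_arr_def)

lemma plus_left_comm:
  "\<lbrakk>f \<in> Arr C; g \<in> Arr C; h \<in> Arr C; src C f = src C g; tgt C f = tgt C g; src C h = src C g; tgt C h = tgt C g\<rbrakk>
    \<Longrightarrow> f \<boxplus> (g \<boxplus> h) = g \<boxplus> (f \<boxplus> h)"
  by (metis plus_assoc plus_comm)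

lemmas plus_ac = plus_assoc plus_comm plus_left_comm

lemma neg_eqI:
  assumes "f \<in> Arr C" "g \<in> Arr C" "src C f = src C g" "tgt C f = tgt C g"
    "f \<boxplus> g = \<zero> (src C f) (tgt C f)"
  shows "neg_arr C f = g"
proof -
  have "neg_arr C f \<boxplus> (f \<boxplus> g) = g"
    using assms(1-4) by (simp add: plus_assoc[symmetric])
  then show ?thesis using assms by simp
qed

lemma neg_neg [simp]: "f \<in> Arr C \<Longrightarrow> neg_arr C (neg_arr C f) = f"
  by (rule neg_eqI) auto

lemma diff_eq_zero_iff:
  assumes "f \<in> Arr C" "g \<in> Arr C" "src C f = src C g" "tgt C f = tgt C g"
  shows "f \<boxplus> neg_arr C g = \<zero> (src C f) (tgt C f) \<longleftrightarrow> f = g"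
proof
  assume "f \<boxplus> neg_arr C g = \<zero> (src C f) (tgt C f)"
  then have "f \<boxplus> neg_arr C g \<boxplus> g = g" using assms by simp
  then show "f = g" using assms by (simp add: plus_assoc)
qed (use assms in simp)

lemma diff_plus_cancel [simp]:
  "\<lbrakk>f \<in> Arr C; g \<in> Arr C; src C f = src C g; tgt C f = tgt C g\<rbrakk> \<Longrightarrow> f \<boxplus> neg_arr C g \<boxplus> g = f"
  by (simp add: plus_assoc)

text \<open>Turns additivity into preservation of zero: an additive operation sends 0 to some f with
  f + f = f.\<close>

lemma idempotent_zero: "\<lbrakk>f \<in> Arr C; f \<boxplus> f = f\<rbrakk> \<Longrightarrow> f = \<zero> (src C f) (tgt C f)"
  by (metis plus_assoc plus_neg neg_Arr plus_zero src_neg tgt_neg)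

lemma comp_plus_dist_right:
  "\<lbrakk>f \<in> Arr C; g \<in> Arr C; g' \<in> Arr C; src C g = tgt C f; src C g' = src C g; tgt C g' = tgt C g\<rbrakk>
    \<Longrightarrow> (g \<boxplus> g') \<cdot> f = g \<cdot> f \<boxplus> g' \<cdot> f"
  using comp_plus_left[of f "src C f" "tgt C f" g "tgt C g" g'] by (simp add: Hom_iff)

lemma comp_plus_dist_left:
  "\<lbrakk>g \<in> Arr C; f \<in> Arr C; f' \<in> Arr C; src C g = tgt C f; src C f' = src C f; tgt C f' = tgt C f\<rbrakk>
    \<Longrightarrow> g \<cdot> (f \<boxplus> f') = g \<cdot> f \<boxplus> g \<cdot> f'"
  using comp_plus_right[of f "src C f" "tgt C f" f' g "tgt C g"] by (simp add: Hom_iff)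

lemma zero_comp [simp]:
  assumes "f \<in> Arr C" "tgt C f = X" "Y \<in> Ob C" shows "\<zero> X Y \<cdot> f = \<zero> (src C f) Y"
proof -
  have X: "X \<in> Ob C" using assms by auto
  have "\<zero> X Y \<cdot> f \<boxplus> \<zero> X Y \<cdot> f = \<zero> X Y \<cdot> f"
    using assms X comp_plus_dist_right[of f "\<zero> X Y" "\<zero> X Y"] by simp
  from idempotent_zero[OF _ this] show ?thesis using assms X by simp
qed

lemma comp_zero [simp]:
  assumes "f \<in> Arr C" "src C f = Y" "X \<in> Ob C" shows "f \<cdot> \<zero> X Y = \<zero> X (tgt C f)"
proof -
  have Y: "Y \<in> Ob C" using assms by auto
  have "f \<cdot> \<zero> X Y \<boxplus> f \<cdot> \<zero> X Y = f \<cdot> \<zero> X Y"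
    using assms Y comp_plus_dist_left[of f "\<zero> X Y" "\<zero> X Y"] by simp
  from idempotent_zero[OF _ this] show ?thesis using assms Y by simp
qed

lemma neg_comp: "\<lbrakk>f \<in> Arr C; g \<in> Arr C; tgt C f = src C g\<rbrakk> \<Longrightarrow> neg_arr C g \<cdot> f = neg_arr C (g \<cdot> f)"
  by (rule neg_eqI[symmetric]) (auto simp: comp_plus_dist_right[symmetric])

lemma comp_neg: "\<lbrakk>f \<in> Arr C; g \<in> Arr C; tgt C f = src C g\<rbrakk> \<Longrightarrow> g \<cdot> neg_arr C f = neg_arr C (g \<cdot> f)"
  by (rule neg_eqI[symmetric]) (auto simp: comp_plus_dist_left[symmetric])

lemma neg_zero [simp]: "\<lbrakk>X \<in> Ob C; Y \<in> Ob C\<rbrakk> \<Longrightarrow> neg_arr C (\<zero> X Y) = \<zero> X Y"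
  by (rule neg_eqI) auto

lemma neg_inject: "\<lbrakk>f \<in> Arr C; g \<in> Arr C; neg_arr C f = neg_arr C g\<rbrakk> \<Longrightarrow> f = g"
  by (metis neg_neg)

lemma eq_zero_if_neg_zero:
  "\<lbrakk>f \<in> Arr C; neg_arr C f = \<zero> X Y; X \<in> Ob C; Y \<in> Ob C\<rbrakk> \<Longrightarrow> f = \<zero> X Y"
  by (metis neg_neg neg_zero)

lemma ident_zero_imp_zero:
  assumes "ident C (src C f) = \<zero> (src C f) (src C f) \<or> ident C (tgt C f) = \<zero> (tgt C f) (tgt C f)" "f \<in> Arr C"
  shows "f = \<zero> (src C f) (tgt C f)"
  using assms by (metis comp_ident_Arr ident_comp_Arr comp_zero zero_comp src_Ob tgt_Ob)

lemma zero_object_iff_ident: "X \<in> Ob C \<Longrightarrow> is_zero_object C X \<longleftrightarrow> ident C X = \<zero> X X"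
proof
  assume X: "X \<in> Ob C" "is_zero_object C X"
  then show "ident C X = \<zero> X X" by (auto intro: zero_object_unique_to)
next
  assume X: "X \<in> Ob C" "ident C X = \<zero> X X"
  have "f = \<zero> X Y" if "f \<in> Arr C" "src C f = X" "tgt C f = Y" for f Y
    using that X ident_zero_imp_zero[of f] by simp
  moreover have "f = \<zero> Y X" if "f \<in> Arr C" "src C f = Y" "tgt C f = X" for f Y
    using that X ident_zero_imp_zero[of f] by simp
  ultimately show "is_zero_object C X"
    unfolding is_zero_object_def Hom_iff using X
    by (metis zero_Arr src_zero tgt_zero)
qed

text \<open>With n = x - 1 of square zero, x = 1 + n has the inverse 1 - n.\<close>

lemma is_iso_unipotent:
  assumes "x \<in> Arr C" "src C x = X" "tgt C x = X"
    and sq: "(x \<boxplus> neg_arr C (ident C X)) \<cdot> (x \<boxplus> neg_arr C (ident C X)) = \<zero> X X"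
  shows "is_iso C x"
proof -
  have X: "X \<in> Ob C" using assms by auto
  define n where "n = x \<boxplus> neg_arr C (ident C X)"
  have n: "n \<in> Arr C" "src C n = X" "tgt C n = X" using assms X by (auto simp: n_def)
  have x: "x = n \<boxplus> ident C X" unfolding n_def using assms X by simp
  have nn: "n \<cdot> n = \<zero> X X" using sq by (simp add: n_def)
  have nn1: "n \<boxplus> (ident C X \<boxplus> neg_arr C n) = ident C X"
    using plus_left_comm[of n "ident C X" "neg_arr C n"] n X by simp
  have l: "(ident C X \<boxplus> neg_arr C n) \<cdot> x = ident C X" and r: "x \<cdot> (ident C X \<boxplus> neg_arr C n) = ident C X"
    using n X nn by (simp_all add: x comp_plus_dist_right comp_plus_dist_left neg_comp comp_neg plus_assoc nn1)
  show ?thesis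
    by (rule is_isoI[where e' = "ident C X \<boxplus> neg_arr C n"]) (use l r assms n X in auto)
qed

end

section \<open>Exact triangles\<close>

context suspended_category
begin

lemma susp_arr_Hom: "f \<in> Arr T \<Longrightarrow> susp_arr T f \<in> Hom T (susp T (src T f)) (susp T (tgt T f))"
  using susp_bij[of "src T f" "tgt T f"] by (auto simp: bij_betw_def Hom_iff)

lemma susp_Arr [simp]: "f \<in> Arr T \<Longrightarrow> susp_arr T f \<in> Arr T"
  and src_susp [simp]: "f \<in> Arr T \<Longrightarrow> src T (susp_arr T f) = susp T (src T f)"
  and tgt_susp [simp]: "f \<in> Arr T \<Longrightarrow> tgt T (susp_arr T f) = susp T (tgt T f)"
  using susp_arr_Hom[of f] by (auto simp: Hom_iff)

declare susp_Ob [simp] susp_ident [simp]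

lemma susp_arr_comp [simp]:
  "\<lbrakk>f \<in> Arr T; g \<in> Arr T; tgt T f = src T g\<rbrakk> \<Longrightarrow> susp_arr T (g \<cdot> f) = susp_arr T g \<cdot> susp_arr T f"
  using susp_comp[of f "src T f" "tgt T f" g "tgt T g"] by (simp add: Hom_iff)

lemma susp_arr_plus [simp]:
  "\<lbrakk>f \<in> Arr T; g \<in> Arr T; src T f = src T g; tgt T f = tgt T g\<rbrakk>
    \<Longrightarrow> susp_arr T (f \<boxplus> g) = susp_arr T f \<boxplus> susp_arr T g"
  using susp_plus[of f "src T f" "tgt T f" g] by (simp add: Hom_iff)

lemma susp_arr_zero [simp]:
  assumes "X \<in> Ob T" "Y \<in> Ob T" shows "susp_arr T (\<zero> X Y) = \<zero> (susp T X) (susp T Y)"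
proof -
  have "susp_arr T (\<zero> X Y) \<boxplus> susp_arr T (\<zero> X Y) = susp_arr T (\<zero> X Y)"
    using assms susp_arr_plus[of "\<zero> X Y" "\<zero> X Y"] by simp
  from idempotent_zero[OF _ this] show ?thesis using assms by simp
qed

lemma susp_faithful:
  "\<lbrakk>susp_arr T f = susp_arr T g; f \<in> Arr T; g \<in> Arr T; src T f = src T g; tgt T f = tgt T g\<rbrakk> \<Longrightarrow> f = g"
  using susp_bij[of "src T f" "tgt T f"] by (auto simp: bij_betw_def Hom_iff inj_on_def)

lemma susp_full:
  assumes "g \<in> Arr T" "src T g = susp T X" "tgt T g = susp T Y" "X \<in> Ob T" "Y \<in> Ob T"
  obtains f where "f \<in> Arr T" "src T f = X" "tgt T f = Y" "g = susp_arr T f"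
proof -
  have "g \<in> susp_arr T ` Hom T X Y"
    using susp_bij[of X Y] assms by (auto simp: bij_betw_def Hom_iff)
  then show thesis using that by (auto simp: Hom_iff)
qed

lemma susp_zero_object_iff: "X \<in> Ob T \<Longrightarrow> is_zero_object T (susp T X) \<longleftrightarrow> is_zero_object T X"
  using susp_faithful[of "ident T X" "\<zero> X X"] susp_arr_zero[of X X] susp_ident[of X]
  by (auto simp: zero_object_iff_ident simp del: susp_arr_zero susp_ident)

lemma susp_desusp_ex:
  assumes "Y \<in> Ob T"
  obtains X e where "X \<in> Ob T" "e \<in> Arr T" "src T e = susp T X" "tgt T e = Y" "is_iso T e"
  using susp_ess_surj[OF assms] by (auto simp: Hom_iff)

end

section \<open>Weak kernels, weak cokernels and fibres\<close>

context triangulated_category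
begin

lemma exactD:
  assumes "(f, g, h) \<in> exact_tri T"
  shows "f \<in> Arr T" "g \<in> Arr T" "h \<in> Arr T" "src T g = tgt T f" "src T h = tgt T g" "tgt T h = susp T (src T f)"
  using exact_is_triangle[OF assms] by (auto simp: is_triangle_def)

lemma TR3_fill:
  assumes "(f, g, h) \<in> exact_tri T" "(f', g', h') \<in> exact_tri T"
    "a \<in> Arr T" "src T a = src T f" "tgt T a = src T f'"
    "b \<in> Arr T" "src T b = tgt T f" "tgt T b = tgt T f'" "b \<cdot> f = f' \<cdot> a"
  obtains c where "c \<in> Arr T" "src T c = tgt T g" "tgt T c = tgt T g'"
    "c \<cdot> g = g' \<cdot> b" "h' \<cdot> c = susp_arr T a \<cdot> h"
proof -
  have "\<exists>c \<in> Hom T (src T h) (src T h'). c \<cdot> g = g' \<cdot> b \<and> susp_arr T a \<cdot> h = h' \<cdot> c"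
    by (rule TR3[OF assms(1,2)]) (use assms exactD[OF assms(1)] exactD[OF assms(2)] in \<open>simp_all add: Hom_iff\<close>)
  then obtain c where "c \<in> Hom T (src T h) (src T h')" "c \<cdot> g = g' \<cdot> b" "susp_arr T a \<cdot> h = h' \<cdot> c"
    by blast
  then show thesis
    using exactD[OF assms(1)] exactD[OF assms(2)] by (intro that[of c]) (simp_all add: Hom_iff)
qed

lemma rotate:
  assumes "(f, g, h) \<in> exact_tri T" shows "(g, h, neg_arr T (susp_arr T f)) \<in> exact_tri T"
  using TR2[OF exact_is_triangle[OF assms]] assms by simp

lemma unrotate:
  assumes "(g, h, neg_arr T (susp_arr T f)) \<in> exact_tri T" "f \<in> Arr T" "src T g = tgt T f" "tgt T h = susp T (src T f)"
  shows "(f, g, h) \<in> exact_tri T"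
  using TR2[of f g h] assms exactD[OF assms(1)] by (simp add: is_triangle_def)

lemma zero_object_ex: obtains O' where "is_zero_object T O'" "O' \<in> Ob T"
  using ex_zero_object zero_object_Ob by blast

text \<open>The identity triangle rotated backwards. Against it, TR3 turns a map out of the second
  object that vanishes on the first into a map out of the cone.\<close>

lemma exact_zero_ident:
  assumes "W \<in> Ob T" "is_zero_object T O'"
  shows "(\<zero> O' W, ident T W, \<zero> W (susp T O')) \<in> exact_tri T"
proof (rule unrotate)
  have "is_zero_object T (susp T O')" using assms by (simp add: susp_zero_object_iff)
  from TR1_ident[OF assms(1) this]
  show "(ident T W, \<zero> W (susp T O'), neg_arr T (susp_arr T (\<zero> O' W))) \<in> exact_tri T"
    using assms by simp
qed (use assms in auto)

text \<open>The identity and f map the triangle X = X -> 0 to the given one, so g f factors through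
  a zero object.\<close>

lemma exact_comp_zero1:
  assumes "(f, g, h) \<in> exact_tri T" shows "g \<cdot> f = \<zero> (src T f) (tgt T g)"
proof -
  note [simp] = exactD[OF assms]
  obtain O' where O': "is_zero_object T O'" "O' \<in> Ob T" by (rule zero_object_ex)
  let ?X = "src T f"
  have X: "?X \<in> Ob T" by simp
  obtain c where "c \<in> Arr T" "src T c = O'" "tgt T c = tgt T g" "c \<cdot> \<zero> ?X O' = g \<cdot> f"
    by (rule TR3_fill[OF TR1_ident[OF X O'(1)] assms, of "ident T ?X" f]) (use O' in simp_all)
  then show ?thesis using O' by auto
qed

lemma exact_comp_zero2:
  assumes "(f, g, h) \<in> exact_tri T" shows "h \<cdot> g = \<zero> (src T g) (tgt T h)"
  using exact_comp_zero1[OF rotate[OF assms]] exactD[OF assms] by simp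

lemma exact_comp_zero3:
  assumes "(f, g, h) \<in> exact_tri T" shows "susp_arr T f \<cdot> h = \<zero> (src T h) (susp T (tgt T f))"
proof -
  note [simp] = exactD[OF assms]
  have "neg_arr T (susp_arr T f) \<cdot> h = \<zero> (src T h) (susp T (tgt T f))"
    using exact_comp_zero2[OF rotate[OF assms]] by simp
  then have "neg_arr T (susp_arr T f \<cdot> h) = \<zero> (src T h) (susp T (tgt T f))"
    by (simp add: neg_comp)
  then show ?thesis by (rule eq_zero_if_neg_zero[rotated]) auto
qed

lemma weak_cokernel:
  assumes "(f, g, h) \<in> exact_tri T" "k \<in> Arr T" "src T k = tgt T f" "k \<cdot> f = \<zero> (src T f) (tgt T k)"
  obtains k' where "k' \<in> Arr T" "src T k' = tgt T g" "tgt T k' = tgt T k" "k' \<cdot> g = k"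
proof -
  note [simp] = exactD[OF assms(1)] assms(2-4)
  obtain O' where O': "is_zero_object T O'" "O' \<in> Ob T" by (rule zero_object_ex)
  let ?W = "tgt T k"
  have W: "?W \<in> Ob T" by simp
  obtain c where "c \<in> Arr T" "src T c = tgt T g" "tgt T c = ?W" "c \<cdot> g = ident T ?W \<cdot> k"
    by (rule TR3_fill[OF assms(1) exact_zero_ident[OF W O'(1)], of "\<zero> (src T f) O'" k]) (use O' in simp_all)
  then show thesis by (intro that[of c]) simp_all
qed

text \<open>TR3 only fills in the third map, so the triangle is rotated and compared with W -> 0 ->
  \<Sigma>W; the filler is a map between suspensions and desuspends by fullness.\<close>

lemma weak_kernel:
  assumes "(f, g, h) \<in> exact_tri T" "k \<in> Arr T" "tgt T k = tgt T f" "g \<cdot> k = \<zero> (src T k) (tgt T g)"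
  obtains k' where "k' \<in> Arr T" "src T k' = src T k" "tgt T k' = src T f" "f \<cdot> k' = k"
proof -
  note [simp] = exactD[OF assms(1)] assms(2-4)
  obtain O' where O': "is_zero_object T O'" "O' \<in> Ob T" by (rule zero_object_ex)
  let ?W = "src T k"
  have tri: "(\<zero> ?W O', \<zero> O' (susp T ?W), neg_arr T (ident T (susp T ?W))) \<in> exact_tri T"
    using rotate[OF TR1_ident[OF _ O'(1), of ?W]] by simp
  obtain c where c: "c \<in> Arr T" "src T c = susp T ?W" "tgt T c = susp T (src T f)"
    "neg_arr T (susp_arr T f) \<cdot> c = susp_arr T k \<cdot> neg_arr T (ident T (susp T ?W))"
    by (rule TR3_fill[OF tri rotate[OF assms(1)], of k "\<zero> O' (tgt T g)"]) (use O' in simp_all)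
  obtain k' where k': "k' \<in> Arr T" "src T k' = ?W" "tgt T k' = src T f" "c = susp_arr T k'"
    by (rule susp_full[OF c(1-3)]) auto
  have "neg_arr T (susp_arr T k) = neg_arr T (susp_arr T (f \<cdot> k'))"
    using c(4)[symmetric] k' by (simp add: comp_neg neg_comp)
  then have "susp_arr T k = susp_arr T (f \<cdot> k')"
    by (rule neg_inject[rotated 2]) (use k' in auto)
  from susp_faithful[OF this] have "f \<cdot> k' = k" using k' by simp
  with k' show thesis by (intro that[of k']) auto
qed

lemma weak_cokernel2:
  assumes "(f, g, h) \<in> exact_tri T" "k \<in> Arr T" "src T k = tgt T g" "k \<cdot> g = \<zero> (src T g) (tgt T k)"
  obtains k' where "k' \<in> Arr T" "src T k' = tgt T h" "tgt T k' = tgt T k" "k' \<cdot> h = k"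
  using weak_cokernel[OF rotate[OF assms(1)], of k] assms that by blast

lemma cone_ex:
  assumes "f \<in> Arr T" obtains g h where "(f, g, h) \<in> exact_tri T"
  using TR1_ex[OF assms] by blast

text \<open>The cone of q need not be a suspension. It is replaced by an isomorphic
  \<open>susp T X'\<close>; then its boundary map desuspends and the triangle can be rotated
  back.\<close>

lemma fibre_ex:
  assumes "q \<in> Arr T" obtains s h where "(s, q, h) \<in> exact_tri T"
proof -
  obtain g k where t: "(q, g, k) \<in> exact_tri T" using assms by (rule cone_ex)
  note [simp] = exactD[OF t]
  obtain X' e where e: "X' \<in> Ob T" "e \<in> Arr T" "src T e = susp T X'" "tgt T e = tgt T g" "is_iso T e"
    using susp_desusp_ex[of "tgt T g"] by auto
  note [simp] = e
  obtain e' where e': "e' \<in> Arr T" "src T e' = tgt T g" "tgt T e' = susp T X'"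
    "e' \<cdot> e = ident T (susp T X')" "e \<cdot> e' = ident T (tgt T g)"
    using is_isoE[OF e(5)] e by metis
  note [simp] = e'(1-3)
  have iso: "is_iso T e'" by (rule is_isoI[where e' = e]) (use e e' in auto)
  have "(q, e' \<cdot> g, k \<cdot> e) \<in> exact_tri T"
  proof (rule TR1_iso[OF t, where a = "ident T (src T q)" and b = "ident T (tgt T q)" and c = e'])
    show "is_triangle T q (e' \<cdot> g) (k \<cdot> e)" by (simp add: is_triangle_def)
    show "susp_arr T (ident T (src T q)) \<cdot> k = (k \<cdot> e) \<cdot> e'" by (simp add: e')
  qed (auto simp: Hom_iff iso)
  moreover obtain s where s: "s \<in> Arr T" "src T s = X'" "tgt T s = src T q" "neg_arr T (k \<cdot> e) = susp_arr T s"
    by (rule susp_full[of "neg_arr T (k \<cdot> e)" X' "src T q"]) auto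
  have "neg_arr T (susp_arr T s) = k \<cdot> e" using s(4)[symmetric] by simp
  ultimately have "(q, e' \<cdot> g, neg_arr T (susp_arr T s)) \<in> exact_tri T" by simp
  then have "(s, q, e' \<cdot> g) \<in> exact_tri T"
    by (rule unrotate) (use s in auto)
  then show thesis by (rule that)
qed

lemma is_iso_neg_ident [simp]: "X \<in> Ob T \<Longrightarrow> is_iso T (neg_arr T (ident T X))"
  by (rule is_isoI[where e' = "neg_arr T (ident T X)"]) (auto simp: neg_comp comp_neg)

text \<open>Three rotations negate all three maps; changing the sign of the middle identity removes
  two of the three signs.\<close>

lemma susp_exact:
  assumes "(f, g, h) \<in> exact_tri T"
  shows "(susp_arr T f, susp_arr T g, neg_arr T (susp_arr T h)) \<in> exact_tri T"
proof -
  note [simp] = exactD[OF assms]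
  show ?thesis
  proof (rule TR1_iso[OF rotate[OF rotate[OF rotate[OF assms]]], where a = "ident T (susp T (src T f))"
        and b = "neg_arr T (ident T (susp T (tgt T f)))" and c = "ident T (susp T (tgt T g))"])
    show "neg_arr T (ident T (susp T (tgt T f))) \<cdot> neg_arr T (susp_arr T f) =
        susp_arr T f \<cdot> ident T (susp T (src T f))"
      by (simp add: neg_comp comp_neg)
    show "ident T (susp T (tgt T g)) \<cdot> neg_arr T (susp_arr T g) =
        susp_arr T g \<cdot> neg_arr T (ident T (susp T (tgt T f)))"
      by (simp add: neg_comp comp_neg)
  qed (auto simp: Hom_iff is_triangle_def)
qed

text \<open>The difference x - 1 kills g, hence factors through h, and h kills it in turn; so its
  square is zero. This handles composites of TR3 fillers, which are compatible with the triangle but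
  need not be identities.\<close>

lemma is_iso_triangle_endo:
  assumes "(f, g, h) \<in> exact_tri T" "x \<in> Arr T" "src T x = tgt T g" "tgt T x = tgt T g"
    "x \<cdot> g = g" "h \<cdot> x = h"
  shows "is_iso T x"
proof -
  note [simp] = exactD[OF assms(1)] assms(2-6)
  define n where "n = x \<boxplus> neg_arr T (ident T (tgt T g))"
  have n [simp]: "n \<in> Arr T" "src T n = tgt T g" "tgt T n = tgt T g" by (auto simp: n_def)
  have "n \<cdot> g = \<zero> (src T g) (tgt T n)"
    by (simp add: n_def comp_plus_dist_right neg_comp)
  then obtain k where k: "k \<in> Arr T" "src T k = tgt T h" "tgt T k = tgt T n" "k \<cdot> h = n"
    by (rule weak_cokernel2[OF assms(1), rotated 2]) auto
  have hn: "h \<cdot> n = \<zero> (src T h) (tgt T h)"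
    by (simp add: n_def comp_plus_dist_left comp_neg)
  have "(k \<cdot> h) \<cdot> n = k \<cdot> (h \<cdot> n)"
    using k(1-3) by (intro comp_assoc_Arr) simp_all
  then have "n \<cdot> n = \<zero> (tgt T g) (tgt T g)"
    using k by (simp add: hn)
  then show ?thesis
    by (intro is_iso_unipotent[of x "tgt T g"]) (simp_all add: n_def)
qed

end

section \<open>Morphisms with cone in a thick subcategory\<close>

locale thick_subcategory = triangulated_category T
  for T :: "('o, 'm, 'z) tri_struct_scheme" (structure) +
  fixes S :: "'o set"
  assumes thick: "thick T S"
begin

lemma S_Ob [simp]: "X \<in> S \<Longrightarrow> X \<in> Ob T"
  and S_zero: "is_zero_object T Z \<Longrightarrow> Z \<in> S"
  and S_susp_iff: "X \<in> Ob T \<Longrightarrow> susp T X \<in> S \<longleftrightarrow> X \<in> S"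
  and S_third: "\<lbrakk>(f, g, h) \<in> exact_tri T; src T f \<in> S; tgt T f \<in> S\<rbrakk> \<Longrightarrow> tgt T g \<in> S"
  and S_first: "\<lbrakk>(f, g, h) \<in> exact_tri T; tgt T f \<in> S; tgt T g \<in> S\<rbrakk> \<Longrightarrow> src T f \<in> S"
  and S_second: "\<lbrakk>(f, g, h) \<in> exact_tri T; src T f \<in> S; tgt T g \<in> S\<rbrakk> \<Longrightarrow> tgt T f \<in> S"
proof -
  have t: "triangulated_subcategory T S" using thick by (simp add: thick_def)
  then have *: "(src T f \<in> S \<and> src T g \<in> S \<longrightarrow> src T h \<in> S) \<and>
        (src T g \<in> S \<and> src T h \<in> S \<longrightarrow> src T f \<in> S) \<and>
        (src T f \<in> S \<and> src T h \<in> S \<longrightarrow> src T g \<in> S)" if "(f, g, h) \<in> exact_tri T" for f g h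
    using that unfolding triangulated_subcategory_def by blast
  show "X \<in> S \<Longrightarrow> X \<in> Ob T" "is_zero_object T Z \<Longrightarrow> Z \<in> S"
    using t by (auto simp: triangulated_subcategory_def)
  show "X \<in> Ob T \<Longrightarrow> susp T X \<in> S \<longleftrightarrow> X \<in> S"
    using t by (auto simp: triangulated_subcategory_def)
  show "\<lbrakk>(f, g, h) \<in> exact_tri T; src T f \<in> S; tgt T f \<in> S\<rbrakk> \<Longrightarrow> tgt T g \<in> S"
    "\<lbrakk>(f, g, h) \<in> exact_tri T; tgt T f \<in> S; tgt T g \<in> S\<rbrakk> \<Longrightarrow> src T f \<in> S"
    "\<lbrakk>(f, g, h) \<in> exact_tri T; src T f \<in> S; tgt T g \<in> S\<rbrakk> \<Longrightarrow> tgt T f \<in> S"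
    using *[of f g h] exactD[of f g h] by auto
qed

lemma cone_in_ArrD: "s \<in> cone_in T S \<Longrightarrow> s \<in> Arr T"
  by (auto simp: cone_in_def dest: exactD)

lemma exact_ident_cone: assumes "X \<in> Ob T"
  obtains g h where "(ident T X, g, h) \<in> exact_tri T" "is_zero_object T (tgt T g)"
  using TR1_ident[OF assms] assms by (metis zero_object_ex tgt_zero)

text \<open>Independence of the chosen cone: the octahedron on s = 1 s places the two cones in a
  triangle with a zero object.\<close>

lemma tgt_cone_in:
  assumes s: "(s, g, h) \<in> exact_tri T" and s': "s \<in> cone_in T S"
  shows "tgt T g \<in> S"
proof -
  obtain g' h' where t: "(s, g', h') \<in> exact_tri T" "tgt T g' \<in> S"
    using s' by (auto simp: cone_in_def)
  note [simp] = exactD[OF s] exactD[OF t(1)]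
  obtain i j where i: "(ident T (tgt T s), i, j) \<in> exact_tri T" "is_zero_object T (tgt T i)"
    by (rule exact_ident_cone[of "tgt T s"]) auto
  from TR4[OF s i(1) t(1)]
  obtain k1 k2 k3 where k: "(k1, k2, k3) \<in> exact_tri T" "k1 \<in> Hom T (tgt T g) (tgt T g')"
    "k2 \<in> Hom T (tgt T g') (tgt T i)" by auto
  then show ?thesis using S_first[OF k(1)] t(2) S_zero[OF i(2)] by (auto simp: Hom_iff)
qed

lemma cone_in_iff: "(s, g, h) \<in> exact_tri T \<Longrightarrow> s \<in> cone_in T S \<longleftrightarrow> tgt T g \<in> S"
  using tgt_cone_in[of s g h] by (auto simp: cone_in_def)

lemma cone_in_iff_fibre: 
  assumes "(f, s, h) \<in> exact_tri T" shows "s \<in> cone_in T S \<longleftrightarrow> src T f \<in> S"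
  using cone_in_iff[OF rotate[OF assms]] exactD[OF assms] by (simp add: S_susp_iff)

text \<open>By TR4 the cones of f, g f and g form a triangle, so closure of S under triangles gives
  both implications.\<close>

lemma cone_in_octahedron:
  assumes "f \<in> Arr T" "g \<in> Arr T" "tgt T f = src T g"
  shows "f \<in> cone_in T S \<Longrightarrow> g \<in> cone_in T S \<Longrightarrow> g \<cdot> f \<in> cone_in T S"
    and "g \<cdot> f \<in> cone_in T S \<Longrightarrow> g \<in> cone_in T S \<Longrightarrow> f \<in> cone_in T S"
proof -
  obtain f2 f3 where f: "(f, f2, f3) \<in> exact_tri T" using assms cone_ex by blast
  obtain g2 g3 where g: "(g, g2, g3) \<in> exact_tri T" using assms cone_ex by blast
  obtain h2 h3 where h: "(g \<cdot> f, h2, h3) \<in> exact_tri T" using assms cone_ex by (metis comp_Arr)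
  from TR4[OF f g h assms(3) refl]
  obtain k1 k2 k3 where k: "(k1, k2, k3) \<in> exact_tri T" "k1 \<in> Hom T (tgt T f2) (tgt T h2)"
    "k2 \<in> Hom T (tgt T h2) (tgt T g2)" by auto
  show "f \<in> cone_in T S \<Longrightarrow> g \<in> cone_in T S \<Longrightarrow> g \<cdot> f \<in> cone_in T S"
    "g \<cdot> f \<in> cone_in T S \<Longrightarrow> g \<in> cone_in T S \<Longrightarrow> f \<in> cone_in T S"
    unfolding cone_in_iff[OF f] cone_in_iff[OF g] cone_in_iff[OF h]
    using S_first[OF k(1)] S_second[OF k(1)] k by (auto simp: Hom_iff)
qed

lemma cone_in_comp:
  "\<lbrakk>f \<in> cone_in T S; g \<in> cone_in T S; tgt T f = src T g\<rbrakk> \<Longrightarrow> g \<cdot> f \<in> cone_in T S"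
  by (rule cone_in_octahedron(1)) (auto dest: cone_in_ArrD)

lemma cone_in_cancel_left:
  "\<lbrakk>g \<cdot> f \<in> cone_in T S; g \<in> cone_in T S; f \<in> Arr T; tgt T f = src T g\<rbrakk> \<Longrightarrow> f \<in> cone_in T S"
  by (rule cone_in_octahedron(2)[of f g]) (auto dest: cone_in_ArrD)

lemma cone_in_ident [simp]: "X \<in> Ob T \<Longrightarrow> ident T X \<in> cone_in T S"
  by (rule exact_ident_cone[of X]) (auto simp: cone_in_iff S_zero)

text \<open>The identity triangle is transported along e, which gives e a zero cone.\<close>

lemma cone_in_iso:
  assumes "is_iso T e" shows "e \<in> cone_in T S"
proof -
  obtain e' where e': "e' \<in> Arr T" "src T e' = tgt T e" "tgt T e' = src T e"
    "e' \<cdot> e = ident T (src T e)" "e \<cdot> e' = ident T (tgt T e)" using assms by (rule is_isoE)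
  obtain g h where t: "(ident T (src T e), g, h) \<in> exact_tri T" "is_zero_object T (tgt T g)"
    using exact_ident_cone[of "src T e"] assms by auto
  note [simp] = exactD[OF t(1)] e'(1-3) is_iso_Arr[OF assms]
  have [simp]: "src T g = src T e" "tgt T h = susp T (src T e)" by simp_all
  have "(e, g \<cdot> e', h) \<in> exact_tri T"
  proof (rule TR1_iso[OF t(1), where a = "ident T (src T e)" and b = e and c = "ident T (tgt T g)"])
    show "is_triangle T e (g \<cdot> e') h" by (auto simp: is_triangle_def)
    show "ident T (tgt T g) \<cdot> g = (g \<cdot> e') \<cdot> e" by (simp add: e')
  qed (auto simp: Hom_iff assms)
  then show ?thesis using S_zero[OF t(2)] by (simp add: cone_in_iff)
qed

lemma susp_cone_in_iff: "f \<in> Arr T \<Longrightarrow> susp_arr T f \<in> cone_in T S \<longleftrightarrow> f \<in> cone_in T S"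
proof -
  assume "f \<in> Arr T"
  then obtain g h where t: "(f, g, h) \<in> exact_tri T" by (rule cone_ex)
  show ?thesis
    using cone_in_iff[OF t] cone_in_iff[OF susp_exact[OF t]] exactD[OF t] by (simp add: S_susp_iff)
qed

lemma cone_in_between: "\<lbrakk>f \<in> Arr T; src T f \<in> S; tgt T f \<in> S\<rbrakk> \<Longrightarrow> f \<in> cone_in T S"
  by (rule cone_ex[of f]) (auto simp: cone_in_iff S_third)

lemma cone_in_src: "\<lbrakk>f \<in> cone_in T S; tgt T f \<in> S\<rbrakk> \<Longrightarrow> src T f \<in> S"
  using S_first by (auto simp: cone_in_def)

end

section \<open>Ore squares and factorisations through fibres\<close>

context triangulated_category
begin

lemma thick_subcategoryI: "thick T S \<Longrightarrow> thick_subcategory T S"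
  by unfold_locales

text \<open>The square is a homotopy pullback: with q the map from the target of s to its cone, s'
  is the fibre of q f. So s' has the same cone as s, and the octahedron on q f shows that the fibre
  of \<Sigma>f' is the cone of f. The conclusions range over all S because one square is later used
  with its two legs in different thick subcategories.\<close>

lemma ore_right:
  assumes "s \<in> Arr T" "f \<in> Arr T" "tgt T s = tgt T f"
  obtains s' f' where "s' \<in> Arr T" "f' \<in> Arr T" "src T f' = src T s'" "tgt T s' = src T f" "tgt T f' = src T s"
    "s \<cdot> f' = f \<cdot> s'"
    "\<And>S. thick T S \<Longrightarrow> s \<in> cone_in T S \<Longrightarrow> s' \<in> cone_in T S"
    "\<And>S. thick T S \<Longrightarrow> f \<in> cone_in T S \<Longrightarrow> f' \<in> cone_in T S"
proof -
  obtain q h where s: "(s, q, h) \<in> exact_tri T" using assms cone_ex by blast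
  note [simp] = assms(2) exactD[OF s] assms(3)
  obtain f2 f3 where f: "(f, f2, f3) \<in> exact_tri T" using assms cone_ex by blast
  obtain s' h' where s': "(s', q \<cdot> f, h') \<in> exact_tri T" using fibre_ex[of "q \<cdot> f"] by auto
  note f' [simp] = exactD[OF f]
  have [simp]: "s' \<in> Arr T" "h' \<in> Arr T" "tgt T s' = src T f" "src T h' = tgt T q" "tgt T h' = susp T (src T s')"
    using exactD[OF s'] by auto
  from TR4[OF f rotate[OF s] rotate[OF s'] _ refl]
  obtain k1 k2 k3 where k: "(k1, k2, k3) \<in> exact_tri T" "k1 \<in> Hom T (tgt T f2) (tgt T h')"
    "k2 \<in> Hom T (tgt T h') (tgt T h)"
    "neg_arr T (susp_arr T s) \<cdot> k2 = susp_arr T f \<cdot> neg_arr T (susp_arr T s')" by auto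
  then have [simp]: "k2 \<in> Arr T" "src T k2 = susp T (src T s')" "tgt T k2 = susp T (src T s)"
    by (simp_all add: Hom_iff)
  obtain f' where f': "f' \<in> Arr T" "src T f' = src T s'" "tgt T f' = src T s" "k2 = susp_arr T f'"
    using susp_full[of k2 "src T s'" "src T s"] by auto
  have "neg_arr T (susp_arr T (s \<cdot> f')) = neg_arr T (susp_arr T (f \<cdot> s'))"
    using k(4) f' by (simp add: neg_comp comp_neg)
  then have "susp_arr T (s \<cdot> f') = susp_arr T (f \<cdot> s')"
    by (rule neg_inject[rotated 2]) (use f' in auto)
  then have sq: "s \<cdot> f' = f \<cdot> s'"
    by (rule susp_faithful) (use f' in auto)
  show thesis
  proof (rule that[of s' f'])
    fix S assume "thick T S"
    then interpret thick_subcategory T S by (rule thick_subcategoryI)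
    show "s' \<in> cone_in T S" if "s \<in> cone_in T S"
      using that s s' by (auto simp: cone_in_iff)
    show "f' \<in> cone_in T S" if "f \<in> cone_in T S"
      using that f k(2) f' cone_in_iff_fibre[OF k(1)] susp_cone_in_iff[OF f'(1)] 
      by (auto simp: cone_in_iff Hom_iff)
  qed (use f' sq in auto)
qed

text \<open>The dual square: with w the fibre of s, the map s' leads to the cone of f w, so s and s'
  have the same fibre object.\<close>

lemma ore_left:
  assumes "s \<in> Arr T" "f \<in> Arr T" "src T s = src T f"
  obtains s' f' where "s' \<in> Arr T" "f' \<in> Arr T" "tgt T f' = tgt T s'" "src T s' = tgt T f" "src T f' = tgt T s"
    "f' \<cdot> s = s' \<cdot> f" "\<And>S. thick T S \<Longrightarrow> s \<in> cone_in T S \<Longrightarrow> s' \<in> cone_in T S"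
proof -
  obtain w h where s: "(w, s, h) \<in> exact_tri T" using assms fibre_ex by blast
  have [simp]: "f \<in> Arr T" "src T s = src T f" "tgt T w = src T f" "w \<in> Arr T" "s \<in> Arr T" "h \<in> Arr T" "src T h = tgt T s"
    using assms exactD[OF s] by auto
  obtain s' h' where s': "(f \<cdot> w, s', h') \<in> exact_tri T" using cone_ex[of "f \<cdot> w"] by auto
  note t = exactD[OF s']
  have [simp]: "s' \<in> Arr T" "src T s' = tgt T f" "h' \<in> Arr T" "src T h' = tgt T s'" using t by auto
  obtain c where c: "c \<in> Arr T" "src T c = tgt T s" "tgt T c = tgt T s'" "c \<cdot> s = s' \<cdot> f"
    by (rule TR3_fill[OF s s', of "ident T (src T w)" f]) simp_all
  show thesis
  proof (rule that[of s' c])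
    fix S assume "thick T S"
    then interpret thick_subcategory T S by (rule thick_subcategoryI)
    show "s' \<in> cone_in T S" if "s \<in> cone_in T S"
      using that cone_in_iff_fibre[OF s] cone_in_iff_fibre[OF s'] by simp
  qed (use c in auto)
qed

text \<open>p is the fibre of q and t the fibre of r q. The octahedron on r q links them by s, and
  the suspension of s has the same cone as r. A map out of the cone of p thus yields a factorisation
  of p.\<close>

lemma fibre_factorisation:
  assumes "(p, q, h) \<in> exact_tri T" "r \<in> Arr T" "src T r = tgt T q"
  obtains t s h' where "s \<in> Arr T" "t \<in> Arr T" "src T s = src T p" "tgt T s = src T t" "tgt T t = tgt T p"
    "p = t \<cdot> s" "(t, r \<cdot> q, h') \<in> exact_tri T" "\<And>S. thick T S \<Longrightarrow> r \<in> cone_in T S \<Longrightarrow> s \<in> cone_in T S"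
proof -
  note [simp] = exactD[OF assms(1)] assms(2,3)
  obtain r2 r3 where r: "(r, r2, r3) \<in> exact_tri T" using cone_ex[OF assms(2)] by blast
  obtain t h' where t: "(t, r \<cdot> q, h') \<in> exact_tri T" using fibre_ex[of "r \<cdot> q"] by auto
  have [simp]: "t \<in> Arr T" "h' \<in> Arr T" "tgt T t = tgt T p" "src T h' = tgt T r" "tgt T h' = susp T (src T t)"
    using exactD[OF t] by auto
  from TR4[OF rotate[OF assms(1)] r rotate[OF t] _ refl]
  obtain k1 k2 k3 where k: "(k1, k2, k3) \<in> exact_tri T" "k1 \<in> Hom T (tgt T h) (tgt T h')"
    "k2 \<in> Hom T (tgt T h') (tgt T r2)"
    "neg_arr T (susp_arr T t) \<cdot> k1 = neg_arr T (susp_arr T p)" by auto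
  then have [simp]: "k1 \<in> Arr T" "src T k1 = susp T (src T p)" "tgt T k1 = susp T (src T t)"
    by (simp_all add: Hom_iff)
  obtain s where s: "s \<in> Arr T" "src T s = src T p" "tgt T s = src T t" "k1 = susp_arr T s"
    using susp_full[of k1 "src T p" "src T t"] by auto
  have "neg_arr T (susp_arr T p) = neg_arr T (susp_arr T (t \<cdot> s))"
    using k(4) s by (simp add: neg_comp comp_neg)
  then have "susp_arr T p = susp_arr T (t \<cdot> s)"
    by (rule neg_inject[rotated 2]) (use s in auto)
  then have p: "p = t \<cdot> s"
    by (rule susp_faithful) (use s in auto)
  show thesis
  proof (rule that[of s t h'])
    fix S assume "thick T S"
    then interpret thick_subcategory T S by (rule thick_subcategoryI)
    show "s \<in> cone_in T S" if "r \<in> cone_in T S"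
    proof -
      have "tgt T r2 \<in> S" using that r by (simp add: cone_in_iff)
      then have "k1 \<in> cone_in T S" using cone_in_iff[OF k(1)] k(3) by (simp add: Hom_iff)
      then show ?thesis using s susp_cone_in_iff[of s] by simp
    qed
  qed (use s p[symmetric] t in simp_all)
qed

end

section \<open>Cancelling morphisms with cone in S\<close>

context thick_subcategory
begin

text \<open>Since s k = 0, k factors through the fibre of s, whose source lies in S. The fibre t of
  that factor kills k, and its cone is that source.\<close>

lemma cone_in_annihilated:
  assumes "s \<in> cone_in T S" "k \<in> Arr T" "tgt T k = src T s" "s \<cdot> k = \<zero> (src T k) (tgt T s)"
  obtains t where "t \<in> cone_in T S" "tgt T t = src T k" "k \<cdot> t = \<zero> (src T t) (tgt T k)"
proof -
  have [simp]: "s \<in> Arr T" using assms(1) by (rule cone_in_ArrD)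
  note [simp] = assms(2-4)
  obtain w h where w: "(w, s, h) \<in> exact_tri T" using fibre_ex[of s] by auto
  have [simp]: "w \<in> Arr T" "tgt T w = src T s" using exactD[OF w] by auto
  obtain k' where k': "k' \<in> Arr T" "src T k' = src T k" "tgt T k' = src T w" "w \<cdot> k' = k"
    by (rule weak_kernel[OF w, of k]) auto
  obtain t h' where t: "(t, k', h') \<in> exact_tri T" using fibre_ex[OF k'(1)] by auto
  show thesis
  proof (rule that[of t])
    show "t \<in> cone_in T S" using cone_in_iff[OF t] cone_in_iff_fibre[OF w] assms(1) k' by simp
    show "tgt T t = src T k" using exactD[OF t] k' by simp
    have "(w \<cdot> k') \<cdot> t = w \<cdot> (k' \<cdot> t)"
      using exactD[OF t] k'(1-3) by (intro comp_assoc_Arr) simp_all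
    then show "k \<cdot> t = \<zero> (src T t) (tgt T k)" using exact_comp_zero1[OF t] exactD[OF t] k' by simp
  qed
qed

text \<open>The cancellation axiom of a calculus of fractions, obtained by annihilating k -
  l.\<close>

lemma cone_in_equalised:
  assumes "s \<in> cone_in T S" "k \<in> Arr T" "l \<in> Arr T" "tgt T k = src T s" "tgt T l = src T s" "src T k = src T l"
    "s \<cdot> k = s \<cdot> l"
  obtains t where "t \<in> cone_in T S" "tgt T t = src T k" "k \<cdot> t = l \<cdot> t"
proof -
  have [simp]: "s \<in> Arr T" using assms(1) by (rule cone_in_ArrD)
  note [simp] = assms(2-6)
  let ?d = "k \<boxplus> neg_arr T l"
  have "s \<cdot> ?d = \<zero> (src T ?d) (tgt T s)"
    using assms(7) by (simp add: comp_plus_dist_left comp_neg)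
  then obtain t where t: "t \<in> cone_in T S" "tgt T t = src T ?d" "?d \<cdot> t = \<zero> (src T t) (tgt T ?d)"
    by (rule cone_in_annihilated[OF assms(1), rotated 2]) auto
  have [simp]: "t \<in> Arr T" "tgt T t = src T l" using t cone_in_ArrD by auto
  show thesis
  proof (rule that[of t])
    have "k \<cdot> t \<boxplus> neg_arr T (l \<cdot> t) = \<zero> (src T t) (tgt T (k \<cdot> t))"
      using t(3) by (simp add: comp_plus_dist_right neg_comp)
    then show "k \<cdot> t = l \<cdot> t" using diff_eq_zero_iff[of "k \<cdot> t" "l \<cdot> t"] by simp
  qed (use t in auto)
qed

text \<open>If t kills k, then k factors through the cone of t. If k factors through an object of S,
  take for t the fibre of the first factor.\<close>

lemma annihilated_iff_factors_through:
  assumes "k \<in> Arr T"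
  shows "(\<exists>t \<in> cone_in T S. tgt T t = src T k \<and> k \<cdot> t = \<zero> (src T t) (tgt T k)) \<longleftrightarrow> factors_through T k S"
proof
  assume "\<exists>t \<in> cone_in T S. tgt T t = src T k \<and> k \<cdot> t = \<zero> (src T t) (tgt T k)"
  then obtain t where t: "t \<in> cone_in T S" "tgt T t = src T k" "k \<cdot> t = \<zero> (src T t) (tgt T k)" by blast
  obtain g h where g: "(t, g, h) \<in> exact_tri T" using t cone_in_ArrD cone_ex by blast
  obtain k' where k': "k' \<in> Arr T" "src T k' = tgt T g" "tgt T k' = tgt T k" "k' \<cdot> g = k"
    by (rule weak_cokernel[OF g, of k]) (use t assms in auto)
  moreover have "tgt T g \<in> S" using t g cone_in_iff by blast
  ultimately show "factors_through T k S"
    unfolding factors_through_def using exactD[OF g] t(2)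
    by (intro bexI[of _ "tgt T g"] bexI[of _ g] bexI[of _ k']) (simp_all add: Hom_iff)
next
  assume "factors_through T k S"
  then obtain W g h where W: "W \<in> S" "g \<in> Arr T" "h \<in> Arr T" "src T g = src T k" "tgt T g = W"
    "src T h = W" "tgt T h = tgt T k" "k = h \<cdot> g"
    by (auto simp: factors_through_def Hom_iff)
  obtain t l where t: "(t, g, l) \<in> exact_tri T" using W fibre_ex by blast
  have tt: "t \<in> Arr T" "tgt T t = src T k" using exactD[OF t] W(4) by simp_all
  have "(h \<cdot> g) \<cdot> t = h \<cdot> (g \<cdot> t)" using tt W(2-7) by (intro comp_assoc_Arr) simp_all
  then have "k \<cdot> t = \<zero> (src T t) (tgt T k)"
    using exact_comp_zero1[OF t] tt W(1-7) W(8)[symmetric] by simp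
  moreover have "t \<in> cone_in T S" using cone_in_iff[OF t] W(1,5) by simp
  ultimately show "\<exists>t \<in> cone_in T S. tgt T t = src T k \<and> k \<cdot> t = \<zero> (src T t) (tgt T k)"
    using tt by blast
qed

text \<open>Dually, t is the map from the target of the second factor to its cone.\<close>

lemma factors_through_annihilated_left:
  assumes "factors_through T k S"
  obtains t where "t \<in> cone_in T S" "src T t = tgt T k" "t \<cdot> k = \<zero> (src T k) (tgt T t)"
proof -
  obtain W g h where W: "W \<in> S" "g \<in> Arr T" "h \<in> Arr T" "src T g = src T k" "tgt T g = W"
    "src T h = W" "tgt T h = tgt T k" "k = h \<cdot> g"
    using assms by (auto simp: factors_through_def Hom_iff)
  obtain t l where t: "(h, t, l) \<in> exact_tri T" using W cone_ex by blast
  have tt: "t \<in> Arr T" "src T t = tgt T k" using exactD[OF t] W(7) by simp_all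
  have "(t \<cdot> h) \<cdot> g = t \<cdot> (h \<cdot> g)" using tt W(2-7) by (intro comp_assoc_Arr) simp_all
  then have "t \<cdot> k = \<zero> (src T k) (tgt T t)"
    using exact_comp_zero1[OF t] tt W(1-7) W(8)[symmetric] by simp
  moreover have "t \<in> cone_in T S" using cone_in_iff_fibre[OF t] W(1,6) by simp
  ultimately show thesis using tt that by blast
qed

end

section \<open>The Verdier quotient as a preadditive category\<close>

context category
begin

text \<open>Plays the part of \<open>comp_reduce\<close> for an equation between two composites, as
  provided by commutative squares.\<close>

lemma comp_cong_right:
  "\<lbrakk>s \<cdot> a = t \<cdot> b; s \<in> Arr C; a \<in> Arr C; t \<in> Arr C; b \<in> Arr C; x \<in> Arr C;
    tgt C a = src C s; tgt C b = src C t; tgt C x = src C a; src C b = src C a\<rbrakk>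
    \<Longrightarrow> s \<cdot> (a \<cdot> x) = t \<cdot> (b \<cdot> x)"
  by (metis comp_assoc_Arr)

end

lemma fractions_iff:
  "(s, f) \<in> fractions T S X Y \<longleftrightarrow>
    s \<in> cone_in T S \<and> f \<in> Arr T \<and> src T f = src T s \<and> tgt T s = X \<and> tgt T f = Y"
  by (auto simp: fractions_def)

context thick_subcategory
begin

abbreviation Q where "Q \<equiv> quot T S"
abbreviation comp_Q (infixr "\<cdot>\<^sub>Q" 75) where "x \<cdot>\<^sub>Q y \<equiv> comp Q x y"
abbreviation plus_Q (infixl "\<boxplus>\<^sub>Q" 65) where "x \<boxplus>\<^sub>Q y \<equiv> plus_arr Q x y"
abbreviation zero_Q ("\<zero>\<^sub>Q") where "\<zero>\<^sub>Q \<equiv> zero_arr Q"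
abbreviation cls where "cls s f \<equiv> frac_class T S (s, f)"
abbreviation q where "q \<equiv> quot_functor T S"

lemma ore_cone:
  assumes "s \<in> cone_in T S" "f \<in> Arr T" "tgt T s = tgt T f"
  obtains s' f' where "s' \<in> cone_in T S" "f' \<in> Arr T" "src T f' = src T s'" "tgt T s' = src T f" "tgt T f' = src T s"
    "s \<cdot> f' = f \<cdot> s'"
  by (rule ore_right[of s f]) (use assms thick cone_in_ArrD in auto)

lemma ore_cone2:
  assumes "s \<in> cone_in T S" "t \<in> cone_in T S" "tgt T s = tgt T t"
  obtains a b where "a \<in> cone_in T S" "b \<in> cone_in T S" "src T a = src T b" "tgt T a = src T s" "tgt T b = src T t"
    "s \<cdot> a = t \<cdot> b"
  by (rule ore_right[of s t]) (use assms thick cone_in_ArrD in auto)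

lemma frac_equivI:
  assumes "a \<in> cone_in T S" "b \<in> cone_in T S" "src T a = src T b" "tgt T a = src T s" "tgt T b = src T t"
    "s \<in> cone_in T S" "s \<cdot> a = t \<cdot> b" "f \<cdot> a = g \<cdot> b"
  shows "frac_equiv T S (s, f) (t, g)"
proof -
  have "s \<cdot> a \<in> cone_in T S" by (rule cone_in_comp) (use assms(1,4,6) in simp_all)
  then show ?thesis
    unfolding frac_equiv_def prod.case
    by (rule_tac bexI[of _ "src T a"], rule_tac bexI[of _ a], rule_tac bexI[of _ b])
      (use assms(1-5,7,8) assms(1,2)[THEN cone_in_ArrD] in \<open>simp_all add: Hom_iff\<close>)
qed

text \<open>The definition places only \<open>s \<cdot> a\<close> among the denominators;
  cancellation places a and b there too, which gluing by Ore squares relies on.\<close>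

lemma frac_equivE:
  assumes "frac_equiv T S (s, f) (t, g)" "s \<in> cone_in T S" "t \<in> cone_in T S"
  obtains a b where "a \<in> cone_in T S" "b \<in> cone_in T S" "src T a = src T b" "tgt T a = src T s" "tgt T b = src T t"
    "s \<cdot> a = t \<cdot> b" "f \<cdot> a = g \<cdot> b"
proof -
  obtain W a b where ab': "a \<in> Hom T W (src T s)" "b \<in> Hom T W (src T t)"
    "s \<cdot> a = t \<cdot> b" "f \<cdot> a = g \<cdot> b" "s \<cdot> a \<in> cone_in T S"
    using assms(1) unfolding frac_equiv_def prod.case by blast
  then have ab: "a \<in> Arr T" "b \<in> Arr T" "src T a = src T b" "tgt T a = src T s" "tgt T b = src T t"
    "s \<cdot> a = t \<cdot> b" "f \<cdot> a = g \<cdot> b" "s \<cdot> a \<in> cone_in T S"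
    unfolding Hom_iff by simp_all
  moreover have "a \<in> cone_in T S" by (rule cone_in_cancel_left[OF ab(8) assms(2) ab(1,4)])
  moreover have "t \<cdot> b \<in> cone_in T S" using ab(6,8) by simp
  then have "b \<in> cone_in T S" by (rule cone_in_cancel_left[rotated, OF assms(3) ab(2,5)])
  ultimately show thesis using that by blast
qed

lemma frac_equiv_refl: "s \<in> cone_in T S \<Longrightarrow> frac_equiv T S (s, f) (s, f)"
  by (rule frac_equivI[of "ident T (src T s)" "ident T (src T s)"]) (auto dest: cone_in_ArrD)

lemma frac_equiv_sym:
  "\<lbrakk>frac_equiv T S (s, f) (t, g); s \<in> cone_in T S; t \<in> cone_in T S\<rbrakk> \<Longrightarrow> frac_equiv T S (t, g) (s, f)"
  by (erule frac_equivE, assumption, assumption) (rule frac_equivI, auto)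

lemma frac_equiv_trans:
  assumes "frac_equiv T S (s, f) (t, g)" "frac_equiv T S (t, g) (r, h)"
    "(s, f) \<in> fractions T S X Y" "(t, g) \<in> fractions T S X Y" "(r, h) \<in> fractions T S X Y"
  shows "frac_equiv T S (s, f) (r, h)"
proof -
  note F = assms(3-5)[unfolded fractions_iff]
  obtain a b where ab: "a \<in> cone_in T S" "b \<in> cone_in T S" "src T a = src T b" "tgt T a = src T s" "tgt T b = src T t"
    "s \<cdot> a = t \<cdot> b" "f \<cdot> a = g \<cdot> b" using assms(1) F frac_equivE by blast
  obtain c d where cd: "c \<in> cone_in T S" "d \<in> cone_in T S" "src T c = src T d" "tgt T c = src T t" "tgt T d = src T r"
    "t \<cdot> c = r \<cdot> d" "g \<cdot> c = h \<cdot> d" using assms(2) F frac_equivE by blast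
  \<comment> \<open>Both equivalences refine the middle fraction; an Ore square on b and c makes the
    two refinements agree there.\<close>
  obtain x y where xy: "x \<in> cone_in T S" "y \<in> cone_in T S" "src T x = src T y" "tgt T x = src T b" "tgt T y = src T c"
    "b \<cdot> x = c \<cdot> y" using ore_cone2[of b c] ab cd by auto
  note A = ab(1,2)[THEN cone_in_ArrD] cd(1,2)[THEN cone_in_ArrD] xy(1,2)[THEN cone_in_ArrD]
  note B = F[THEN conjunct1, THEN cone_in_ArrD]
  have "s \<cdot> (a \<cdot> x) = t \<cdot> (b \<cdot> x)"
    by (rule comp_cong_right[OF ab(6)]) (use ab(3-5) xy(4) F A B in simp_all)
  also have "\<dots> = r \<cdot> (d \<cdot> y)"
    unfolding xy(6) by (rule comp_cong_right[OF cd(6)]) (use cd(3-5) xy(5) F A B in simp_all)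
  finally have 1: "s \<cdot> (a \<cdot> x) = r \<cdot> (d \<cdot> y)" .
  have "f \<cdot> (a \<cdot> x) = g \<cdot> (b \<cdot> x)"
    by (rule comp_cong_right[OF ab(7)]) (use ab(3-5) xy(4) F A B in simp_all)
  also have "\<dots> = h \<cdot> (d \<cdot> y)"
    unfolding xy(6) by (rule comp_cong_right[OF cd(7)]) (use cd(3-5) xy(5) F A B in simp_all)
  finally have 2: "f \<cdot> (a \<cdot> x) = h \<cdot> (d \<cdot> y)" .
  show ?thesis
    by (rule frac_equivI[of "a \<cdot> x" "d \<cdot> y", OF _ _ _ _ _ _ 1 2])
      (use ab(1-5) cd(1-5) xy(1-5) F A B in \<open>simp_all add: cone_in_comp\<close>)
qed

lemma mem_frac_class_iff:
  "(t, g) \<in> cls s f \<longleftrightarrow> (t, g) \<in> fractions T S (tgt T s) (tgt T f) \<and> frac_equiv T S (s, f) (t, g)"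
  by (simp add: frac_class_def)

lemma mem_cls_self: "(s, f) \<in> fractions T S X Y \<Longrightarrow> (s, f) \<in> cls s f"
  by (auto simp: mem_frac_class_iff fractions_iff frac_equiv_refl)

lemma cls_eqI:
  assumes "(s, f) \<in> fractions T S X Y" "(t, g) \<in> fractions T S X Y" "frac_equiv T S (s, f) (t, g)"
  shows "cls s f = cls t g"
proof -
  have "(r, h) \<in> cls s f \<longleftrightarrow> (r, h) \<in> cls t g" for r h
    using assms frac_equiv_sym[of s f t g] frac_equiv_trans[of s f t g r h X Y] frac_equiv_trans[of t g s f r h X Y]
    unfolding mem_frac_class_iff by (auto simp: fractions_iff)
  then show ?thesis by auto
qed

lemma cls_refine:
  assumes "s \<in> cone_in T S" "f \<in> Arr T" "src T f = src T s" "a \<in> cone_in T S" "tgt T a = src T s"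
  shows "cls (s \<cdot> a) (f \<cdot> a) = cls s f"
proof (rule cls_eqI)
  note A = assms(1,4)[THEN cone_in_ArrD]
  show "(s \<cdot> a, f \<cdot> a) \<in> fractions T S (tgt T s) (tgt T f)" "(s, f) \<in> fractions T S (tgt T s) (tgt T f)"
    using assms A by (auto simp: fractions_iff cone_in_comp)
  show "frac_equiv T S (s \<cdot> a, f \<cdot> a) (s, f)"
    using assms A by (intro frac_equivI[of "ident T (src T a)" a]) (auto simp: cone_in_comp)
qed

lemma cls_eqE:
  assumes "cls s f = cls t g" "(s, f) \<in> fractions T S X Y" "(t, g) \<in> fractions T S X' Y'"
  obtains a b where "a \<in> cone_in T S" "b \<in> cone_in T S" "src T a = src T b" "tgt T a = src T s" "tgt T b = src T t"
    "s \<cdot> a = t \<cdot> b" "f \<cdot> a = g \<cdot> b"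
proof -
  have "frac_equiv T S (s, f) (t, g)"
    using mem_cls_self[OF assms(3)] unfolding assms(1)[symmetric] by (simp add: mem_frac_class_iff)
  then show thesis using frac_equivE[OF _ _ _ that] assms(2,3) by (auto simp: fractions_iff)
qed

lemma Ob_quot [simp]: "Ob Q = Ob T"
  and ident_quot: "ident Q X = cls (ident T X) (ident T X)"
  and comp_quot: "comp Q = quot_comp T S"
  and plus_quot: "plus_arr Q = quot_plus T S"
  and zero_quot: "zero_arr Q X Y = cls (ident T X) (zero_arr T X Y)"
  by (simp_all add: quot_def)

lemma cls_Arr [simp]:
  assumes "s \<in> cone_in T S" "f \<in> Arr T" "src T f = src T s"
  shows "cls s f \<in> Arr Q" "src Q (cls s f) = tgt T s" "tgt Q (cls s f) = tgt T f"
proof -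
  have fr: "(s, f) \<in> fractions T S (tgt T s) (tgt T f)" using assms by (simp add: fractions_iff)
  then show "cls s f \<in> Arr Q" by (auto simp: quot_def)
  have "(THE X. \<exists>(s, f) \<in> cls s f. X = tgt T s) = tgt T s"
    by (rule the_equality) (use mem_cls_self[OF fr] in \<open>auto simp: mem_frac_class_iff fractions_iff\<close>)
  then show "src Q (cls s f) = tgt T s" by (simp add: quot_def)
  have "(THE Y. \<exists>(s, f) \<in> cls s f. Y = tgt T f) = tgt T f"
    by (rule the_equality) (use mem_cls_self[OF fr] in \<open>auto simp: mem_frac_class_iff fractions_iff\<close>)
  then show "tgt Q (cls s f) = tgt T f" by (simp add: quot_def)
qed

lemma Arr_quotE:
  assumes "x \<in> Arr Q"
  obtains s f where "s \<in> cone_in T S" "f \<in> Arr T" "src T f = src T s" "x = cls s f"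
    "src Q x = tgt T s" "tgt Q x = tgt T f" "s \<in> Arr T"
proof -
  obtain s f X Y where "(s, f) \<in> fractions T S X Y" "x = cls s f"
    using assms by (auto simp: quot_def)
  then show thesis using that[of s f] cone_in_ArrD by (simp add: fractions_iff)
qed

text \<open>The two completions are first refined to agree in the leg into the source of f; the
  other legs then differ by something that t kills.\<close>

lemma completion_unique:
  assumes s: "s \<in> cone_in T S" "f \<in> Arr T" "src T f = src T s"
    and t: "t \<in> cone_in T S" "g \<in> Arr T" "src T g = src T t" "tgt T t = tgt T f"
    and 1: "t1 \<in> cone_in T S" "f1 \<in> Arr T" "src T f1 = src T t1" "tgt T t1 = src T s" "tgt T f1 = src T t" "f \<cdot> t1 = t \<cdot> f1"
    and 2: "t2 \<in> cone_in T S" "f2 \<in> Arr T" "src T f2 = src T t2" "tgt T t2 = src T s" "tgt T f2 = src T t" "f \<cdot> t2 = t \<cdot> f2"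
  shows "cls (s \<cdot> t1) (g \<cdot> f1) = cls (s \<cdot> t2) (g \<cdot> f2)"
proof -
  obtain v w where vw: "v \<in> cone_in T S" "w \<in> cone_in T S" "src T v = src T w" "tgt T v = src T t1" "tgt T w = src T t2"
    "t1 \<cdot> v = t2 \<cdot> w" using ore_cone2[of t1 t2] 1 2 by auto
  note A = s(1)[THEN cone_in_ArrD] t(1)[THEN cone_in_ArrD] 1(1)[THEN cone_in_ArrD] 2(1)[THEN cone_in_ArrD]
    vw(1,2)[THEN cone_in_ArrD]
  have "t \<cdot> (f1 \<cdot> v) = f \<cdot> (t1 \<cdot> v)"
    by (rule comp_cong_right[OF 1(6)[symmetric]]) (use s t 1(1-5) vw(1-5) A in simp_all)
  also have "\<dots> = t \<cdot> (f2 \<cdot> w)"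
    unfolding vw(6) by (rule comp_cong_right[OF 2(6)]) (use s t 2(1-5) vw(1-5) A in simp_all)
  \<comment> \<open>\<open>f1 \<cdot> v\<close> and \<open>f2 \<cdot> w\<close> agree only after
    composition with t; the further denominator r makes them agree outright.\<close>
  finally obtain r where r: "r \<in> cone_in T S" "tgt T r = src T (f1 \<cdot> v)" "(f1 \<cdot> v) \<cdot> r = (f2 \<cdot> w) \<cdot> r"
    by (rule cone_in_equalised[OF t(1), rotated 5]) (use s t 1(1-5) 2(1-5) vw(1-5) A in auto)
  have r': "tgt T r = src T v" "r \<in> Arr T" using r 1(1-5) vw(1-5) A cone_in_ArrD by auto
  have "cls (s \<cdot> t1) (g \<cdot> f1) = cls ((s \<cdot> t1) \<cdot> (v \<cdot> r)) ((g \<cdot> f1) \<cdot> (v \<cdot> r))"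
    by (rule cls_refine[symmetric]) (use s t 1(1-5) vw(1-5) r(1) r' A in \<open>auto intro!: cone_in_comp\<close>)
  also have "(s \<cdot> t1) \<cdot> (v \<cdot> r) = s \<cdot> (t1 \<cdot> (v \<cdot> r))" using s 1(1-5) vw(1-5) r' A by simp
  also have "t1 \<cdot> (v \<cdot> r) = t2 \<cdot> (w \<cdot> r)"
    by (rule comp_cong_right[OF vw(6)]) (use 1(1-5) 2(1-5) vw(1-5) r' A in auto)
  also have "s \<cdot> (t2 \<cdot> (w \<cdot> r)) = (s \<cdot> t2) \<cdot> (w \<cdot> r)" using s 2(1-5) vw(1-5) r' A by simp
  also have "(g \<cdot> f1) \<cdot> (v \<cdot> r) = g \<cdot> ((f1 \<cdot> v) \<cdot> r)" using t 1(1-5) vw(1-5) r' A by simp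
  also have "\<dots> = (g \<cdot> f2) \<cdot> (w \<cdot> r)" unfolding r(3) using t 2(1-5) vw(1-5) r' A by simp
  also have "cls ((s \<cdot> t2) \<cdot> (w \<cdot> r)) ((g \<cdot> f2) \<cdot> (w \<cdot> r)) = cls (s \<cdot> t2) (g \<cdot> f2)"
    by (rule cls_refine) (use s t 2(1-5) vw(1-5) r(1) r' A in \<open>auto intro!: cone_in_comp\<close>)
  finally show ?thesis .
qed

text \<open>All classes in the union that defines composition coincide, so the value may be computed
  from any representatives and any completion of the square.\<close>

lemma comp_cls:
  assumes s: "s \<in> cone_in T S" "f \<in> Arr T" "src T f = src T s"
    and t: "t \<in> cone_in T S" "g \<in> Arr T" "src T g = src T t" "tgt T t = tgt T f"
    and 1: "t' \<in> cone_in T S" "f' \<in> Arr T" "src T f' = src T t'" "tgt T t' = src T s" "tgt T f' = src T t" "f \<cdot> t' = t \<cdot> f'"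
  shows "cls t g \<cdot>\<^sub>Q cls s f = cls (s \<cdot> t') (g \<cdot> f')"
proof -
  have indep: "cls (s0 \<cdot> t0') (g0 \<cdot> f0') = cls (s \<cdot> t') (g \<cdot> f')"
    if m: "(s0, f0) \<in> cls s f" "(t0, g0) \<in> cls t g" "t0' \<in> Hom T W (src T f0)" "t0' \<in> cone_in T S"
      "f0' \<in> Hom T W (src T t0)" "f0 \<cdot> t0' = t0 \<cdot> f0'" for s0 f0 t0 g0 t0' f0' W
  proof -
    have s0: "s0 \<in> cone_in T S" "f0 \<in> Arr T" "src T f0 = src T s0" "tgt T s0 = tgt T s" "tgt T f0 = tgt T f"
      and t0: "t0 \<in> cone_in T S" "g0 \<in> Arr T" "src T g0 = src T t0" "tgt T t0 = tgt T t" "tgt T g0 = tgt T g"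
      using m by (auto simp: mem_frac_class_iff fractions_iff)
    have t0': "t0' \<in> Arr T" "f0' \<in> Arr T" "src T f0' = src T t0'" "tgt T t0' = src T s0" "tgt T f0' = src T t0"
      using m s0 by (auto simp: Hom_iff)
    obtain a a0 where a: "a \<in> cone_in T S" "a0 \<in> cone_in T S" "src T a = src T a0" "tgt T a = src T s"
      "tgt T a0 = src T s0" "s \<cdot> a = s0 \<cdot> a0" "f \<cdot> a = f0 \<cdot> a0"
      using m(1) s s0 unfolding mem_frac_class_iff by (auto elim: frac_equivE)
    obtain b b0 where b: "b \<in> cone_in T S" "b0 \<in> cone_in T S" "src T b = src T b0" "tgt T b = src T t"
      "tgt T b0 = src T t0" "t \<cdot> b = t0 \<cdot> b0" "g \<cdot> b = g0 \<cdot> b0"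
      using m(2) t t0 unfolding mem_frac_class_iff by (auto elim: frac_equivE)
    note A = s(1)[THEN cone_in_ArrD] t(1)[THEN cone_in_ArrD] s0(1)[THEN cone_in_ArrD] t0(1)[THEN cone_in_ArrD]
      a(1,2)[THEN cone_in_ArrD] b(1,2)[THEN cone_in_ArrD]
    \<comment> \<open>A completion for the common refinements of the representatives serves both
      pairs, so both composites can be compared with it.\<close>
    obtain u v where u: "u \<in> cone_in T S" "v \<in> Arr T" "src T v = src T u" "tgt T u = src T (f \<cdot> a)"
      "tgt T v = src T (t \<cdot> b)" "(t \<cdot> b) \<cdot> v = (f \<cdot> a) \<cdot> u"
      by (rule ore_cone[of "t \<cdot> b" "f \<cdot> a"]) (use s t a(1-5) b(1-5) A cone_in_comp in auto)
    have u': "u \<in> Arr T" "tgt T u = src T a" "tgt T v = src T b"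
      using u(1-5) s t a(1-5) b(1-5) A cone_in_ArrD by auto
    have tbv: "t \<cdot> (b \<cdot> v) = f \<cdot> (a \<cdot> u)"
      using u(6) u(1-3) u' s t a(1-5) b(1-5) A by simp
    have "t0 \<cdot> (b0 \<cdot> v) = t \<cdot> (b \<cdot> v)"
      by (rule comp_cong_right[OF b(6)[symmetric]]) (use t t0 b(1-5) A u(1-3) u' in auto)
    also have "\<dots> = f0 \<cdot> (a0 \<cdot> u)" unfolding tbv
      by (rule comp_cong_right[OF a(7)]) (use s s0 a(1-5) A u(1-3) u' in auto)
    finally have u0: "f0 \<cdot> (a0 \<cdot> u) = t0 \<cdot> (b0 \<cdot> v)" ..
    have "cls (s0 \<cdot> t0') (g0 \<cdot> f0') = cls (s0 \<cdot> (a0 \<cdot> u)) (g0 \<cdot> (b0 \<cdot> v))"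
      by (rule completion_unique[of s0 f0 t0]) (use s0 t0 t0' m(4,6) t a(1-5) b(1-5) A u(1-3) u' u0 in \<open>simp_all add: cone_in_comp\<close>)
    also have "s0 \<cdot> (a0 \<cdot> u) = s \<cdot> (a \<cdot> u)"
      by (rule comp_cong_right[OF a(6)[symmetric]]) (use s s0 a(1-5) A u(1-3) u' in auto)
    also have "g0 \<cdot> (b0 \<cdot> v) = g \<cdot> (b \<cdot> v)"
      by (rule comp_cong_right[OF b(7)[symmetric]]) (use t t0 b(1-5) A u(1-3) u' in auto)
    also have "cls (s \<cdot> (a \<cdot> u)) (g \<cdot> (b \<cdot> v)) = cls (s \<cdot> t') (g \<cdot> f')"
      by (rule completion_unique[of s f t]) (use s t 1 a(1-5) b(1-5) A u(1-3) u' tbv in \<open>simp_all add: cone_in_comp\<close>)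
    finally show ?thesis .
  qed
  have self: "(s, f) \<in> cls s f" "(t, g) \<in> cls t g"
    using s t by (auto intro!: mem_cls_self simp: fractions_iff)
  have "{frac_class T S (s0 \<cdot> t0', g0 \<cdot> f0') | s0 f0 t0 g0 t0' f0' W.
     (s0, f0) \<in> cls s f \<and> (t0, g0) \<in> cls t g \<and> t0' \<in> Hom T W (src T f0) \<and> t0' \<in> cone_in T S \<and>
     f0' \<in> Hom T W (src T t0) \<and> f0 \<cdot> t0' = t0 \<cdot> f0'} = {cls (s \<cdot> t') (g \<cdot> f')}" (is "?L = _")
  proof (rule equalityI)
    show "?L \<subseteq> {cls (s \<cdot> t') (g \<cdot> f')}" using indep by blast
    have "t' \<in> Hom T (src T t') (src T f)" "f' \<in> Hom T (src T t') (src T t)"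
      using s 1 cone_in_ArrD by (auto simp: Hom_iff)
    then have "cls (s \<cdot> t') (g \<cdot> f') \<in> ?L" using self 1(1,6) by blast
    then show "{cls (s \<cdot> t') (g \<cdot> f')} \<subseteq> ?L" by blast
  qed
  then show ?thesis unfolding comp_quot quot_comp_def by simp
qed

text \<open>As for composition, all classes in the defining union coincide: the sum formed from
  arbitrary representatives and the sum over s are expanded to one denominator.\<close>

lemma plus_cls:
  assumes s: "s \<in> cone_in T S" "f \<in> Arr T" "src T f = src T s" "g \<in> Arr T" "src T g = src T s" "tgt T f = tgt T g"
  shows "cls s f \<boxplus>\<^sub>Q cls s g = cls s (f \<boxplus> g)"
proof -
  note A = s(1)[THEN cone_in_ArrD]
  have indep: "cls (s1 \<cdot> a) (f1 \<cdot> a \<boxplus> g1 \<cdot> b) = cls s (f \<boxplus> g)"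
    if m: "(s1, f1) \<in> cls s f" "(t1, g1) \<in> cls s g" "a \<in> Hom T W (src T s1)" "b \<in> Hom T W (src T t1)"
      "s1 \<cdot> a = t1 \<cdot> b" "s1 \<cdot> a \<in> cone_in T S" for s1 f1 t1 g1 a b W
  proof -
    have s1: "s1 \<in> cone_in T S" "f1 \<in> Arr T" "src T f1 = src T s1" "tgt T s1 = tgt T s" "tgt T f1 = tgt T g"
      and t1: "t1 \<in> cone_in T S" "g1 \<in> Arr T" "src T g1 = src T t1" "tgt T t1 = tgt T s" "tgt T g1 = tgt T g"
      using m s by (auto simp: mem_frac_class_iff fractions_iff)
    have ab: "a \<in> Arr T" "b \<in> Arr T" "src T b = src T a" "tgt T a = src T s1" "tgt T b = src T t1"
      using m by (auto simp: Hom_iff)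
    obtain p p1 where p: "p \<in> cone_in T S" "p1 \<in> cone_in T S" "src T p = src T p1" "tgt T p = src T s"
      "tgt T p1 = src T s1" "s \<cdot> p = s1 \<cdot> p1" "f \<cdot> p = f1 \<cdot> p1"
      using m(1) s s1 unfolding mem_frac_class_iff by (auto elim: frac_equivE)
    obtain r r1 where r: "r \<in> cone_in T S" "r1 \<in> cone_in T S" "src T r = src T r1" "tgt T r = src T s"
      "tgt T r1 = src T t1" "s \<cdot> r = t1 \<cdot> r1" "g \<cdot> r = g1 \<cdot> r1"
      using m(2) s t1 unfolding mem_frac_class_iff by (auto elim: frac_equivE)
    note B = A s1(1)[THEN cone_in_ArrD] t1(1)[THEN cone_in_ArrD] p(1,2)[THEN cone_in_ArrD] r(1,2)[THEN cone_in_ArrD]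
    obtain w w' where w: "w \<in> cone_in T S" "w' \<in> cone_in T S" "src T w = src T w'" "tgt T w = src T p"
      "tgt T w' = src T r" "p \<cdot> w = r \<cdot> w'"
      using ore_cone2[of p r] p r by auto
    note W = w(1,2)[THEN cone_in_ArrD]
    \<comment> \<open>m expands the denominator s far enough to reach both representatives at
      once.\<close>
    define m where "m = p \<cdot> w"
    have m': "m \<in> cone_in T S" "m \<in> Arr T" "src T m = src T w" "tgt T m = src T s"
      using p(1-5) w(1-5) B W by (simp_all add: m_def cone_in_comp)
    have "s \<cdot> m = s1 \<cdot> (p1 \<cdot> w)" unfolding m_def
      by (rule comp_cong_right[OF p(6)]) (use s s1 p w B W in auto)
    moreover have "s \<cdot> m = t1 \<cdot> (r1 \<cdot> w')" unfolding m_def w(6)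
      by (rule comp_cong_right[OF r(6)]) (use s t1 r w B W in auto)
    moreover have "f \<cdot> m = f1 \<cdot> (p1 \<cdot> w)" unfolding m_def
      by (rule comp_cong_right[OF p(7)]) (use s s1 p w B W in auto)
    moreover have "g \<cdot> m = g1 \<cdot> (r1 \<cdot> w')" unfolding m_def w(6)
      by (rule comp_cong_right[OF r(7)]) (use s t1 r w B W in auto)
    moreover define k where "k = p1 \<cdot> w"
    moreover define l where "l = r1 \<cdot> w'"
    moreover have kl: "k \<in> Arr T" "src T k = src T m" "tgt T k = src T s1"
       "l \<in> Arr T" "src T l = src T m" "tgt T l = src T t1"
      using p r w B W m' by (auto simp: k_def l_def)
    ultimately have M: "s \<cdot> m = s1 \<cdot> k" "s \<cdot> m = t1 \<cdot> l" "f \<cdot> m = f1 \<cdot> k" "g \<cdot> m = g1 \<cdot> l" by auto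
    obtain n n' where n: "n \<in> cone_in T S" "n' \<in> cone_in T S" "src T n = src T n'" "tgt T n = src T m"
      "tgt T n' = src T a" "(s \<cdot> m) \<cdot> n = (s1 \<cdot> a) \<cdot> n'"
      by (rule ore_cone2[of "s \<cdot> m" "s1 \<cdot> a"]) (use s s1 ab m(6) m' B cone_in_comp in auto)
    note N = n(1,2)[THEN cone_in_ArrD]
    have "s1 \<cdot> (k \<cdot> n) = (s \<cdot> m) \<cdot> n" using s1 kl M n N B by simp
    also have "\<dots> = s1 \<cdot> (a \<cdot> n')" unfolding n(6) using s1 ab N B n by simp
    finally obtain e where e: "e \<in> cone_in T S" "tgt T e = src T (k \<cdot> n)" "(k \<cdot> n) \<cdot> e = (a \<cdot> n') \<cdot> e"
      by (rule cone_in_equalised[OF s1(1), rotated 5]) (use kl n N ab in auto)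
    have e': "e \<in> Arr T" "tgt T e = src T n" using e(1,2) kl n(1-5) N cone_in_ArrD by simp_all
    have "t1 \<cdot> (l \<cdot> n) = (s \<cdot> m) \<cdot> n" using t1 kl M(2) n(1-5) N B by simp
    also have "\<dots> = (t1 \<cdot> b) \<cdot> n'" unfolding n(6) m(5) ..
    also have "\<dots> = t1 \<cdot> (b \<cdot> n')" using t1 ab N B n by simp
    finally obtain d where d: "d \<in> cone_in T S" "tgt T d = src T (l \<cdot> n)" "(l \<cdot> n) \<cdot> d = (b \<cdot> n') \<cdot> d"
      by (rule cone_in_equalised[OF t1(1), rotated 5]) (use kl n N ab in auto)
    have d': "d \<in> Arr T" "tgt T d = src T n" using d(1,2) kl n(1-5) N cone_in_ArrD by simp_all
    obtain x y where x: "x \<in> cone_in T S" "y \<in> cone_in T S" "src T x = src T y" "tgt T x = src T e" "tgt T y = src T d"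
      "e \<cdot> x = d \<cdot> y"
      using ore_cone2[of e d] e d e' d' by auto
    note X = x(1,2)[THEN cone_in_ArrD]
    \<comment> \<open>e and d repair the two numerators separately; their common refinement z
      repairs both.\<close>
    define z where "z = e \<cdot> x"
    have z: "z \<in> cone_in T S" "z \<in> Arr T" "tgt T z = src T n" "src T z = src T x"
      using x(1-5) X e(1) e' by (simp_all add: z_def cone_in_comp)
    have kz: "k \<cdot> (n \<cdot> z) = a \<cdot> (n' \<cdot> z)"
      using comp_cong_right[OF e(3), of x] kl n(1-5) N ab e' x(1-5) X by (simp add: z_def)
    have lz: "l \<cdot> (n \<cdot> z) = b \<cdot> (n' \<cdot> z)"
      using comp_cong_right[OF d(3), of y] kl n(1-5) N ab d' x(1-5) X by (simp add: z_def x(6))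
    have "cls s (f \<boxplus> g) = cls (s \<cdot> (m \<cdot> (n \<cdot> z))) ((f \<boxplus> g) \<cdot> (m \<cdot> (n \<cdot> z)))"
      by (rule cls_refine[symmetric]) (use s m' n N z in \<open>auto intro!: cone_in_comp\<close>)
    also have "s \<cdot> (m \<cdot> (n \<cdot> z)) = s1 \<cdot> (k \<cdot> (n \<cdot> z))"
      by (rule comp_cong_right[OF M(1)]) (use s s1 m' kl n N z B in auto)
    also have "\<dots> = (s1 \<cdot> a) \<cdot> (n' \<cdot> z)" unfolding kz using s1 ab n N z B by simp
    also have "(f \<boxplus> g) \<cdot> (m \<cdot> (n \<cdot> z)) = f1 \<cdot> (k \<cdot> (n \<cdot> z)) \<boxplus> g1 \<cdot> (l \<cdot> (n \<cdot> z))"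
      using s s1 t1 m' kl n N z B comp_cong_right[OF M(3), of "n \<cdot> z"] comp_cong_right[OF M(4), of "n \<cdot> z"]
      by (simp add: comp_plus_dist_right)
    also have "\<dots> = (f1 \<cdot> a \<boxplus> g1 \<cdot> b) \<cdot> (n' \<cdot> z)"
      unfolding kz lz using s1 t1 ab n N z B by (simp add: comp_plus_dist_right)
    also have "cls ((s1 \<cdot> a) \<cdot> (n' \<cdot> z)) ((f1 \<cdot> a \<boxplus> g1 \<cdot> b) \<cdot> (n' \<cdot> z)) = cls (s1 \<cdot> a) (f1 \<cdot> a \<boxplus> g1 \<cdot> b)"
      by (rule cls_refine) (use m(6) s1 t1 ab n N z B in \<open>auto intro!: cone_in_comp\<close>)
    finally show ?thesis ..
  qed
  have self: "(s, f) \<in> cls s f" "(s, g) \<in> cls s g"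
    using s by (auto intro!: mem_cls_self simp: fractions_iff)
  have "{frac_class T S (s1 \<cdot> a, f1 \<cdot> a \<boxplus> g1 \<cdot> b) | s1 f1 t1 g1 a b W.
     (s1, f1) \<in> cls s f \<and> (t1, g1) \<in> cls s g \<and> a \<in> Hom T W (src T s1) \<and> b \<in> Hom T W (src T t1) \<and>
     s1 \<cdot> a = t1 \<cdot> b \<and> s1 \<cdot> a \<in> cone_in T S} = {cls s (f \<boxplus> g)}" (is "?L = _")
  proof (rule equalityI)
    show "?L \<subseteq> {cls s (f \<boxplus> g)}" using indep by blast
    have i: "ident T (src T s) \<in> Hom T (src T s) (src T s)" "s \<cdot> ident T (src T s) = s"
      "f \<cdot> ident T (src T s) = f" "g \<cdot> ident T (src T s) = g"
      using s A by (auto simp: Hom_iff)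
    then have "\<exists>s1 f1 t1 g1 a b W. cls s (f \<boxplus> g) = cls (s1 \<cdot> a) (f1 \<cdot> a \<boxplus> g1 \<cdot> b) \<and>
       (s1, f1) \<in> cls s f \<and> (t1, g1) \<in> cls s g \<and> a \<in> Hom T W (src T s1) \<and> b \<in> Hom T W (src T t1) \<and>
       s1 \<cdot> a = t1 \<cdot> b \<and> s1 \<cdot> a \<in> cone_in T S"
      using self s(1) by (intro exI[of _ s] exI[of _ f] exI[of _ g] exI[of _ "ident T (src T s)"] exI[of _ "src T s"]) simp
    then show "{cls s (f \<boxplus> g)} \<subseteq> ?L" by blast
  qed
  then show ?thesis unfolding plus_quot quot_plus_def by simp
qed

section \<open>Group laws, category laws and bilinearity\<close>

lemma common_denominator:
  assumes "x \<in> Arr Q" "y \<in> Arr Q" "src Q x = src Q y"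
  obtains s f g where "s \<in> cone_in T S" "f \<in> Arr T" "src T f = src T s" "g \<in> Arr T" "src T g = src T s"
    "x = cls s f" "y = cls s g" "tgt T s = src Q x" "tgt T f = tgt Q x" "tgt T g = tgt Q y" "s \<in> Arr T"
proof -
  obtain s f where s: "s \<in> cone_in T S" "f \<in> Arr T" "src T f = src T s" "x = cls s f"
    "src Q x = tgt T s" "tgt Q x = tgt T f" "s \<in> Arr T" using assms(1) by (rule Arr_quotE)
  obtain t g where t: "t \<in> cone_in T S" "g \<in> Arr T" "src T g = src T t" "y = cls t g"
    "src Q y = tgt T t" "tgt Q y = tgt T g" "t \<in> Arr T" using assms(2) by (rule Arr_quotE)
  obtain a b where ab: "a \<in> cone_in T S" "b \<in> cone_in T S" "src T a = src T b" "tgt T a = src T s" "tgt T b = src T t"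
    "s \<cdot> a = t \<cdot> b" using ore_cone2[of s t] s(1,5) t(1,5) assms(3) by auto
  note A = ab(1,2)[THEN cone_in_ArrD]
  have "x = cls (s \<cdot> a) (f \<cdot> a)" unfolding s(4) by (rule cls_refine[symmetric]) (use s(1-3) ab in simp_all)
  moreover have "y = cls (s \<cdot> a) (g \<cdot> b)"
    unfolding t(4) ab(6) by (rule cls_refine[symmetric]) (use t(1-3) ab in simp_all)
  ultimately show thesis
    by (intro that[of "s \<cdot> a" "f \<cdot> a" "g \<cdot> b"]) (use s(1-3,7) s(5,6)[symmetric] t(2,3,7) t(6)[symmetric] ab(1-5) A in \<open>simp_all add: cone_in_comp\<close>)
qed

lemma cls_zero: "\<lbrakk>s \<in> cone_in T S; X = src T s; Y \<in> Ob T\<rbrakk> \<Longrightarrow> cls s (\<zero> X Y) = \<zero>\<^sub>Q (tgt T s) Y"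
  unfolding zero_quot using cls_refine[of "ident T (tgt T s)" "\<zero> (tgt T s) Y" s] cone_in_ArrD[of s] by simp

lemma comm_group_hom_quot:
  assumes XY: "X \<in> Ob T" "Y \<in> Ob T" shows "comm_group (hom_group Q X Y)"
proof -
  have zero: "zero_arr Q X Y \<in> Hom Q X Y"
    using XY by (simp add: zero_quot Hom_iff)
  show ?thesis
    unfolding hom_group_def
  proof (rule comm_groupI; (simp only: partial_object.simps monoid.simps)?)
    show "zero_arr Q X Y \<in> Hom Q X Y" by (rule zero)
  next
    fix x y assume xy: "x \<in> Hom Q X Y" "y \<in> Hom Q X Y"
    obtain s f g where s: "s \<in> cone_in T S" "f \<in> Arr T" "src T f = src T s" "g \<in> Arr T" "src T g = src T s"
      "x = cls s f" "y = cls s g" "tgt T s = X" "tgt T f = Y" "tgt T g = Y"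
      using common_denominator[of x y] xy unfolding Hom_iff by metis
    have e: "x \<boxplus>\<^sub>Q y = cls s (f \<boxplus> g)" "y \<boxplus>\<^sub>Q x = cls s (g \<boxplus> f)"
      unfolding s(6,7) by (rule plus_cls; use s(1-5,8-10) in simp)+
    show "x \<boxplus>\<^sub>Q y \<in> Hom Q X Y" unfolding e using s(1-5,8-10) by (simp add: Hom_iff)
    show "x \<boxplus>\<^sub>Q y = y \<boxplus>\<^sub>Q x"
      unfolding e using s(1-5,8-10) plus_comm[of f g] by simp
  next
    fix x y z assume xyz: "x \<in> Hom Q X Y" "y \<in> Hom Q X Y" "z \<in> Hom Q X Y"
    obtain s f g where s: "s \<in> cone_in T S" "f \<in> Arr T" "src T f = src T s" "g \<in> Arr T" "src T g = src T s"
      "x = cls s f" "y = cls s g" "tgt T s = X" "tgt T f = Y" "tgt T g = Y"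
      using common_denominator[of x y] xyz unfolding Hom_iff by metis
    obtain t h where t: "t \<in> cone_in T S" "h \<in> Arr T" "src T h = src T t" "z = cls t h"
      "X = tgt T t" "Y = tgt T h" using xyz(3) Arr_quotE[of z] unfolding Hom_iff by metis
    obtain a b where ab: "a \<in> cone_in T S" "b \<in> cone_in T S" "src T a = src T b" "tgt T a = src T s" "tgt T b = src T t"
      "s \<cdot> a = t \<cdot> b" using ore_cone2[of s t] s(1,8) t(1,5) by auto
    note A = ab(1,2)[THEN cone_in_ArrD] s(1)[THEN cone_in_ArrD] t(1)[THEN cone_in_ArrD]
    let ?s = "s \<cdot> a"
    have c: "?s \<in> cone_in T S" using s(1) ab(1-5) by (simp add: cone_in_comp)
    have x: "x = cls ?s (f \<cdot> a)" "y = cls ?s (g \<cdot> a)"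
      unfolding s(6,7) by (rule cls_refine[symmetric]; use s(1-5) ab in simp)+
    have z: "z = cls ?s (h \<cdot> b)"
      unfolding t(4) ab(6) by (rule cls_refine[symmetric]) (use t(1-3) ab in simp_all)
    note ty = s(2-5,8-10) t(2,3) t(5,6)[symmetric] ab(3-5) A c
    show "x \<boxplus>\<^sub>Q y \<boxplus>\<^sub>Q z = x \<boxplus>\<^sub>Q (y \<boxplus>\<^sub>Q z)"
      unfolding x z using ty by (simp add: plus_cls plus_assoc)
  next
    fix x assume x: "x \<in> Hom Q X Y"
    obtain s f where s: "s \<in> cone_in T S" "f \<in> Arr T" "src T f = src T s" "x = cls s f"
      "X = tgt T s" "Y = tgt T f" "s \<in> Arr T" using x Arr_quotE[of x] unfolding Hom_iff by metis
    have z: "\<zero>\<^sub>Q X Y = cls s (\<zero> (src T s) Y)"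
      unfolding s(5,6) by (rule cls_zero[symmetric]) (use s(1,2) in simp_all)
    note ty = s(1-3,7) s(5,6)[symmetric]
    show "\<zero>\<^sub>Q X Y \<boxplus>\<^sub>Q x = x"
      unfolding z unfolding s(4) using ty XY by (simp add: plus_cls)
    have "cls s (neg_arr T f) \<boxplus>\<^sub>Q x = \<zero>\<^sub>Q X Y"
      unfolding z unfolding s(4) using ty XY by (simp add: plus_cls)
    moreover have "cls s (neg_arr T f) \<in> Hom Q X Y" using ty by (simp add: Hom_iff)
    ultimately show "\<exists>y\<in>Hom Q X Y. y \<boxplus>\<^sub>Q x = \<zero>\<^sub>Q X Y" by blast
  qed
qed

lemma comp_cls_ex:
  assumes s: "s \<in> cone_in T S" "f \<in> Arr T" "src T f = src T s"
    and t: "t \<in> cone_in T S" "g \<in> Arr T" "src T g = src T t" "tgt T t = tgt T f"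
  obtains t' f' where "t' \<in> cone_in T S" "f' \<in> Arr T" "src T f' = src T t'" "tgt T t' = src T s" "tgt T f' = src T t"
    "f \<cdot> t' = t \<cdot> f'" "cls t g \<cdot>\<^sub>Q cls s f = cls (s \<cdot> t') (g \<cdot> f')" "t' \<in> Arr T"
proof -
  obtain t' f' where u: "t' \<in> cone_in T S" "f' \<in> Arr T" "src T f' = src T t'" "tgt T t' = src T f" "tgt T f' = src T t"
    "t \<cdot> f' = f \<cdot> t'" by (rule ore_cone[OF t(1) s(2) t(4)])
  moreover have "cls t g \<cdot>\<^sub>Q cls s f = cls (s \<cdot> t') (g \<cdot> f')"
    by (rule comp_cls[OF s t]) (use u s in simp_all)
  ultimately show thesis using s by (intro that[of t' f']) (simp_all add: cone_in_ArrD)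
qed

lemma category_quot: "category Q"
proof
  fix x assume "x \<in> Arr Q"
  then show "src Q x \<in> Ob Q" "tgt Q x \<in> Ob Q" by (auto elim!: Arr_quotE)
next
  fix X assume "X \<in> Ob Q"
  then show "ident Q X \<in> Hom Q X X" by (simp add: ident_quot Hom_iff)
next
  fix x y X Y Z assume "x \<in> Hom Q X Y" "y \<in> Hom Q Y Z"
  then have xy: "x \<in> Arr Q" "y \<in> Arr Q" "src Q x = X" "tgt Q x = Y" "src Q y = Y" "tgt Q y = Z" by (simp_all add: Hom_iff)
  obtain s f where s: "s \<in> cone_in T S" "f \<in> Arr T" "src T f = src T s" "x = cls s f"
    "src Q x = tgt T s" "tgt Q x = tgt T f" "s \<in> Arr T" using xy(1) by (rule Arr_quotE)
  obtain t g where t: "t \<in> cone_in T S" "g \<in> Arr T" "src T g = src T t" "y = cls t g"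
    "src Q y = tgt T t" "tgt Q y = tgt T g" "t \<in> Arr T" using xy(2) by (rule Arr_quotE)
  obtain t' f' where u: "t' \<in> cone_in T S" "f' \<in> Arr T" "src T f' = src T t'" "tgt T t' = src T s" "tgt T f' = src T t"
    "f \<cdot> t' = t \<cdot> f'" "y \<cdot>\<^sub>Q x = cls (s \<cdot> t') (g \<cdot> f')" "t' \<in> Arr T"
    unfolding t(4) s(4) by (rule comp_cls_ex[OF s(1-3) t(1-3)]) (use s(6) t(5) xy in simp_all)
  show "y \<cdot>\<^sub>Q x \<in> Hom Q X Z"
    unfolding u(7) using s(1-3,7) t(1-3) u(1-5,8) s(5) t(6) xy(3,6) by (simp add: Hom_iff cone_in_comp)
next
  fix x X Y assume "x \<in> Hom Q X Y"
  then have x: "x \<in> Arr Q" "src Q x = X" "tgt Q x = Y" by (simp_all add: Hom_iff)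
  obtain s f where s: "s \<in> cone_in T S" "f \<in> Arr T" "src T f = src T s" "x = cls s f"
    "src Q x = tgt T s" "tgt Q x = tgt T f" "s \<in> Arr T" using x(1) by (rule Arr_quotE)
  have "cls s f \<cdot>\<^sub>Q cls (ident T (tgt T s)) (ident T (tgt T s)) = cls (ident T (tgt T s) \<cdot> s) (f \<cdot> ident T (src T s))"
    by (rule comp_cls) (use s(1-3,7) in simp_all)
  then show "x \<cdot>\<^sub>Q ident Q X = x" unfolding ident_quot using s x by simp
  have "cls (ident T (tgt T f)) (ident T (tgt T f)) \<cdot>\<^sub>Q cls s f = cls (s \<cdot> ident T (src T s)) (ident T (tgt T f) \<cdot> f)"
    by (rule comp_cls) (use s(1-3,7) in simp_all)
  then show "ident Q Y \<cdot>\<^sub>Q x = x" unfolding ident_quot using s x by simp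
next
  fix x y z W X Y Z assume "x \<in> Hom Q W X" "y \<in> Hom Q X Y" "z \<in> Hom Q Y Z"
  then have xyz: "x \<in> Arr Q" "y \<in> Arr Q" "z \<in> Arr Q" "tgt Q x = X" "src Q y = X" "tgt Q y = Y" "src Q z = Y"
    by (simp_all add: Hom_iff)
  obtain s f where s: "s \<in> cone_in T S" "f \<in> Arr T" "src T f = src T s" "x = cls s f"
    "src Q x = tgt T s" "tgt Q x = tgt T f" "s \<in> Arr T" using xyz(1) by (rule Arr_quotE)
  obtain t g where t: "t \<in> cone_in T S" "g \<in> Arr T" "src T g = src T t" "y = cls t g"
    "src Q y = tgt T t" "tgt Q y = tgt T g" "t \<in> Arr T" using xyz(2) by (rule Arr_quotE)
  obtain r h where r: "r \<in> cone_in T S" "h \<in> Arr T" "src T h = src T r" "z = cls r h"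
    "src Q z = tgt T r" "tgt Q z = tgt T h" "r \<in> Arr T" using xyz(3) by (rule Arr_quotE)
  obtain t' f' where u: "t' \<in> cone_in T S" "f' \<in> Arr T" "src T f' = src T t'" "tgt T t' = src T s" "tgt T f' = src T t"
    "f \<cdot> t' = t \<cdot> f'" "y \<cdot>\<^sub>Q x = cls (s \<cdot> t') (g \<cdot> f')" "t' \<in> Arr T"
    unfolding t(4) s(4) by (rule comp_cls_ex[OF s(1-3) t(1-3)]) (use s(6) t(5) xyz in simp_all)
  obtain r' g' where v: "r' \<in> cone_in T S" "g' \<in> Arr T" "src T g' = src T r'" "tgt T r' = src T t" "tgt T g' = src T r"
    "g \<cdot> r' = r \<cdot> g'" "z \<cdot>\<^sub>Q y = cls (t \<cdot> r') (h \<cdot> g')" "r' \<in> Arr T"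
    unfolding t(4) r(4) by (rule comp_cls_ex[OF t(1-3) r(1-3)]) (use t(6) r(5) xyz in simp_all)
  \<comment> \<open>A third square, on f' and r', lies over the two earlier ones; with it both
    bracketings become the same fraction, with denominator
    \<open>s \<cdot> (t' \<cdot> r'')\<close>.\<close>
  obtain r'' f'' where w: "r'' \<in> cone_in T S" "f'' \<in> Arr T" "src T f'' = src T r''" "tgt T r'' = src T f'"
    "tgt T f'' = src T r'" "r' \<cdot> f'' = f' \<cdot> r''"
    by (rule ore_cone[OF v(1) u(2)]) (use u(5) v(4) in auto)
  have w': "r'' \<in> Arr T" "tgt T r'' = src T t'" using w u cone_in_ArrD by auto
  note ty = s(1-3,7) t(1-3,7) r(1-3,7) u(1-5,8) v(1-5,8) w(1-3,5) w'
  have xy: "tgt T f = tgt T t" "tgt T g = tgt T r" using s(6) t(5,6) r(5) xyz by simp_all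
  have "z \<cdot>\<^sub>Q (y \<cdot>\<^sub>Q x) = cls ((s \<cdot> t') \<cdot> r'') (h \<cdot> (g' \<cdot> f''))"
    unfolding u(7) unfolding r(4)
  proof (rule comp_cls)
    have "g \<cdot> (f' \<cdot> r'') = r \<cdot> (g' \<cdot> f'')"
      unfolding w(6)[symmetric] by (rule comp_cong_right[OF v(6)]) (use ty xy in simp_all)
    then show "(g \<cdot> f') \<cdot> r'' = r \<cdot> (g' \<cdot> f'')" using ty xy by simp
  qed (use ty xy in \<open>simp_all add: cone_in_comp\<close>)
  moreover have "(z \<cdot>\<^sub>Q y) \<cdot>\<^sub>Q x = cls (s \<cdot> (t' \<cdot> r'')) ((h \<cdot> g') \<cdot> f'')"
    unfolding v(7) unfolding s(4)
  proof (rule comp_cls)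
    have "f \<cdot> (t' \<cdot> r'') = t \<cdot> (f' \<cdot> r'')"
      by (rule comp_cong_right[OF u(6)]) (use ty xy in simp_all)
    then show "f \<cdot> (t' \<cdot> r'') = (t \<cdot> r') \<cdot> f''" unfolding w(6)[symmetric] using ty xy by simp
  qed (use ty xy in \<open>simp_all add: cone_in_comp\<close>)
  ultimately show "(z \<cdot>\<^sub>Q y) \<cdot>\<^sub>Q x = z \<cdot>\<^sub>Q (y \<cdot>\<^sub>Q x)" using ty xy by simp
qed

sublocale Q: category "quot T S" by (rule category_quot)

lemma preadditive_quot: "preadditive_category Q"
proof (intro preadditive_category.intro category_quot preadditive_category_axioms.intro)
  fix X Y assume "X \<in> Ob Q" "Y \<in> Ob Q"
  then show "comm_group (hom_group Q X Y)" by (simp add: comm_group_hom_quot)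
next
  fix x y y' X Y Z assume "x \<in> Hom Q X Y" "y \<in> Hom Q Y Z" "y' \<in> Hom Q Y Z"
  then have xy: "x \<in> Arr Q" "y \<in> Arr Q" "y' \<in> Arr Q" "tgt Q x = Y" "src Q y = Y" "src Q y' = Y" "tgt Q y = Z" "tgt Q y' = Z"
    by (simp_all add: Hom_iff)
  obtain s f where s: "s \<in> cone_in T S" "f \<in> Arr T" "src T f = src T s" "x = cls s f"
    "src Q x = tgt T s" "tgt Q x = tgt T f" "s \<in> Arr T" using xy(1) by (rule Arr_quotE)
  obtain t g h where t: "t \<in> cone_in T S" "g \<in> Arr T" "src T g = src T t" "h \<in> Arr T" "src T h = src T t"
    "y = cls t g" "y' = cls t h" "tgt T t = src Q y" "tgt T g = tgt Q y" "tgt T h = tgt Q y'" "t \<in> Arr T"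
    by (rule common_denominator[OF xy(2,3)]) (use xy in simp_all)
  obtain t' f' where u: "t' \<in> cone_in T S" "f' \<in> Arr T" "src T f' = src T t'" "tgt T t' = src T f" "tgt T f' = src T t"
    "t \<cdot> f' = f \<cdot> t'" by (rule ore_cone[OF t(1) s(2)]) (use s(6) t(8) xy in simp_all)
  have u': "t' \<in> Arr T" "tgt T t' = src T s" using u s cone_in_ArrD by auto
  have e: "cls t k \<cdot>\<^sub>Q cls s f = cls (s \<cdot> t') (k \<cdot> f')" if "k \<in> Arr T" "src T k = src T t" for k
    by (rule comp_cls) (use that s(1-3,6) t(1,8) u u' xy in simp_all)
  have eq: "tgt T g = tgt T h" using t xy by simp
  show "(y \<boxplus>\<^sub>Q y') \<cdot>\<^sub>Q x = y \<cdot>\<^sub>Q x \<boxplus>\<^sub>Q y' \<cdot>\<^sub>Q x"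
    unfolding t(6,7) s(4) using s(1-3,7) t(1-5,11) u(1-3,5) u' eq
    by (simp add: plus_cls e cone_in_comp comp_plus_dist_right)
next
  fix x x' y X Y Z assume "x \<in> Hom Q X Y" "x' \<in> Hom Q X Y" "y \<in> Hom Q Y Z"
  then have xy: "x \<in> Arr Q" "x' \<in> Arr Q" "y \<in> Arr Q" "tgt Q x = Y" "tgt Q x' = Y" "src Q y = Y" "src Q x = src Q x'"
    by (simp_all add: Hom_iff)
  obtain t g where t: "t \<in> cone_in T S" "g \<in> Arr T" "src T g = src T t" "y = cls t g"
    "src Q y = tgt T t" "tgt Q y = tgt T g" "t \<in> Arr T" using xy(3) by (rule Arr_quotE)
  obtain s f h where s: "s \<in> cone_in T S" "f \<in> Arr T" "src T f = src T s" "h \<in> Arr T" "src T h = src T s"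
    "x = cls s f" "x' = cls s h" "tgt T s = src Q x" "tgt T f = tgt Q x" "tgt T h = tgt Q x'" "s \<in> Arr T"
    by (rule common_denominator[OF xy(1,2,7)])
  have st: "tgt T f = tgt T t" "tgt T h = tgt T t" using s(9,10) t(5) xy by simp_all
  obtain t1 f1 where u: "t1 \<in> cone_in T S" "f1 \<in> Arr T" "src T f1 = src T t1" "tgt T t1 = src T f" "tgt T f1 = src T t"
    "t \<cdot> f1 = f \<cdot> t1" by (rule ore_cone[OF t(1) s(2)]) (use st in simp_all)
  obtain t2 h2 where v: "t2 \<in> cone_in T S" "h2 \<in> Arr T" "src T h2 = src T t2" "tgt T t2 = src T h" "tgt T h2 = src T t"
    "t \<cdot> h2 = h \<cdot> t2" by (rule ore_cone[OF t(1) s(4)]) (use st in simp_all)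
  \<comment> \<open>The squares for the two numerators were completed separately. Refining them to
    one denominator w lets f' + h' complete the square of the sum.\<close>
  obtain a b where ab: "a \<in> cone_in T S" "b \<in> cone_in T S" "src T a = src T b" "tgt T a = src T t1" "tgt T b = src T t2"
    "t1 \<cdot> a = t2 \<cdot> b" using ore_cone2[of t1 t2] u(1,4) v(1,4) s(3,5) by auto
  define w where "w = t1 \<cdot> a"
  define f' where "f' = f1 \<cdot> a"
  define h' where "h' = h2 \<cdot> b"
  note A = ab(1,2)[THEN cone_in_ArrD] u(1)[THEN cone_in_ArrD] v(1)[THEN cone_in_ArrD]
  have ty: "w \<in> cone_in T S" "w \<in> Arr T" "tgt T w = src T s" "f' \<in> Arr T" "src T f' = src T w" "tgt T f' = src T t"
    "h' \<in> Arr T" "src T h' = src T w" "tgt T h' = src T t"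
    using A ab(1-5) u(1-5) v(1-5) s(3,5) by (simp_all add: w_def f'_def h'_def cone_in_comp)
  have fw: "f \<cdot> w = t \<cdot> f'" unfolding w_def f'_def
    by (rule comp_cong_right[OF u(6)[symmetric]]) (use A ab(1-5) u(1-5) s(2,3) t(7) in simp_all)
  have hw: "h \<cdot> w = t \<cdot> h'" unfolding w_def h'_def ab(6)
    by (rule comp_cong_right[OF v(6)[symmetric]]) (use A ab(1-5) v(1-5) s(4,5) t(7) in simp_all)
  have fhw: "(f \<boxplus> h) \<cdot> w = t \<cdot> (f' \<boxplus> h')"
    using ty s(2-5) st t(7) by (simp add: comp_plus_dist_right comp_plus_dist_left fw hw)
  have e: "cls t g \<cdot>\<^sub>Q cls s k = cls (s \<cdot> w) (g \<cdot> k')"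
    if "k \<in> Arr T" "src T k = src T s" "tgt T k = tgt T t" "k \<cdot> w = t \<cdot> k'" "k' \<in> Arr T" "src T k' = src T w" "tgt T k' = src T t"
    for k k'
    by (rule comp_cls) (use that s(1) t(1-3) ty in simp_all)
  have "y \<cdot>\<^sub>Q (x \<boxplus>\<^sub>Q x') = cls (s \<cdot> w) (g \<cdot> (f' \<boxplus> h'))"
    unfolding t(4) s(6,7) using s(1-5) st ty fhw by (simp add: plus_cls e)
  moreover have "y \<cdot>\<^sub>Q x \<boxplus>\<^sub>Q y \<cdot>\<^sub>Q x' = cls (s \<cdot> w) (g \<cdot> f' \<boxplus> g \<cdot> h')"
    unfolding t(4) s(6,7) using s(1-5,11) st ty fw hw t(2,3) by (simp add: plus_cls e cone_in_comp)
  ultimately show "y \<cdot>\<^sub>Q (x \<boxplus>\<^sub>Q x') = y \<cdot>\<^sub>Q x \<boxplus>\<^sub>Q y \<cdot>\<^sub>Q x'"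
    using t(2,3) ty by (simp add: comp_plus_dist_left)
qed

sublocale Q: preadditive_category "quot T S" by (rule preadditive_quot)

end

section \<open>The quotient functor\<close>

lemma UN_eq_const: "\<lbrakk>a \<in> A; \<And>p. p \<in> A \<Longrightarrow> F p = X\<rbrakk> \<Longrightarrow> (\<Union>p\<in>A. F p) = X"
  by auto

context thick_subcategory
begin

lemma src_quot_Ob [simp]: "x \<in> Arr Q \<Longrightarrow> src Q x \<in> Ob T"
  and tgt_quot_Ob [simp]: "x \<in> Arr Q \<Longrightarrow> tgt Q x \<in> Ob T"
  using Q.src_Ob[of x] Q.tgt_Ob[of x] by simp_all

lemma q_Arr [simp]: "f \<in> Arr T \<Longrightarrow> q f \<in> Arr Q"
  and src_q [simp]: "f \<in> Arr T \<Longrightarrow> src Q (q f) = src T f"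
  and tgt_q [simp]: "f \<in> Arr T \<Longrightarrow> tgt Q (q f) = tgt T f"
  by (simp_all add: quot_functor_def)

lemma q_ident [simp]: "X \<in> Ob T \<Longrightarrow> q (ident T X) = ident Q X"
  by (simp add: quot_functor_def ident_quot)

lemma cls_comp_q:
  assumes "s \<in> cone_in T S" "f \<in> Arr T" "src T f = src T s" "g \<in> Arr T" "tgt T g = src T f"
  shows "cls s f \<cdot>\<^sub>Q q (s \<cdot> g) = q (f \<cdot> g)"
proof -
  have "cls s f \<cdot>\<^sub>Q cls (ident T (src T g)) (s \<cdot> g) = cls (ident T (src T g) \<cdot> ident T (src T g)) (f \<cdot> g)"
    by (rule comp_cls) (use assms cone_in_ArrD[of s] in simp_all)
  then show ?thesis using assms cone_in_ArrD[of s] by (simp add: quot_functor_def)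
qed

lemma q_comp [simp]:
  assumes "f \<in> Arr T" "g \<in> Arr T" "tgt T f = src T g"
  shows "q (g \<cdot> f) = q g \<cdot>\<^sub>Q q f"
  using cls_comp_q[of "ident T (src T g)" g f] assms by (simp add: quot_functor_def)

lemma cls_comp_q_self: "\<lbrakk>s \<in> cone_in T S; f \<in> Arr T; src T f = src T s\<rbrakk> \<Longrightarrow> cls s f \<cdot>\<^sub>Q q s = q f"
  using cls_comp_q[of s f "ident T (src T s)"] cone_in_ArrD[of s] by simp

lemma q_plus [simp]:
  "\<lbrakk>f \<in> Arr T; g \<in> Arr T; src T f = src T g; tgt T f = tgt T g\<rbrakk> \<Longrightarrow> q (f \<boxplus> g) = q f \<boxplus>\<^sub>Q q g"
  by (simp add: quot_functor_def plus_cls)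

lemma q_zero [simp]: "\<lbrakk>X \<in> Ob T; Y \<in> Ob T\<rbrakk> \<Longrightarrow> q (\<zero> X Y) = \<zero>\<^sub>Q X Y"
  by (simp add: quot_functor_def cls_zero)

lemma q_neg [simp]: "f \<in> Arr T \<Longrightarrow> q (neg_arr T f) = neg_arr Q (q f)"
  by (rule Q.neg_eqI[symmetric]) (simp_all flip: q_plus)

lemma q_iso:
  assumes "s \<in> cone_in T S" shows "is_iso Q (q s)"
proof (rule Q.is_isoI)
  have s: "s \<in> Arr T" using assms by (rule cone_in_ArrD)
  let ?s' = "cls s (ident T (src T s))"
  show "q s \<in> Arr Q" "?s' \<in> Arr Q" "src Q ?s' = tgt Q (q s)" "tgt Q ?s' = src Q (q s)"
    using assms s by simp_all
  show "?s' \<cdot>\<^sub>Q q s = ident Q (src Q (q s))"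
    using assms s by (simp add: cls_comp_q_self)
  have "q s \<cdot>\<^sub>Q ?s' = cls s s"
    unfolding quot_functor_def using comp_cls[of s "ident T (src T s)" "ident T (src T s)" s "ident T (src T s)" "ident T (src T s)"]
      assms s by simp
  also have "\<dots> = ident Q (tgt T s)"
    using cls_refine[of "ident T (tgt T s)" "ident T (tgt T s)" s] assms s by (simp add: ident_quot)
  finally show "q s \<cdot>\<^sub>Q ?s' = ident Q (tgt Q (q s))" using s by simp
qed

lemma quot_right_fraction:
  assumes "x \<in> Arr Q"
  obtains s f where "s \<in> cone_in T S" "f \<in> Arr T" "src T f = src T s" "tgt T s = src Q x" "tgt T f = tgt Q x"
    "s \<in> Arr T" "x = cls s f" "x \<cdot>\<^sub>Q q s = q f"
proof -
  obtain s f where s: "s \<in> cone_in T S" "f \<in> Arr T" "src T f = src T s" "x = cls s f"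
    "src Q x = tgt T s" "tgt Q x = tgt T f" "s \<in> Arr T" using assms by (rule Arr_quotE)
  then show thesis using cls_comp_q_self[OF s(1-3)] by (intro that[of s f]) simp_all
qed

lemma cls_eq_if_comp_q:
  assumes "x \<in> Arr Q" "s \<in> cone_in T S" "f \<in> Arr T" "src T f = src T s" "tgt T s = src Q x" "x \<cdot>\<^sub>Q q s = q f"
  shows "x = cls s f"
  by (rule Q.iso_cancel_right[OF q_iso[OF assms(2)]])
    (use assms cls_comp_q_self[OF assms(2-4)] cone_in_ArrD[OF assms(2)] in simp_all)

lemma q_eq_zero_iff_annihilated:
  assumes "k \<in> Arr T"
  shows "q k = \<zero>\<^sub>Q (src T k) (tgt T k) \<longleftrightarrow>
    (\<exists>t \<in> cone_in T S. tgt T t = src T k \<and> k \<cdot> t = \<zero> (src T t) (tgt T k))"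
proof
  assume "q k = \<zero>\<^sub>Q (src T k) (tgt T k)"
  then have e: "cls (ident T (src T k)) k = cls (ident T (src T k)) (\<zero> (src T k) (tgt T k))"
    by (simp add: quot_functor_def zero_quot)
  obtain a b where ab: "a \<in> cone_in T S" "b \<in> cone_in T S" "src T a = src T b" "tgt T a = src T k" "tgt T b = src T k"
     "k \<cdot> a = \<zero> (src T k) (tgt T k) \<cdot> b"
    by (rule cls_eqE[OF e, of "src T k" "tgt T k" "src T k" "tgt T k"]) (use assms in \<open>auto simp: fractions_iff\<close>)
  then show "\<exists>t \<in> cone_in T S. tgt T t = src T k \<and> k \<cdot> t = \<zero> (src T t) (tgt T k)"
    using assms cone_in_ArrD[of b] by (intro bexI[of _ a]) auto
next
  assume "\<exists>t \<in> cone_in T S. tgt T t = src T k \<and> k \<cdot> t = \<zero> (src T t) (tgt T k)"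
  then obtain t where t: "t \<in> cone_in T S" "tgt T t = src T k" "k \<cdot> t = \<zero> (src T t) (tgt T k)" by blast
  have t': "t \<in> Arr T" using t cone_in_ArrD by blast
  have "q k \<cdot>\<^sub>Q q t = q (k \<cdot> t)" using assms t(2) t' by simp
  also have "\<dots> = \<zero>\<^sub>Q (src T t) (tgt T k)" unfolding t(3) using assms t' by simp
  finally have "q k \<cdot>\<^sub>Q q t = \<zero>\<^sub>Q (src T t) (tgt T k)" .
  then show "q k = \<zero>\<^sub>Q (src T k) (tgt T k)"
    using Q.iso_cancel_right[OF q_iso[OF t(1)], of "q k" "\<zero>\<^sub>Q (src T k) (tgt T k)"] assms t(2) t' by simp
qed

lemma q_eq_zero_iff:
  "k \<in> Arr T \<Longrightarrow> q k = \<zero>\<^sub>Q (src T k) (tgt T k) \<longleftrightarrow> factors_through T k S"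
  by (simp add: q_eq_zero_iff_annihilated annihilated_iff_factors_through)

lemma cls_eq_zero_iff:
  assumes "s \<in> cone_in T S" "f \<in> Arr T" "src T f = src T s"
  shows "cls s f = \<zero>\<^sub>Q (tgt T s) (tgt T f) \<longleftrightarrow> q f = \<zero>\<^sub>Q (src T f) (tgt T f)"
proof
  have s: "s \<in> Arr T" using assms(1) by (rule cone_in_ArrD)
  show "q f = \<zero>\<^sub>Q (src T f) (tgt T f)" if "cls s f = \<zero>\<^sub>Q (tgt T s) (tgt T f)"
    using cls_comp_q_self[OF assms] that assms s by simp
  show "cls s f = \<zero>\<^sub>Q (tgt T s) (tgt T f)" if "q f = \<zero>\<^sub>Q (src T f) (tgt T f)"
    by (rule Q.iso_cancel_right[OF q_iso[OF assms(1)]])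
      (use cls_comp_q_self[OF assms] that assms s in simp_all)
qed

text \<open>The identity of an object of S factors through S, so the object becomes zero in the
  quotient.\<close>

lemma zero_if_through_S:
  assumes "x \<in> Arr Q" "src Q x \<in> S \<or> tgt Q x \<in> S"
  shows "x = \<zero>\<^sub>Q (src Q x) (tgt Q x)"
proof -
  have "ident Q X = \<zero>\<^sub>Q X X" if "X \<in> S" for X
  proof -
    have "factors_through T (ident T X) S"
      unfolding factors_through_def using that
      by (intro bexI[of _ X] bexI[of _ "ident T X"]) (simp_all add: Hom_iff)
    then show ?thesis using q_eq_zero_iff[of "ident T X"] that by simp
  qed
  then show ?thesis using assms Q.ident_zero_imp_zero[of x] by blast
qed

section \<open>Weak cokernels in the quotient\<close>

lemma quot_left_fraction:
  assumes "x \<in> Arr Q"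
  obtains t g where "t \<in> cone_in T S" "t \<in> Arr T" "g \<in> Arr T" "src T t = tgt Q x" "src T g = src Q x" "tgt T g = tgt T t"
    "q t \<cdot>\<^sub>Q x = q g"
proof -
  obtain s f where s: "s \<in> cone_in T S" "f \<in> Arr T" "src T f = src T s" "tgt T s = src Q x" "tgt T f = tgt Q x"
    "s \<in> Arr T" "x = cls s f" "x \<cdot>\<^sub>Q q s = q f" using assms by (rule quot_right_fraction)
  obtain t g where t: "t \<in> Arr T" "g \<in> Arr T" "tgt T g = tgt T t" "src T t = tgt T f" "src T g = tgt T s"
    "g \<cdot> s = t \<cdot> f" "t \<in> cone_in T S"
    by (rule ore_left[of s f]) (use s(1-6) thick in auto)
  have "q t \<cdot>\<^sub>Q x = q g"
  proof (rule Q.iso_cancel_right[OF q_iso[OF s(1)]])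
    have "(q t \<cdot>\<^sub>Q x) \<cdot>\<^sub>Q q s = q t \<cdot>\<^sub>Q q f"
      using assms s(1-6) t(1-5) by (simp add: s(8))
    also have "\<dots> = q (g \<cdot> s)" unfolding t(6) using s(1-6) t(1-5) by simp
    finally show "(q t \<cdot>\<^sub>Q x) \<cdot>\<^sub>Q q s = q g \<cdot>\<^sub>Q q s" using s(1-6) t(1-5) by simp
  qed (use assms s(1-6) t(1-5) in simp_all)
  then show thesis using s t by (intro that[of t g]) simp_all
qed

text \<open>Clearing the denominator t at the target of y leaves the triangle untouched. As the
  image of k f vanishes, some t' with cone in S kills k f already in T; then t' k extends over the
  cone of f, and the extension is divided by t' t.\<close>

lemma quot_weak_cokernel:
  assumes "(f, g, h) \<in> exact_tri T" "y \<in> Arr Q" "src Q y = tgt T f" "y \<cdot>\<^sub>Q q f = \<zero>\<^sub>Q (src T f) (tgt Q y)"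
  obtains y' where "y' \<in> Arr Q" "src Q y' = tgt T g" "tgt Q y' = tgt Q y" "y' \<cdot>\<^sub>Q q g = y"
proof -
  note [simp] = exactD[OF assms(1)] assms(2,3)
  obtain t k where t: "t \<in> cone_in T S" "t \<in> Arr T" "k \<in> Arr T" "src T t = tgt Q y" "src T k = src Q y" "tgt T k = tgt T t"
    "q t \<cdot>\<^sub>Q y = q k" using assms(2) by (rule quot_left_fraction)
  have "q (k \<cdot> f) = q t \<cdot>\<^sub>Q (y \<cdot>\<^sub>Q q f)"
    using t(1-6) by (simp add: Q.comp_reduce[OF t(7)])
  then have "q (k \<cdot> f) = \<zero>\<^sub>Q (src T (k \<cdot> f)) (tgt T (k \<cdot> f))"
    unfolding assms(4) using t(1-6) by simp
  then have "factors_through T (k \<cdot> f) S"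
    using q_eq_zero_iff[of "k \<cdot> f"] t(1-6) by (simp del: q_comp)
  then obtain t' where t': "t' \<in> cone_in T S" "src T t' = tgt T (k \<cdot> f)"
    "t' \<cdot> (k \<cdot> f) = \<zero> (src T (k \<cdot> f)) (tgt T t')"
    by (rule factors_through_annihilated_left)
  have t'': "t' \<in> Arr T" "src T t' = tgt T t" using t' t(1-6) cone_in_ArrD by auto
  obtain k' where k': "k' \<in> Arr T" "src T k' = tgt T g" "tgt T k' = tgt T (t' \<cdot> k)" "k' \<cdot> g = t' \<cdot> k"
    by (rule weak_cokernel[OF assms(1), of "t' \<cdot> k"]) (use t'(3) t'' t(1-6) in simp_all)
  have c: "t' \<cdot> t \<in> cone_in T S" using t t' t'' by (simp add: cone_in_comp)
  obtain r where r: "r \<in> Arr Q" "src Q r = tgt Q (q (t' \<cdot> t))" "tgt Q r = src Q (q (t' \<cdot> t))"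
    "r \<cdot>\<^sub>Q q (t' \<cdot> t) = ident Q (src Q (q (t' \<cdot> t)))"
    using q_iso[OF c] by (rule Q.is_isoE)
  have r': "src Q r = tgt T t'" "tgt Q r = tgt Q y" "r \<cdot>\<^sub>Q q t' \<cdot>\<^sub>Q q t = ident Q (tgt Q y)"
    using r t(1-6) t'' by simp_all
  show thesis
  proof (rule that[of "r \<cdot>\<^sub>Q q k'"])
    have "q k' \<cdot>\<^sub>Q q g = q (k' \<cdot> g)" using k'(1-3) by simp
    also have "\<dots> = q t' \<cdot>\<^sub>Q (q t \<cdot>\<^sub>Q y)" unfolding k'(4) t(7) using t(1-6) t'' by simp
    finally have "(r \<cdot>\<^sub>Q q k') \<cdot>\<^sub>Q q g = (r \<cdot>\<^sub>Q q t' \<cdot>\<^sub>Q q t) \<cdot>\<^sub>Q y"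
      using r(1) r'(1,2) k'(1-3) t(1-6) t'' by simp
    then show "(r \<cdot>\<^sub>Q q k') \<cdot>\<^sub>Q q g = y" unfolding r'(3) by simp
  qed (use r(1) r'(1,2) k'(1-3) t(1-6) t'' in simp_all)
qed

lemma quot_weak_cokernel2:
  assumes "(f, g, h) \<in> exact_tri T" "y \<in> Arr Q" "src Q y = tgt T g" "y \<cdot>\<^sub>Q q g = \<zero>\<^sub>Q (src T g) (tgt Q y)"
  obtains y' where "y' \<in> Arr Q" "src Q y' = tgt T h" "tgt Q y' = tgt Q y" "y' \<cdot>\<^sub>Q q h = y"
  by (rule quot_weak_cokernel[OF rotate[OF assms(1)] assms(2-4)]) (rule that)

text \<open>Rotation gives this up to a sign, which is moved into the extension.\<close>

lemma quot_weak_cokernel3: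
  assumes "(f, g, h) \<in> exact_tri T" "y \<in> Arr Q" "src Q y = tgt T h" "y \<cdot>\<^sub>Q q h = \<zero>\<^sub>Q (src T h) (tgt Q y)"
  obtains y' where "y' \<in> Arr Q" "src Q y' = susp T (tgt T f)" "tgt Q y' = tgt Q y" "y' \<cdot>\<^sub>Q q (susp_arr T f) = y"
proof -
  note [simp] = exactD[OF assms(1)]
  obtain y' where y': "y' \<in> Arr Q" "src Q y' = susp T (tgt T f)" "tgt Q y' = tgt Q y"
    "y' \<cdot>\<^sub>Q q (neg_arr T (susp_arr T f)) = y"
    using quot_weak_cokernel2[OF rotate[OF assms(1)] assms(2-4)] by auto
  show thesis
    by (rule that[of "neg_arr Q y'"]) (use y' in \<open>simp_all add: Q.neg_comp Q.comp_neg\<close>)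
qed

section \<open>The suspension of the quotient\<close>

text \<open>Extensions along the third map of a triangle start at suspended objects; this functor,
  once known to be full and faithful, brings them back down.\<close>

definition susp_quot :: "('m \<times> 'm) set \<Rightarrow> ('m \<times> 'm) set" where
  "susp_quot x = (\<Union>(s, f) \<in> x. cls (susp_arr T s) (susp_arr T f))"

lemma susp_cls:
  assumes "s \<in> cone_in T S" "f \<in> Arr T" "src T f = src T s"
  shows "susp_quot (cls s f) = cls (susp_arr T s) (susp_arr T f)"
proof -
  have "cls (susp_arr T t) (susp_arr T g) = cls (susp_arr T s) (susp_arr T f)" if tg: "(t, g) \<in> cls s f" for t g
  proof -
    have t: "t \<in> cone_in T S" "g \<in> Arr T" "src T g = src T t" "tgt T t = tgt T s" "tgt T g = tgt T f"
      using tg by (auto simp: mem_frac_class_iff fractions_iff)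
    obtain a b where ab: "a \<in> cone_in T S" "b \<in> cone_in T S" "src T a = src T b" "tgt T a = src T s"
      "tgt T b = src T t" "s \<cdot> a = t \<cdot> b" "f \<cdot> a = g \<cdot> b"
      by (rule frac_equivE[of s f t g]) (use tg t(1) assms(1) in \<open>auto simp: mem_frac_class_iff\<close>)
    note A = ab(1,2)[THEN cone_in_ArrD] assms(1)[THEN cone_in_ArrD] t(1)[THEN cone_in_ArrD]
    have "cls (susp_arr T s) (susp_arr T f) = cls (susp_arr T (s \<cdot> a)) (susp_arr T (f \<cdot> a))"
      using cls_refine[of "susp_arr T s" "susp_arr T f" "susp_arr T a"] assms ab(1-5) A by (simp add: susp_cone_in_iff)
    also have "\<dots> = cls (susp_arr T t) (susp_arr T g)"
      unfolding ab(6,7) using cls_refine[of "susp_arr T t" "susp_arr T g" "susp_arr T b"] t ab(1-5) A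
      by (simp add: susp_cone_in_iff)
    finally show ?thesis ..
  qed
  then have *: "(case p of (t, g) \<Rightarrow> cls (susp_arr T t) (susp_arr T g)) = cls (susp_arr T s) (susp_arr T f)"
    if "p \<in> cls s f" for p using that by (cases p) (simp only: prod.case)
  have "(s, f) \<in> cls s f" using assms by (intro mem_cls_self) (simp add: fractions_iff)
  then show ?thesis unfolding susp_quot_def using * by (rule UN_eq_const)
qed

lemma susp_quot_Arr [simp]: "x \<in> Arr Q \<Longrightarrow> susp_quot x \<in> Arr Q"
  and src_susp_quot [simp]: "x \<in> Arr Q \<Longrightarrow> src Q (susp_quot x) = susp T (src Q x)"
  and tgt_susp_quot [simp]: "x \<in> Arr Q \<Longrightarrow> tgt Q (susp_quot x) = susp T (tgt Q x)"
  by (auto elim!: Arr_quotE simp: susp_cls susp_cone_in_iff)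

lemma susp_q: "f \<in> Arr T \<Longrightarrow> susp_quot (q f) = q (susp_arr T f)"
  unfolding quot_functor_def by (simp add: susp_cls)

lemma susp_quot_plus:
  assumes "x \<in> Arr Q" "y \<in> Arr Q" "src Q x = src Q y" "tgt Q x = tgt Q y"
  shows "susp_quot (x \<boxplus>\<^sub>Q y) = susp_quot x \<boxplus>\<^sub>Q susp_quot y"
proof -
  obtain s f g where s: "s \<in> cone_in T S" "f \<in> Arr T" "src T f = src T s" "g \<in> Arr T" "src T g = src T s"
    "x = cls s f" "y = cls s g" "tgt T s = src Q x" "tgt T f = tgt Q x" "tgt T g = tgt Q y" "s \<in> Arr T"
    by (rule common_denominator[OF assms(1-3)])
  have "tgt T f = tgt T g" using s assms by simp
  then show ?thesis unfolding s(6,7) using s(1-5,11) by (simp add: plus_cls susp_cls susp_cone_in_iff)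
qed

lemma susp_quot_comp:
  assumes "x \<in> Arr Q" "y \<in> Arr Q" "tgt Q x = src Q y"
  shows "susp_quot (y \<cdot>\<^sub>Q x) = susp_quot y \<cdot>\<^sub>Q susp_quot x"
proof -
  obtain s f where s: "s \<in> cone_in T S" "f \<in> Arr T" "src T f = src T s" "x = cls s f"
    "src Q x = tgt T s" "tgt Q x = tgt T f" "s \<in> Arr T" using assms(1) by (rule Arr_quotE)
  obtain t g where t: "t \<in> cone_in T S" "g \<in> Arr T" "src T g = src T t" "y = cls t g"
    "src Q y = tgt T t" "tgt Q y = tgt T g" "t \<in> Arr T" using assms(2) by (rule Arr_quotE)
  have st: "tgt T f = tgt T t" using s(6) t(5) assms by simp
  obtain t' f' where u: "t' \<in> cone_in T S" "f' \<in> Arr T" "src T f' = src T t'" "tgt T t' = src T s" "tgt T f' = src T t"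
    "f \<cdot> t' = t \<cdot> f'" "cls t g \<cdot>\<^sub>Q cls s f = cls (s \<cdot> t') (g \<cdot> f')" "t' \<in> Arr T"
    by (rule comp_cls_ex[OF s(1-3) t(1-3)]) (use st in simp_all)
  have "susp_arr T (f \<cdot> t') = susp_arr T (t \<cdot> f')" by (simp only: u(6))
  then have "cls (susp_arr T t) (susp_arr T g) \<cdot>\<^sub>Q cls (susp_arr T s) (susp_arr T f) =
      cls (susp_arr T s \<cdot> susp_arr T t') (susp_arr T g \<cdot> susp_arr T f')"
    using s(1-3,7) t(1-3,7) st u(1-5,8) by (intro comp_cls) (simp_all add: susp_cone_in_iff)
  then show ?thesis
    unfolding s(4) t(4) u(7) using s(1-3,7) t(1-3,7) st u(1-5,8) by (simp add: susp_cls cone_in_comp)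
qed

lemma susp_quot_zero [simp]: "\<lbrakk>X \<in> Ob T; Y \<in> Ob T\<rbrakk> \<Longrightarrow> susp_quot (\<zero>\<^sub>Q X Y) = \<zero>\<^sub>Q (susp T X) (susp T Y)"
  using susp_q[of "\<zero> X Y"] by simp

lemma susp_quot_neg: "x \<in> Arr Q \<Longrightarrow> susp_quot (neg_arr Q x) = neg_arr Q (susp_quot x)"
  by (rule Q.neg_eqI[symmetric]) (simp_all flip: susp_quot_plus)

text \<open>The intermediate object is isomorphic to a suspension \<open>susp T N'\<close> with N'
  again in S; fullness desuspends both factors, and faithfulness their composite.\<close>

lemma factors_through_desusp:
  assumes "factors_through T (susp_arr T f) S" "f \<in> Arr T"
  shows "factors_through T f S"
proof -
  obtain N g h where N: "N \<in> S" "g \<in> Arr T" "h \<in> Arr T" "src T g = susp T (src T f)" "tgt T g = N"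
    "src T h = N" "tgt T h = susp T (tgt T f)" "susp_arr T f = h \<cdot> g"
    using assms by (auto simp: factors_through_def Hom_iff)
  obtain N' e where e: "N' \<in> Ob T" "e \<in> Arr T" "src T e = susp T N'" "tgt T e = N" "is_iso T e"
    using susp_desusp_ex[of N] N by auto
  obtain e' where e': "e' \<in> Arr T" "src T e' = tgt T e" "tgt T e' = src T e" "e \<cdot> e' = ident T (tgt T e)"
    using e(5) by (rule is_isoE)
  obtain g' where g': "g' \<in> Arr T" "src T g' = src T f" "tgt T g' = N'" "e' \<cdot> g = susp_arr T g'"
    by (rule susp_full[of "e' \<cdot> g" "src T f" N']) (use N e e' assms(2) in simp_all)
  obtain h' where h': "h' \<in> Arr T" "src T h' = N'" "tgt T h' = tgt T f" "h \<cdot> e = susp_arr T h'"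
    by (rule susp_full[of "h \<cdot> e" N' "tgt T f"]) (use N e e' assms(2) in simp_all)
  have "(h \<cdot> e) \<cdot> (e' \<cdot> g) = h \<cdot> ((e \<cdot> e') \<cdot> g)"
    using N(1-7) e(1-4) e'(1-3) by simp
  then have "susp_arr T (h' \<cdot> g') = susp_arr T f"
    using N(1-7) N(8)[symmetric] e(1-4) e' g' h' by simp
  then have "h' \<cdot> g' = f" by (rule susp_faithful) (use g' h' assms(2) in simp_all)
  moreover have "N' \<in> S"
    using cone_in_src[OF cone_in_iso[OF e(5)]] e N(1) by (simp add: S_susp_iff)
  ultimately show ?thesis
    unfolding factors_through_def using g' h'
    by (intro bexI[of _ N'] bexI[of _ g'] bexI[of _ h']) (simp_all add: Hom_iff)
qed

text \<open>Applied to the difference of x and y: a fraction is zero exactly when its numerator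
  factors through S, and such a factorisation desuspends.\<close>

lemma susp_quot_faithful:
  assumes "susp_quot x = susp_quot y" "x \<in> Arr Q" "y \<in> Arr Q" "src Q x = src Q y" "tgt Q x = tgt Q y"
  shows "x = y"
proof -
  let ?d = "x \<boxplus>\<^sub>Q neg_arr Q y"
  have d: "?d \<in> Arr Q" using assms by simp
  obtain s f where s: "s \<in> cone_in T S" "f \<in> Arr T" "src T f = src T s" "?d = cls s f"
    "src Q ?d = tgt T s" "tgt Q ?d = tgt T f" "s \<in> Arr T" using d by (rule Arr_quotE)
  have sf: "tgt T s = src Q x" "tgt T f = tgt Q x" using s(5,6) assms by simp_all
  have "susp_quot ?d = \<zero>\<^sub>Q (src Q (susp_quot ?d)) (tgt Q (susp_quot ?d))"
    using assms by (simp add: susp_quot_plus susp_quot_neg)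
  then have "cls (susp_arr T s) (susp_arr T f) = \<zero>\<^sub>Q (tgt T (susp_arr T s)) (tgt T (susp_arr T f))"
    unfolding s(4) using s(1-3,7) by (simp add: susp_cls susp_cone_in_iff)
  then have "factors_through T (susp_arr T f) S"
    using cls_eq_zero_iff[of "susp_arr T s" "susp_arr T f"] q_eq_zero_iff[of "susp_arr T f"] s(1-3,7)
    by (simp add: susp_cone_in_iff)
  then have "factors_through T f S" using s(2) by (rule factors_through_desusp)
  then have "?d = \<zero>\<^sub>Q (src Q x) (tgt Q x)"
    using cls_eq_zero_iff[OF s(1-3)] q_eq_zero_iff[OF s(2)] unfolding s(4) sf by simp
  then show ?thesis using Q.diff_eq_zero_iff[of x y] assms by simp
qed

text \<open>The middle object of a fraction is only isomorphic to a suspension; expanding by the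
  isomorphism makes both legs maps between suspensions.\<close>

lemma susp_quot_full:
  assumes "y \<in> Arr Q" "src Q y = susp T X" "tgt Q y = susp T Y" "X \<in> Ob T" "Y \<in> Ob T"
  obtains x where "x \<in> Arr Q" "src Q x = X" "tgt Q x = Y" "y = susp_quot x"
proof -
  obtain s f where s: "s \<in> cone_in T S" "f \<in> Arr T" "src T f = src T s" "y = cls s f"
    "src Q y = tgt T s" "tgt Q y = tgt T f" "s \<in> Arr T" using assms(1) by (rule Arr_quotE)
  obtain W e where e: "W \<in> Ob T" "e \<in> Arr T" "src T e = susp T W" "tgt T e = src T s" "is_iso T e"
    using susp_desusp_ex[of "src T s"] s by auto
  have y: "y = cls (s \<cdot> e) (f \<cdot> e)"
    unfolding s(4) by (rule cls_refine[symmetric]) (use s(1-3) e cone_in_iso in simp_all)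
  have se: "s \<cdot> e \<in> cone_in T S" by (rule cone_in_comp) (use s e cone_in_iso in simp_all)
  obtain t where t: "t \<in> Arr T" "src T t = W" "tgt T t = X" "s \<cdot> e = susp_arr T t"
    by (rule susp_full[of "s \<cdot> e" W X]) (use s(1-3,7) s(5)[symmetric] e assms in simp_all)
  obtain g where g: "g \<in> Arr T" "src T g = W" "tgt T g = Y" "f \<cdot> e = susp_arr T g"
    by (rule susp_full[of "f \<cdot> e" W Y]) (use s(1-3,7) s(6)[symmetric] e assms in simp_all)
  have c: "t \<in> cone_in T S" using se t by (simp add: susp_cone_in_iff)
  show thesis
    by (rule that[of "cls t g"]) (use c t g y in \<open>simp_all add: susp_cls\<close>)
qed

end

section \<open>Functors between Verdier quotients\<close>

locale thick_inclusion = A: thick_subcategory T A + B: thick_subcategory T B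
  for T :: "('o, 'm, 'z) tri_struct_scheme" (structure) and A B +
  assumes sub: "A \<subseteq> B"
begin

abbreviation I where "I \<equiv> induced T B"

lemma cone_in_mono: "s \<in> cone_in T A \<Longrightarrow> s \<in> cone_in T B"
  using sub by (auto simp: cone_in_def)

lemma induced_cls:
  assumes "s \<in> cone_in T A" "f \<in> Arr T" "src T f = src T s"
  shows "I (A.cls s f) = B.cls s f"
proof -
  have "B.cls t g = B.cls s f" if tg: "(t, g) \<in> A.cls s f" for t g
  proof -
    have t: "t \<in> cone_in T A" "g \<in> Arr T" "src T g = src T t" "tgt T t = tgt T s" "tgt T g = tgt T f"
      using tg by (auto simp: A.mem_frac_class_iff fractions_iff)
    obtain a b where ab: "a \<in> cone_in T A" "b \<in> cone_in T A" "src T a = src T b" "tgt T a = src T s"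
      "tgt T b = src T t" "s \<cdot> a = t \<cdot> b" "f \<cdot> a = g \<cdot> b"
      by (rule A.frac_equivE[of s f t g]) (use tg t(1) assms(1) in \<open>auto simp: A.mem_frac_class_iff\<close>)
    have "B.cls s f = B.cls (s \<cdot> a) (f \<cdot> a)"
      by (rule B.cls_refine[symmetric]) (use assms ab cone_in_mono in simp_all)
    also have "\<dots> = B.cls t g" unfolding ab(6,7)
      by (rule B.cls_refine) (use t ab cone_in_mono in simp_all)
    finally show ?thesis ..
  qed
  then have *: "frac_class T B p = B.cls s f" if "p \<in> A.cls s f" for p
    using that by (cases p) (simp only:)
  have "(s, f) \<in> A.cls s f" using assms by (intro A.mem_cls_self) (simp add: fractions_iff)
  then show ?thesis unfolding induced_def using * by (rule UN_eq_const)
qed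

lemma induced_Arr [simp]: "x \<in> Arr A.Q \<Longrightarrow> I x \<in> Arr B.Q"
  and src_induced [simp]: "x \<in> Arr A.Q \<Longrightarrow> src B.Q (I x) = src A.Q x"
  and tgt_induced [simp]: "x \<in> Arr A.Q \<Longrightarrow> tgt B.Q (I x) = tgt A.Q x"
  by (auto elim!: A.Arr_quotE simp: induced_cls cone_in_mono)

lemma induced_q [simp]: "f \<in> Arr T \<Longrightarrow> I (A.q f) = B.q f"
  unfolding quot_functor_def by (simp add: induced_cls)

lemma induced_ident [simp]: "X \<in> Ob T \<Longrightarrow> I (ident A.Q X) = ident B.Q X"
  using induced_q[of "ident T X"] by simp

lemma induced_zero [simp]: "\<lbrakk>X \<in> Ob T; Y \<in> Ob T\<rbrakk> \<Longrightarrow> I (\<zero>\<^bsub>A.Q\<^esub> X Y) = \<zero>\<^bsub>B.Q\<^esub> X Y"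
  using induced_q[of "\<zero> X Y"] by simp

lemma induced_plus [simp]:
  assumes "x \<in> Arr A.Q" "y \<in> Arr A.Q" "src A.Q x = src A.Q y" "tgt A.Q x = tgt A.Q y"
  shows "I (x \<boxplus>\<^bsub>A.Q\<^esub> y) = I x \<boxplus>\<^bsub>B.Q\<^esub> I y"
proof -
  obtain s f g where s: "s \<in> cone_in T A" "f \<in> Arr T" "src T f = src T s" "g \<in> Arr T" "src T g = src T s"
    "x = A.cls s f" "y = A.cls s g" "tgt T s = src A.Q x" "tgt T f = tgt A.Q x" "tgt T g = tgt A.Q y" "s \<in> Arr T"
    by (rule A.common_denominator[OF assms(1-3)])
  have "tgt T f = tgt T g" using s assms by simp
  then show ?thesis unfolding s(6,7) using s(1-5,11)
    by (simp add: A.plus_cls B.plus_cls induced_cls cone_in_mono)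
qed

lemma induced_neg [simp]: "x \<in> Arr A.Q \<Longrightarrow> I (neg_arr A.Q x) = neg_arr B.Q (I x)"
  by (rule B.Q.neg_eqI[symmetric]) (simp_all flip: induced_plus)

lemma induced_comp [simp]:
  assumes "x \<in> Arr A.Q" "y \<in> Arr A.Q" "tgt A.Q x = src A.Q y"
  shows "I (y \<cdot>\<^bsub>A.Q\<^esub> x) = I y \<cdot>\<^bsub>B.Q\<^esub> I x"
proof -
  obtain s f where s: "s \<in> cone_in T A" "f \<in> Arr T" "src T f = src T s" "x = A.cls s f"
    "src A.Q x = tgt T s" "tgt A.Q x = tgt T f" "s \<in> Arr T" using assms(1) by (rule A.Arr_quotE)
  obtain t g where t: "t \<in> cone_in T A" "g \<in> Arr T" "src T g = src T t" "y = A.cls t g"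
    "src A.Q y = tgt T t" "tgt A.Q y = tgt T g" "t \<in> Arr T" using assms(2) by (rule A.Arr_quotE)
  have st: "tgt T f = tgt T t" using s(6) t(5) assms by simp
  obtain t' f' where u: "t' \<in> cone_in T A" "f' \<in> Arr T" "src T f' = src T t'" "tgt T t' = src T s" "tgt T f' = src T t"
    "f \<cdot> t' = t \<cdot> f'" "A.cls t g \<cdot>\<^bsub>A.Q\<^esub> A.cls s f = A.cls (s \<cdot> t') (g \<cdot> f')" "t' \<in> Arr T"
    by (rule A.comp_cls_ex[OF s(1-3) t(1-3)]) (use st in simp_all)
  have "B.cls t g \<cdot>\<^bsub>B.Q\<^esub> B.cls s f = B.cls (s \<cdot> t') (g \<cdot> f')"
    using s(1-3,7) t(1-3,7) st u(1-6,8) by (intro B.comp_cls) (simp_all add: cone_in_mono)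
  then show ?thesis
    unfolding s(4) t(4) u(7) using s(1-3,7) t(1-3,7) st u(1-5,8) by (simp add: induced_cls A.cone_in_comp)
qed

end

section \<open>Commuting pairs\<close>

context triangulated_category
begin

text \<open>Makes the family whose intersection is \<open>thick_join\<close> nonempty.\<close>

lemma thick_Ob: "thick T (Ob T)"
  unfolding thick_def triangulated_subcategory_def
proof (intro conjI allI impI ballI)
  fix X assume "X \<in> Ob T" then show "(X \<in> Ob T) = (susp T X \<in> Ob T)" by simp
next
  fix t assume t: "t \<in> exact_tri T"
  obtain f g h where [simp]: "t = (f, g, h)" by (cases t) auto
  show "case t of (f, g, h) \<Rightarrow> (src T f \<in> Ob T \<and> src T g \<in> Ob T \<longrightarrow> src T h \<in> Ob T) \<and>
      (src T g \<in> Ob T \<and> src T h \<in> Ob T \<longrightarrow> src T f \<in> Ob T) \<and>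
      (src T f \<in> Ob T \<and> src T h \<in> Ob T \<longrightarrow> src T g \<in> Ob T)"
    using exactD(1-3)[of f g h] t by simp
qed (auto simp: is_biproduct_def)

lemma thick_Inter:
  assumes "F \<noteq> {}" "\<And>S. S \<in> F \<Longrightarrow> thick T S"
  shows "thick T (\<Inter>F)"
proof -
  have S: "thick_subcategory T S" if "S \<in> F" for S using assms(2)[OF that] by (rule thick_subcategoryI)
  show ?thesis
    unfolding thick_def triangulated_subcategory_def
  proof (intro conjI allI impI ballI)
    show "\<Inter>F \<subseteq> Ob T" using assms(1) thick_subcategory.S_Ob[OF S] by blast
    show "Z \<in> \<Inter>F" if "is_zero_object T Z" for Z using thick_subcategory.S_zero[OF S] that by blast
    show "(X \<in> \<Inter>F) = (susp T X \<in> \<Inter>F)" if "X \<in> Ob T" for X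
      using thick_subcategory.S_susp_iff[OF S] that by blast
  next
    fix t assume t: "t \<in> exact_tri T"
    obtain f g h where e: "t = (f, g, h)" by (cases t) auto
    then have t: "(f, g, h) \<in> exact_tri T" using t by simp
    have "(src T f \<in> S \<and> src T g \<in> S \<longrightarrow> src T h \<in> S) \<and> (src T g \<in> S \<and> src T h \<in> S \<longrightarrow> src T f \<in> S) \<and>
        (src T f \<in> S \<and> src T h \<in> S \<longrightarrow> src T g \<in> S)" if "S \<in> F" for S
      using thick_subcategory.S_first[OF S[OF that] t] thick_subcategory.S_second[OF S[OF that] t]
        thick_subcategory.S_third[OF S[OF that] t] exactD(4,5)[OF t] by simp
    then show "case t of (f, g, h) \<Rightarrow> (src T f \<in> \<Inter>F \<and> src T g \<in> \<Inter>F \<longrightarrow> src T h \<in> \<Inter>F) \<and>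
        (src T g \<in> \<Inter>F \<and> src T h \<in> \<Inter>F \<longrightarrow> src T f \<in> \<Inter>F) \<and>
        (src T f \<in> \<Inter>F \<and> src T h \<in> \<Inter>F \<longrightarrow> src T g \<in> \<Inter>F)"
      unfolding e prod.case by blast
  next
    fix X Y B i j p q assume "is_biproduct T X Y B i j p q \<and> B \<in> \<Inter>F"
    then show "X \<in> \<Inter>F" using assms(2) unfolding thick_def by blast
  qed
qed

lemma thick_Int: "\<lbrakk>thick T U; thick T V\<rbrakk> \<Longrightarrow> thick T (U \<inter> V)"
  using thick_Inter[of "{U, V}"] by auto

lemma thick_thick_join: "\<lbrakk>thick T U; thick T V\<rbrakk> \<Longrightarrow> thick T (thick_join T U V)"
  unfolding thick_join_def
proof (rule thick_Inter)
  assume "thick T U" "thick T V"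
  then have "U \<subseteq> Ob T" "V \<subseteq> Ob T" by (simp_all add: thick_def triangulated_subcategory_def)
  then show "{S. thick T S \<and> U \<subseteq> S \<and> V \<subseteq> S} \<noteq> {}" using thick_Ob by blast
qed simp

text \<open>A morphism might have one cone in U and a different one in V; independence of the chosen
  cone puts a single one into both.\<close>

lemma cone_in_Int:
  assumes "thick T U" "thick T V"
  shows "s \<in> cone_in T (U \<inter> V) \<longleftrightarrow> s \<in> cone_in T U \<and> s \<in> cone_in T V"
proof
  assume "s \<in> cone_in T U \<and> s \<in> cone_in T V"
  moreover from this obtain g h where "(s, g, h) \<in> exact_tri T" "tgt T g \<in> U" by (auto simp: cone_in_def)
  ultimately show "s \<in> cone_in T (U \<inter> V)"
    using thick_subcategory.tgt_cone_in[OF thick_subcategoryI[OF assms(2)], of s g h] unfolding cone_in_def by blast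
qed (auto simp: cone_in_def)

text \<open>Composing l with an isomorphism onto a suspended object makes it a map between
  suspensions, which desuspends by fullness.\<close>

lemma desuspend_to:
  assumes "thick T U" "thick T V" "l \<in> cone_in T V" "src T l = susp T E" "E \<in> Ob T" "tgt T l \<in> U"
  obtains r where "r \<in> cone_in T V" "src T r = E" "tgt T r \<in> U"
proof -
  interpret U: thick_subcategory T U by (rule thick_subcategoryI) fact
  interpret V: thick_subcategory T V by (rule thick_subcategoryI) fact
  have l: "l \<in> Arr T" using assms(3) by (rule V.cone_in_ArrD)
  obtain U1 e where e: "U1 \<in> Ob T" "e \<in> Arr T" "src T e = susp T U1" "tgt T e = tgt T l" "is_iso T e"
    using susp_desusp_ex[of "tgt T l"] l by auto
  obtain e' where e': "e' \<in> Arr T" "src T e' = tgt T e" "tgt T e' = src T e" "e' \<cdot> e = ident T (src T e)"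
    "e \<cdot> e' = ident T (tgt T e)" using e(5) by (rule is_isoE)
  have "is_iso T e'" by (rule is_isoI[where e' = e]) (use e e' in auto)
  then have c: "e' \<cdot> l \<in> cone_in T V"
    using assms(3) e e' by (intro V.cone_in_comp) (auto intro: V.cone_in_iso)
  obtain r where r: "r \<in> Arr T" "src T r = E" "tgt T r = U1" "e' \<cdot> l = susp_arr T r"
    by (rule susp_full[of "e' \<cdot> l" E U1]) (use l e e' assms(4,5) in auto)
  have "susp T U1 \<in> U" using U.cone_in_src[OF U.cone_in_iso[OF e(5)]] e assms(6) by simp
  then show thesis
    using that[of r] c r e(1) by (simp add: V.susp_cone_in_iff U.S_susp_iff)
qed

text \<open>
  The cone of \<open>t \<cdot> s\<close> is an extension whose connecting map factors through \<open>U \<inter> V\<close>;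
  this allows exchanging the two factors.
\<close>

lemma swap_cones:
  assumes tU: "thick T U" and tV: "thick T V"
    and factor: "\<And>f. \<lbrakk>f \<in> Arr T; src T f \<in> V; tgt T f \<in> U\<rbrakk> \<Longrightarrow> factors_through T f (U \<inter> V)"
    and st: "s \<in> cone_in T U" "t \<in> cone_in T V" "tgt T s = src T t"
  obtains s' t' where "s' \<in> cone_in T V" "t' \<in> cone_in T U" "tgt T s' = src T t'" "src T s' = src T s"
    "tgt T t' = tgt T t" "t \<cdot> s = t' \<cdot> s'"
proof -
  interpret U: thick_subcategory T U by (rule thick_subcategoryI) fact
  interpret V: thick_subcategory T V by (rule thick_subcategoryI) fact
  have A: "s \<in> Arr T" "t \<in> Arr T" using st U.cone_in_ArrD V.cone_in_ArrD by auto
  obtain s2 s3 where s: "(s, s2, s3) \<in> exact_tri T" using A cone_ex by blast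
  obtain t2 t3 where t: "(t, t2, t3) \<in> exact_tri T" using A cone_ex by blast
  obtain g h where ts: "(t \<cdot> s, g, h) \<in> exact_tri T" using A st(3) cone_ex by (metis comp_Arr)
  from TR4[OF s t ts st(3) refl]
  obtain k1 k2 k3 where k: "(k1, k2, k3) \<in> exact_tri T" "k1 \<in> Hom T (tgt T s2) (tgt T g)"
    "k2 \<in> Hom T (tgt T g) (tgt T t2)" by auto
  have k3: "k3 \<in> Arr T" "src T k3 = tgt T t2" "tgt T k3 = susp T (tgt T s2)"
    using exactD[OF k(1)] k by (auto simp: Hom_iff)
  have s2: "tgt T s2 \<in> U" using s st(1) by (simp add: U.cone_in_iff)
  have t2: "tgt T t2 \<in> V" using t st(2) by (simp add: V.cone_in_iff)
  \<comment> \<open>k3 runs from the cone of t, in V, to the suspended cone of s, in U; this is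
    where commutation enters.\<close>
  have "factors_through T k3 (U \<inter> V)"
    by (rule factor) (use k3 s2 t2 in \<open>simp_all add: U.S_susp_iff\<close>)
  then obtain W m n where W: "W \<in> U" "W \<in> V" and m: "m \<in> Arr T" "src T m = src T k3" "tgt T m = W"
    and n: "n \<in> Arr T" "src T n = W" "tgt T n = tgt T k3" and nm: "k3 = n \<cdot> m"
    by (auto simp: factors_through_def Hom_iff)
  obtain m2 m3 where mt: "(m, m2, m3) \<in> exact_tri T" using m cone_ex by blast
  obtain n2 n3 where nt: "(n, n2, n3) \<in> exact_tri T" using n cone_ex by blast
  have mn: "tgt T m = src T n" using m n by simp
  \<comment> \<open>A second octahedron, on k3 = n m, gives a map from the suspended cone of
    \<open>t \<cdot> s\<close> to an object of U, and the fibre of this map lies in V.\<close>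
  from TR4[OF mt nt rotate[OF rotate[OF k(1)]] mn nm]
  obtain l1 l2 l3 where l: "(l1, l2, l3) \<in> exact_tri T" "l1 \<in> Hom T (tgt T m2) (tgt T (neg_arr T (susp_arr T k1)))"
    "l2 \<in> Hom T (tgt T (neg_arr T (susp_arr T k1))) (tgt T n2)" by auto
  have k1: "k1 \<in> Arr T" "tgt T k1 = tgt T g" using k by (auto simp: Hom_iff)
  have l2: "l2 \<in> Arr T" "src T l2 = susp T (tgt T g)" "tgt T l2 = tgt T n2" "src T l1 = tgt T m2"
    using l k1 by (auto simp: Hom_iff)
  have "tgt T m2 \<in> V" using V.S_third[OF mt] m W t2 k3 by simp
  then have "l2 \<in> cone_in T V" using V.cone_in_iff_fibre[OF l(1)] l2 by simp
  moreover have "tgt T n2 \<in> U" using U.S_third[OF nt] n W s2 k3 by (simp add: U.S_susp_iff)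
  moreover have E: "tgt T g \<in> Ob T" using exactD[OF ts] by simp
  ultimately obtain r where r: "r \<in> cone_in T V" "src T r = tgt T g" "tgt T r \<in> U"
    using desuspend_to[OF tU tV _ l2(2) E] l2(3) by auto
  have rA: "r \<in> Arr T" using r V.cone_in_ArrD by blast
  \<comment> \<open>r leads from the cone of \<open>t \<cdot> s\<close> to an object of U and has
    its cone in V. The fibre of \<open>r \<cdot> g\<close> is the new outer factor.\<close>
  obtain t' s' h' where f: "s' \<in> Arr T" "t' \<in> Arr T" "src T s' = src T (t \<cdot> s)" "tgt T s' = src T t'" "tgt T t' = tgt T (t \<cdot> s)"
    "t \<cdot> s = t' \<cdot> s'" "(t', r \<cdot> g, h') \<in> exact_tri T" "s' \<in> cone_in T V"
    by (rule fibre_factorisation[OF ts rA r(2)]) (use r(1) tV in blast)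
  have "t' \<in> cone_in T U" using U.cone_in_iff[OF f(7)] r exactD[OF ts] rA by simp
  moreover have "src T s' = src T s" "tgt T t' = tgt T t" using f(3,5) A st(3) by simp_all
  ultimately show thesis using f(4,6,8) by (intro that[of s' t'])
qed

end

locale thick_pair = triangulated_category T
  for T :: "('o, 'm, 'z) tri_struct_scheme" (structure) +
  fixes U V :: "'o set"
  assumes thick_U: "thick T U" and thick_V: "thick T V"
begin

abbreviation J where "J \<equiv> thick_join T U V"

lemma U_sub_J: "U \<subseteq> J" and V_sub_J: "V \<subseteq> J"
  by (auto simp: thick_join_def)

sublocale SU: thick_subcategory T U using thick_U by unfold_locales
sublocale SV: thick_subcategory T V using thick_V by unfold_locales
sublocale SM: thick_subcategory T "U \<inter> V" by unfold_locales (rule thick_Int[OF thick_U thick_V])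
sublocale SJ: thick_subcategory T "thick_join T U V" by unfold_locales (rule thick_thick_join[OF thick_U thick_V])
sublocale MU: thick_inclusion T "U \<inter> V" U by unfold_locales auto
sublocale MV: thick_inclusion T "U \<inter> V" V by unfold_locales auto
sublocale UJ: thick_inclusion T U "thick_join T U V" by unfold_locales (rule U_sub_J)
sublocale VJ: thick_inclusion T V "thick_join T U V" by unfold_locales (rule V_sub_J)
sublocale MJ: thick_inclusion T "U \<inter> V" "thick_join T U V" by unfold_locales (use U_sub_J in auto)

abbreviation comp_M (infixr "\<cdot>\<^sub>M" 75) where "x \<cdot>\<^sub>M y \<equiv> comp SM.Q x y"
abbreviation plus_M (infixl "\<boxplus>\<^sub>M" 65) where "x \<boxplus>\<^sub>M y \<equiv> plus_arr SM.Q x y"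
abbreviation zero_M ("\<zero>\<^sub>M") where "\<zero>\<^sub>M \<equiv> zero_arr SM.Q"
abbreviation comp_J (infixr "\<cdot>\<^sub>J" 75) where "x \<cdot>\<^sub>J y \<equiv> comp SJ.Q x y"
abbreviation plus_J (infixl "\<boxplus>\<^sub>J" 65) where "x \<boxplus>\<^sub>J y \<equiv> plus_arr SJ.Q x y"
abbreviation zero_J ("\<zero>\<^sub>J") where "\<zero>\<^sub>J \<equiv> zero_arr SJ.Q"
abbreviation zero_U ("\<zero>\<^sub>U") where "\<zero>\<^sub>U \<equiv> zero_arr SU.Q"
abbreviation zero_V ("\<zero>\<^sub>V") where "\<zero>\<^sub>V \<equiv> zero_arr SV.Q"

lemmas cone_in_M_iff = cone_in_Int[OF thick_U thick_V]

lemma induced_induced: "w \<in> Arr SM.Q \<Longrightarrow> UJ.I (MU.I w) = MJ.I w" "w \<in> Arr SM.Q \<Longrightarrow> VJ.I (MV.I w) = MJ.I w"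
  by (auto elim!: SM.Arr_quotE simp: MU.induced_cls MV.induced_cls MJ.induced_cls UJ.induced_cls VJ.induced_cls
      MU.cone_in_mono MV.cone_in_mono)

end

locale commuting_thick_pair = thick_pair T U V
  for T :: "('o, 'm, 'z) tri_struct_scheme" (structure) and U V +
  assumes commuting: "commuting_pair T U V"
begin

lemma factors_VU: "\<lbrakk>f \<in> Arr T; src T f \<in> V; tgt T f \<in> U\<rbrakk> \<Longrightarrow> factors_through T f (U \<inter> V)"
  and factors_UV: "\<lbrakk>f \<in> Arr T; src T f \<in> U; tgt T f \<in> V\<rbrakk> \<Longrightarrow> factors_through T f (U \<inter> V)"
proof -
  have *: "factors_through T f (U \<inter> V)" if "X \<in> U" "Y \<in> V" "f \<in> Hom T X Y \<union> Hom T Y X" for X Y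
    using commuting that unfolding commuting_pair_def by blast
  show "\<lbrakk>f \<in> Arr T; src T f \<in> V; tgt T f \<in> U\<rbrakk> \<Longrightarrow> factors_through T f (U \<inter> V)"
    using *[of "tgt T f" "src T f"] by (simp add: Hom_iff)
  show "\<lbrakk>f \<in> Arr T; src T f \<in> U; tgt T f \<in> V\<rbrakk> \<Longrightarrow> factors_through T f (U \<inter> V)"
    using *[of "src T f" "tgt T f"] by (simp add: Hom_iff)
qed

section \<open>Mixed morphisms, their cones, and the objects of the join\<close>

definition mixed :: "'m \<Rightarrow> bool" where
  "mixed p \<longleftrightarrow> (\<exists>u a. u \<in> cone_in T U \<and> a \<in> cone_in T V \<and> tgt T a = src T u \<and> p = u \<cdot> a)"

text \<open>The fibre of r is an object of V, so a single arrow r encodes a triangle V' -> E -> U'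
  and can be composed, suspended and factored.\<close>

definition UV :: "'o set" where
  "UV = {E \<in> Ob T. \<exists>r \<in> cone_in T V. src T r = E \<and> tgt T r \<in> U}"

lemma mixedI: "\<lbrakk>u \<in> cone_in T U; a \<in> cone_in T V; tgt T a = src T u\<rbrakk> \<Longrightarrow> mixed (u \<cdot> a)"
  unfolding mixed_def by blast

lemma mixedE:
  assumes "mixed p"
  obtains u a v b where "u \<in> cone_in T U" "a \<in> cone_in T V" "v \<in> cone_in T V" "b \<in> cone_in T U"
    "tgt T a = src T u" "tgt T b = src T v" "src T b = src T a" "tgt T v = tgt T u" "p = u \<cdot> a" "v \<cdot> b = u \<cdot> a"
proof -
  obtain u a where u: "u \<in> cone_in T U" "a \<in> cone_in T V" "tgt T a = src T u" "p = u \<cdot> a"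
    using assms unfolding mixed_def by blast
  have *: "factors_through T f (V \<inter> U)" if "f \<in> Arr T" "src T f \<in> U" "tgt T f \<in> V" for f
    using factors_UV[OF that] by (simp add: Int_commute)
  obtain b v where "b \<in> cone_in T U" "v \<in> cone_in T V" "tgt T b = src T v" "src T b = src T a"
    "tgt T v = tgt T u" "u \<cdot> a = v \<cdot> b"
    by (rule swap_cones[OF thick_V thick_U * u(2,1,3)])
  then show thesis using u by (intro that[of u a v b]) simp_all
qed

lemma mixed_cone_in_J: "mixed p \<Longrightarrow> p \<in> cone_in T J"
  unfolding mixed_def by (auto intro: SJ.cone_in_comp[OF VJ.cone_in_mono UJ.cone_in_mono])

text \<open>In u' a' u a the inner pair a' u is swapped, which collects the cones in V on the right
  and those in U on the left.\<close>

lemma mixed_comp: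
  assumes "mixed p" "mixed p'" "tgt T p = src T p'"
  shows "mixed (p' \<cdot> p)"
proof -
  obtain u a where u: "u \<in> cone_in T U" "a \<in> cone_in T V" "tgt T a = src T u" "p = u \<cdot> a"
    using assms(1) unfolding mixed_def by blast
  obtain u' a' where u': "u' \<in> cone_in T U" "a' \<in> cone_in T V" "tgt T a' = src T u'" "p' = u' \<cdot> a'"
    using assms(2) unfolding mixed_def by blast
  note A = u(1)[THEN SU.cone_in_ArrD] u(2)[THEN SV.cone_in_ArrD] u'(1)[THEN SU.cone_in_ArrD] u'(2)[THEN SV.cone_in_ArrD]
  have t: "tgt T u = src T a'" using assms(3) u(3,4) u'(3,4) A by simp
  obtain a2 u2 where w: "a2 \<in> cone_in T V" "u2 \<in> cone_in T U" "tgt T a2 = src T u2" "src T a2 = src T u"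
    "tgt T u2 = tgt T a'" "a' \<cdot> u = u2 \<cdot> a2"
    by (rule swap_cones[OF thick_U thick_V factors_VU u(1) u'(2) t])
  note B = w(1)[THEN SV.cone_in_ArrD] w(2)[THEN SU.cone_in_ArrD]
  have "p' \<cdot> p = u' \<cdot> ((a' \<cdot> u) \<cdot> a)" unfolding u(4) u'(4) using A u(3) u'(3) t by simp
  also have "\<dots> = (u' \<cdot> u2) \<cdot> (a2 \<cdot> a)" unfolding w(6) using A B u(3) u'(3) w(3-5) by simp
  finally show ?thesis
    using u(1-3) u'(1-3) w(1-5) A B
    by (simp del: comp_assoc_Arr) (intro mixedI SU.cone_in_comp SV.cone_in_comp; simp)
qed

text \<open>For u a the octahedron supplies a map from the cone of p to the cone of u, with the cone
  of a as fibre. Conversely, factoring p over the fibre of r q gives the two legs. Closure of mixed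
  morphisms under composition thus becomes a closure property of their cones.\<close>

lemma mixed_iff_cone:
  assumes t: "(p, q, h) \<in> exact_tri T" shows "mixed p \<longleftrightarrow> tgt T q \<in> UV"
proof
  assume "mixed p"
  then obtain u a where u: "u \<in> cone_in T U" "a \<in> cone_in T V" "tgt T a = src T u" "p = u \<cdot> a"
    unfolding mixed_def by blast
  obtain a2 a3 where a: "(a, a2, a3) \<in> exact_tri T" using u SV.cone_in_ArrD cone_ex by blast
  obtain u2 u3 where ut: "(u, u2, u3) \<in> exact_tri T" using u SU.cone_in_ArrD cone_ex by blast
  from TR4[OF a ut t u(3,4)] obtain k1 k2 k3 where k: "(k1, k2, k3) \<in> exact_tri T"
    "k1 \<in> Hom T (tgt T a2) (tgt T q)" "k2 \<in> Hom T (tgt T q) (tgt T u2)" by auto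
  have "k2 \<in> cone_in T V" using SV.cone_in_iff_fibre[OF k(1)] SV.cone_in_iff[OF a] u k(2) by (simp add: Hom_iff)
  moreover have "tgt T u2 \<in> U" using SU.cone_in_iff[OF ut] u by simp
  ultimately show "tgt T q \<in> UV" unfolding UV_def using k(3) exactD(2)[OF t]
    by (auto simp: Hom_iff intro!: bexI[of _ k2])
next
  assume "tgt T q \<in> UV"
  then obtain r where r: "r \<in> cone_in T V" "src T r = tgt T q" "tgt T r \<in> U" unfolding UV_def by blast
  have rA: "r \<in> Arr T" using r SV.cone_in_ArrD by blast
  obtain t' s' h' where f: "s' \<in> Arr T" "t' \<in> Arr T" "tgt T s' = src T t'" 
    "p = t' \<cdot> s'" "(t', r \<cdot> q, h') \<in> exact_tri T" "s' \<in> cone_in T V"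
    by (rule fibre_factorisation[OF t rA r(2)]) (use r(1) thick_V in blast)
  have "t' \<in> cone_in T U" using SU.cone_in_iff[OF f(5)] r exactD[OF t] rA by simp
  then show "mixed p" unfolding f(4) using f by (intro mixedI)
qed

lemma U_sub_UV: "E \<in> U \<Longrightarrow> E \<in> UV"
  unfolding UV_def by (auto intro!: bexI[of _ "ident T E"])

text \<open>The map E -> 0 has both ends in V, hence its cone in V, and 0 is in U.\<close>

lemma V_sub_UV: assumes "E \<in> V" shows "E \<in> UV"
proof -
  obtain O' where O': "is_zero_object T O'" "O' \<in> Ob T" by (rule zero_object_ex)
  have "\<zero> E O' \<in> cone_in T V" by (rule SV.cone_in_between) (use assms O' SV.S_zero in auto)
  then show ?thesis unfolding UV_def using assms O' SU.S_zero by (auto intro!: bexI[of _ "\<zero> E O'"])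
qed

lemma UV_Ob: "E \<in> UV \<Longrightarrow> E \<in> Ob T"
  by (simp add: UV_def)

lemma UV_iso: assumes "tgt T e \<in> UV" "is_iso T e" shows "src T e \<in> UV"
proof -
  obtain r where r: "r \<in> cone_in T V" "src T r = tgt T e" "tgt T r \<in> U" using assms(1) unfolding UV_def by blast
  have "r \<cdot> e \<in> cone_in T V" using SV.cone_in_comp[OF SV.cone_in_iso[OF assms(2)] r(1)] r(2) by simp
  then show ?thesis unfolding UV_def using r SV.cone_in_ArrD[OF r(1)] assms(2)
    by (auto intro!: bexI[of _ "r \<cdot> e"])
qed

lemma UV_susp_iff: assumes "E \<in> Ob T" shows "susp T E \<in> UV \<longleftrightarrow> E \<in> UV"
proof
  assume "susp T E \<in> UV"
  then obtain l where l: "l \<in> cone_in T V" "src T l = susp T E" "tgt T l \<in> U" unfolding UV_def by blast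
  obtain r where "r \<in> cone_in T V" "src T r = E" "tgt T r \<in> U"
    by (rule desuspend_to[OF thick_U thick_V l(1,2) assms l(3)])
  then show "E \<in> UV" unfolding UV_def using assms by blast
next
  assume "E \<in> UV"
  then obtain r where r: "r \<in> cone_in T V" "src T r = E" "tgt T r \<in> U" unfolding UV_def by blast
  have "susp_arr T r \<in> cone_in T V" using r SV.cone_in_ArrD SV.susp_cone_in_iff by blast
  then show "susp T E \<in> UV" unfolding UV_def using assms r SV.cone_in_ArrD[OF r(1)]
    by (auto intro!: bexI[of _ "susp_arr T r"] simp: SU.S_susp_iff)
qed

text \<open>E is the cone of 0 -> E. The map from 0 to the target of g is the composite of 0 -> tgt
  f with g, and g is mixed because its cone is the suspension of the source of f.\<close>

lemma UV_third:
  assumes t: "(f, g, h) \<in> exact_tri T" and "src T f \<in> UV" "tgt T f \<in> UV"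
  shows "tgt T g \<in> UV"
proof -
  note [simp] = exactD[OF t]
  obtain O' where O': "is_zero_object T O'" "O' \<in> Ob T" by (rule zero_object_ex)
  have z: "(\<zero> O' (tgt T f), ident T (tgt T f), \<zero> (tgt T f) (susp T O')) \<in> exact_tri T"
    "(\<zero> O' (tgt T g), ident T (tgt T g), \<zero> (tgt T g) (susp T O')) \<in> exact_tri T"
    by (rule exact_zero_ident; use O' in simp)+
  have "mixed (\<zero> O' (tgt T f))" using mixed_iff_cone[OF z(1)] assms by simp
  moreover have "mixed g" using mixed_iff_cone[OF rotate[OF t]] assms by (simp add: UV_susp_iff)
  ultimately have "mixed (g \<cdot> \<zero> O' (tgt T f))" by (rule mixed_comp) (use O' in simp)
  then show ?thesis using mixed_iff_cone[OF z(2)] O' by simp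
qed

text \<open>Thickness asks for direct summands; recording only a section and a retraction avoids the
  construction of complements.\<close>

definition UV_retracts :: "'o set" where
  "UV_retracts = {E \<in> Ob T. \<exists>C \<in> UV. \<exists>i \<in> Hom T E C. \<exists>r \<in> Hom T C E. r \<cdot> i = ident T E}"

lemma UV_retractsE:
  assumes "E \<in> UV_retracts"
  obtains C i r where "C \<in> UV" "i \<in> Arr T" "src T i = E" "tgt T i = C" "r \<in> Arr T" "src T r = C" "tgt T r = E"
    "r \<cdot> i = ident T E"
proof -
  obtain C i r where "C \<in> UV" "i \<in> Hom T E C" "r \<in> Hom T C E" "r \<cdot> i = ident T E"
    using assms unfolding UV_retracts_def by blast
  then show thesis using that unfolding Hom_iff by blast
qed

lemma UV_retractsI:
  "\<lbrakk>C \<in> UV; i \<in> Arr T; src T i = E; tgt T i = C; r \<in> Arr T; src T r = C; tgt T r = E; r \<cdot> i = ident T E\<rbrakk>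
    \<Longrightarrow> E \<in> UV_retracts"
  unfolding UV_retracts_def
  by (rule CollectI, rule conjI, erule subst, erule src_Ob, rule bexI[of _ C], rule bexI[of _ i], rule bexI[of _ r])
    (simp_all add: Hom_iff)

lemma UV_sub_retracts: "E \<in> UV \<Longrightarrow> E \<in> UV_retracts"
  using UV_Ob[of E] by (intro UV_retractsI[of E "ident T E" _ "ident T E"]) simp_all

lemma UV_retracts_Ob: "E \<in> UV_retracts \<Longrightarrow> E \<in> Ob T"
  by (simp add: UV_retracts_def)

lemma UV_retracts_susp_iff:
  assumes "E \<in> Ob T" shows "susp T E \<in> UV_retracts \<longleftrightarrow> E \<in> UV_retracts"
proof
  assume "E \<in> UV_retracts"
  then obtain C i r where c: "C \<in> UV" "i \<in> Arr T" "src T i = E" "tgt T i = C" "r \<in> Arr T" "src T r = C" "tgt T r = E"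
    "r \<cdot> i = ident T E" by (rule UV_retractsE)
  have "susp_arr T r \<cdot> susp_arr T i = ident T (susp T E)"
    using c assms by (simp flip: susp_arr_comp)
  then show "susp T E \<in> UV_retracts"
    by (intro UV_retractsI[of "susp T C" "susp_arr T i" _ "susp_arr T r"])
      (use c UV_Ob[OF c(1)] in \<open>simp_all add: UV_susp_iff\<close>)
next
  assume "susp T E \<in> UV_retracts"
  then obtain C i r where c: "C \<in> UV" "i \<in> Arr T" "src T i = susp T E" "tgt T i = C" "r \<in> Arr T" "src T r = C"
    "tgt T r = susp T E" "r \<cdot> i = ident T (susp T E)" by (rule UV_retractsE)
  obtain D e where e: "D \<in> Ob T" "e \<in> Arr T" "src T e = susp T D" "tgt T e = C" "is_iso T e"
    using susp_desusp_ex[OF UV_Ob[OF c(1)]] .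
  obtain e' where e': "e' \<in> Arr T" "src T e' = tgt T e" "tgt T e' = src T e" "e \<cdot> e' = ident T (tgt T e)"
    using e(5) by (rule is_isoE)
  have D: "D \<in> UV" using UV_iso[of e] e c(1) UV_susp_iff[OF e(1)] by simp
  obtain i' where i': "i' \<in> Arr T" "src T i' = E" "tgt T i' = D" "e' \<cdot> i = susp_arr T i'"
    by (rule susp_full[of "e' \<cdot> i" E D]) (use c e e' assms in simp_all)
  obtain r' where r': "r' \<in> Arr T" "src T r' = D" "tgt T r' = E" "r \<cdot> e = susp_arr T r'"
    by (rule susp_full[of "r \<cdot> e" D E]) (use c e assms in simp_all)
  have "(r \<cdot> e) \<cdot> (e' \<cdot> i) = r \<cdot> ((e \<cdot> e') \<cdot> i)" using c(1-7) e(1-4) e'(1-3) by simp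
  also have "\<dots> = ident T (susp T E)" using c e(1-4) e' by simp
  finally have "susp_arr T (r' \<cdot> i') = susp_arr T (ident T E)" using i' r' assms by simp
  then have "r' \<cdot> i' = ident T E" by (rule susp_faithful) (use i' r' assms in simp_all)
  then show "E \<in> UV_retracts" by (intro UV_retractsI[OF D i'(1-3) r'(1-3)])
qed

text \<open>f is a retract of the map f' between objects of \<open>UV\<close>, and TR3 gives maps l
  and m between the cones. Their composite need not be the identity, but it is compatible with g and
  h and therefore invertible; its inverse corrects the retraction.\<close>

lemma UV_retracts_third:
  assumes t: "(f, g, h) \<in> exact_tri T" and "src T f \<in> UV_retracts" "tgt T f \<in> UV_retracts"
  shows "tgt T g \<in> UV_retracts"
proof -
  note [simp] = exactD[OF t]
  obtain C i r where c: "C \<in> UV" "i \<in> Arr T" "src T i = src T f" "tgt T i = C" "r \<in> Arr T" "src T r = C" "tgt T r = src T f"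
    "r \<cdot> i = ident T (src T f)" using assms(2) by (rule UV_retractsE)
  obtain D j k where d: "D \<in> UV" "j \<in> Arr T" "src T j = tgt T f" "tgt T j = D" "k \<in> Arr T" "src T k = D" "tgt T k = tgt T f"
    "k \<cdot> j = ident T (tgt T f)" using assms(3) by (rule UV_retractsE)
  define f' where "f' = j \<cdot> (f \<cdot> r)"
  have f': "f' \<in> Arr T" "src T f' = C" "tgt T f' = D" using c d by (simp_all add: f'_def)
  obtain g' h' where t': "(f', g', h') \<in> exact_tri T" using f' cone_ex by blast
  have x: "j \<cdot> f = f' \<cdot> i" using c d by (simp add: f'_def)
  have y: "k \<cdot> f' = f \<cdot> r" using c d comp_reduce[OF d(8), of "f \<cdot> r"] by (simp add: f'_def)
  obtain l where l: "l \<in> Arr T" "src T l = tgt T g" "tgt T l = tgt T g'" "l \<cdot> g = g' \<cdot> j" "h' \<cdot> l = susp_arr T i \<cdot> h"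
    by (rule TR3_fill[OF t t', of i j]) (use c d f' x in simp_all)
  obtain m where m: "m \<in> Arr T" "src T m = tgt T g'" "tgt T m = tgt T g" "m \<cdot> g' = g \<cdot> k" "h \<cdot> m = susp_arr T r \<cdot> h'"
    by (rule TR3_fill[OF t' t, of r k]) (use c d f' y in simp_all)
  note G = exactD[OF t', unfolded f']
  have "m \<cdot> (l \<cdot> g) = g \<cdot> (k \<cdot> j)"
    unfolding l(4) using m(1-3) l(1-3) G c(2-7) d(2-7) by (simp add: comp_reduce[OF m(4)])
  moreover have "h \<cdot> (m \<cdot> l) = susp_arr T (r \<cdot> i) \<cdot> h"
    using m(1-3) l(1-3) G c(2-7) d(2-7) by (simp add: comp_reduce[OF m(5)] l(5))
  ultimately have iso: "is_iso T (m \<cdot> l)"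
    using m(1-3) l(1-3) c(8) d(8) by (intro is_iso_triangle_endo[OF t]) simp_all
  obtain n where n: "n \<in> Arr T" "src T n = tgt T (m \<cdot> l)" "tgt T n = src T (m \<cdot> l)" "n \<cdot> (m \<cdot> l) = ident T (src T (m \<cdot> l))"
    using iso by (rule is_isoE)
  have "tgt T g' \<in> UV" using UV_third[OF t'] f' c d by simp
  then show ?thesis
    by (rule UV_retractsI[of _ l _ "n \<cdot> m"]) (use n m(1-3) l(1-3) in simp_all)
qed

lemma thick_UV_retracts: "thick T UV_retracts"
  unfolding thick_def triangulated_subcategory_def
proof (intro conjI allI impI ballI)
  show "UV_retracts \<subseteq> Ob T" using UV_retracts_Ob by blast
  show "Z \<in> UV_retracts" if "is_zero_object T Z" for Z
    using that SU.S_zero U_sub_UV UV_sub_retracts by blast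
  show "(X \<in> UV_retracts) = (susp T X \<in> UV_retracts)" if "X \<in> Ob T" for X
    using UV_retracts_susp_iff[OF that] by simp
next
  fix t assume t: "t \<in> exact_tri T"
  obtain f g h where e: "t = (f, g, h)" by (cases t) auto
  then have t: "(f, g, h) \<in> exact_tri T" using t by simp
  note X = exactD[OF t]
  have 1: "src T f \<in> UV_retracts" if "tgt T f \<in> UV_retracts" "tgt T g \<in> UV_retracts"
    using UV_retracts_third[OF rotate[OF t]] that X UV_retracts_susp_iff[of "src T f"] by simp
  have 2: "tgt T f \<in> UV_retracts" if "src T f \<in> UV_retracts" "tgt T g \<in> UV_retracts"
    using UV_retracts_third[OF rotate[OF rotate[OF t]]] that X UV_retracts_susp_iff[of "src T f"]
      UV_retracts_susp_iff[of "tgt T f"] by simp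
  show "case t of (f, g, h) \<Rightarrow> (src T f \<in> UV_retracts \<and> src T g \<in> UV_retracts \<longrightarrow> src T h \<in> UV_retracts) \<and>
      (src T g \<in> UV_retracts \<and> src T h \<in> UV_retracts \<longrightarrow> src T f \<in> UV_retracts) \<and>
      (src T f \<in> UV_retracts \<and> src T h \<in> UV_retracts \<longrightarrow> src T g \<in> UV_retracts)"
    unfolding e prod.case X(4,5) using 1 2 UV_retracts_third[OF t] by blast
next
  fix X Y B i j p q assume b: "is_biproduct T X Y B i j p q \<and> B \<in> UV_retracts"
  then have i: "i \<in> Arr T" "src T i = X" "tgt T i = B" "p \<in> Arr T" "src T p = B" "tgt T p = X" "p \<cdot> i = ident T X"
    by (simp_all add: is_biproduct_def Hom_iff)
  obtain C k r where c: "C \<in> UV" "k \<in> Arr T" "src T k = B" "tgt T k = C" "r \<in> Arr T" "src T r = C" "tgt T r = B"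
    "r \<cdot> k = ident T B" using b UV_retractsE[of B] by blast
  have "p \<cdot> (r \<cdot> (k \<cdot> i)) = ident T X"
    using i c(1-7) comp_reduce[OF c(8), of i] by simp
  then show "X \<in> UV_retracts"
    by (intro UV_retractsI[of C "k \<cdot> i" _ "p \<cdot> r"]) (use i c in simp_all)
qed

lemma J_sub_UV_retracts: "J \<subseteq> UV_retracts"
  unfolding thick_join_def using thick_UV_retracts U_sub_UV V_sub_UV UV_sub_retracts by blast

text \<open>The cone of s is a retract of some C in \<open>UV\<close>, with section i and retraction
  r. The fibre p of i q has cone C and so is mixed, and q p = r i q p = 0 makes p factor through
  s.\<close>

lemma mixed_cofinal:
  assumes "s \<in> cone_in T J"
  obtains j where "mixed (s \<cdot> j)" "j \<in> Arr T" "tgt T j = src T s"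
proof -
  obtain q h where t: "(s, q, h) \<in> exact_tri T" using assms SJ.cone_in_ArrD cone_ex by blast
  note [simp] = exactD[OF t]
  have "tgt T q \<in> UV_retracts" using SJ.cone_in_iff[OF t] assms J_sub_UV_retracts by auto
  then obtain C i r where c: "C \<in> UV" "i \<in> Arr T" "src T i = tgt T q" "tgt T i = C" "r \<in> Arr T" "src T r = C" "tgt T r = tgt T q"
    "r \<cdot> i = ident T (tgt T q)" by (rule UV_retractsE)
  obtain p h' where p: "(p, i \<cdot> q, h') \<in> exact_tri T" using fibre_ex[of "i \<cdot> q"] c by auto
  have pA: "p \<in> Arr T" "tgt T p = tgt T s" using exactD[OF p] c by simp_all
  have "q \<cdot> p = (r \<cdot> i) \<cdot> (q \<cdot> p)" unfolding c(8) using pA by simp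
  also have "\<dots> = r \<cdot> ((i \<cdot> q) \<cdot> p)" using pA c(1-7) by simp
  also have "\<dots> = \<zero> (src T p) (tgt T q)"
    unfolding exact_comp_zero1[OF p] using pA c(1-7) by simp
  finally have z: "q \<cdot> p = \<zero> (src T p) (tgt T q)" .
  obtain j where j: "j \<in> Arr T" "src T j = src T p" "tgt T j = src T s" "s \<cdot> j = p"
    by (rule weak_kernel[OF t pA z])
  have "mixed p" using mixed_iff_cone[OF p] c by simp
  then show thesis by (intro that[of j]) (use j in simp_all)
qed

end

section \<open>The canonical splitting of objects of the join\<close>

context category
begin

lemma factors_through_comp_left:
  assumes "factors_through C x S" "y \<in> Arr C" "src C y = tgt C x"
  shows "factors_through C (y \<cdot> x) S"
proof -
  obtain W g h where W: "W \<in> S" "g \<in> Hom C (src C x) W" "h \<in> Hom C W (tgt C x)" "x = h \<cdot> g"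
    using assms(1) unfolding factors_through_def by blast
  have x: "x \<in> Arr C" using assms(1) by (auto simp: factors_through_def Hom_iff)
  have "y \<cdot> (h \<cdot> g) = (y \<cdot> h) \<cdot> g" "y \<cdot> h \<in> Hom C W (tgt C (y \<cdot> x))" "g \<in> Hom C (src C (y \<cdot> x)) W"
    using W(2,3) assms(2,3) x by (simp_all add: Hom_iff)
  then have "y \<cdot> x = (y \<cdot> h) \<cdot> g" "y \<cdot> h \<in> Hom C W (tgt C (y \<cdot> x))" "g \<in> Hom C (src C (y \<cdot> x)) W"
    by (simp_all only: W(4)[symmetric])
  with W(1) show ?thesis unfolding factors_through_def by blast
qed

lemma factors_through_comp_right:
  assumes "factors_through C x S" "y \<in> Arr C" "tgt C y = src C x"
  shows "factors_through C (x \<cdot> y) S"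
proof -
  obtain W g h where W: "W \<in> S" "g \<in> Hom C (src C x) W" "h \<in> Hom C W (tgt C x)" "x = h \<cdot> g"
    using assms(1) unfolding factors_through_def by blast
  have x: "x \<in> Arr C" using assms(1) by (auto simp: factors_through_def Hom_iff)
  have "(h \<cdot> g) \<cdot> y = h \<cdot> (g \<cdot> y)" "g \<cdot> y \<in> Hom C (src C (x \<cdot> y)) W" "h \<in> Hom C W (tgt C (x \<cdot> y))"
    using W(2,3) assms(2,3) x by (simp_all add: Hom_iff)
  then have "x \<cdot> y = h \<cdot> (g \<cdot> y)" "g \<cdot> y \<in> Hom C (src C (x \<cdot> y)) W" "h \<in> Hom C W (tgt C (x \<cdot> y))"
    by (simp_all only: W(4)[symmetric])
  with W(1) show ?thesis unfolding factors_through_def by blast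
qed

lemma factors_throughI:
  "\<lbrakk>g \<in> Arr C; h \<in> Arr C; tgt C g = src C h; src C h \<in> S\<rbrakk> \<Longrightarrow> factors_through C (h \<cdot> g) S"
  unfolding factors_through_def by (intro bexI[of _ "src C h"] bexI[of _ g] bexI[of _ h]) (simp_all add: Hom_iff)

end

context thick_subcategory
begin

lemma quot_divide:
  assumes "k \<in> Arr Q" "u \<in> cone_in T S" "src Q k = src T u"
  obtains x where "x \<in> Arr Q" "src Q x = tgt T u" "tgt Q x = tgt Q k" "x \<cdot>\<^sub>Q q u = k"
proof -
  have u: "u \<in> Arr T" using assms(2) by (rule cone_in_ArrD)
  obtain r where r: "r \<in> Arr Q" "src Q r = tgt Q (q u)" "tgt Q r = src Q (q u)" "r \<cdot>\<^sub>Q q u = ident Q (src Q (q u))"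
    using q_iso[OF assms(2)] by (rule Q.is_isoE)
  show thesis
    by (rule that[of "k \<cdot>\<^sub>Q r"]) (use r u assms(1,3) in simp_all)
qed

end

context commuting_thick_pair
begin

text \<open>A denominator with cone in the meet has its source in U or V whenever its target is
  there. The numerator then joins U and V, and commutation factors it through the meet.\<close>

lemma quot_hom_zero:
  assumes "x \<in> Arr SM.Q" "src SM.Q x \<in> V \<and> tgt SM.Q x \<in> U \<or> src SM.Q x \<in> U \<and> tgt SM.Q x \<in> V"
  shows "x = \<zero>\<^sub>M (src SM.Q x) (tgt SM.Q x)"
proof -
  obtain s f where s: "s \<in> cone_in T (U \<inter> V)" "f \<in> Arr T" "src T f = src T s" "x = SM.cls s f"
    "src SM.Q x = tgt T s" "tgt SM.Q x = tgt T f" "s \<in> Arr T" using assms(1) by (rule SM.Arr_quotE)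
  have "src T s \<in> V" if "tgt T s \<in> V" using SV.cone_in_src s(1) that cone_in_M_iff by blast
  moreover have "src T s \<in> U" if "tgt T s \<in> U" using SU.cone_in_src s(1) that cone_in_M_iff by blast
  ultimately have "factors_through T f (U \<inter> V)"
    using assms(2) factors_VU[of f] factors_UV[of f] s(2,3,5,6) by auto
  then show ?thesis
    using SM.cls_eq_zero_iff[OF s(1-3)] SM.q_eq_zero_iff[OF s(2)] s(4-6) by simp
qed

text \<open>The middle stretch of the composite runs between an object of U and one of V, so it is
  zero.\<close>

lemma through_orthogonal:
  assumes "factors_through SM.Q y A" "factors_through SM.Q z B" "A = U \<and> B = V \<or> A = V \<and> B = U"
    "y \<in> Arr SM.Q" "z \<in> Arr SM.Q" "w \<in> Arr SM.Q" "tgt SM.Q y = src SM.Q w" "tgt SM.Q w = src SM.Q z"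
  shows "z \<cdot>\<^sub>M (w \<cdot>\<^sub>M y) = \<zero>\<^sub>M (src SM.Q y) (tgt SM.Q z)"
proof -
  obtain W g h where W: "W \<in> A" "g \<in> Hom SM.Q (src SM.Q y) W" "h \<in> Hom SM.Q W (tgt SM.Q y)" "y = h \<cdot>\<^sub>M g"
    using assms(1) unfolding factors_through_def by blast
  obtain W' g' h' where W': "W' \<in> B" "g' \<in> Hom SM.Q (src SM.Q z) W'" "h' \<in> Hom SM.Q W' (tgt SM.Q z)" "z = h' \<cdot>\<^sub>M g'"
    using assms(2) unfolding factors_through_def by blast
  note ty = W(2)[unfolded Hom_iff] W(3)[unfolded Hom_iff] W'(2)[unfolded Hom_iff] W'(3)[unfolded Hom_iff] assms(4-8)
  have z: "g' \<cdot>\<^sub>M (w \<cdot>\<^sub>M h) = \<zero>\<^sub>M W W'"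
    using quot_hom_zero[of "g' \<cdot>\<^sub>M (w \<cdot>\<^sub>M h)"] ty W(1) W'(1) assms(3) by auto
  have "z \<cdot>\<^sub>M (w \<cdot>\<^sub>M y) = (h' \<cdot>\<^sub>M g') \<cdot>\<^sub>M (w \<cdot>\<^sub>M (h \<cdot>\<^sub>M g))"
    by (simp only: W(4)[symmetric] W'(4)[symmetric])
  also have "\<dots> = h' \<cdot>\<^sub>M ((g' \<cdot>\<^sub>M (w \<cdot>\<^sub>M h)) \<cdot>\<^sub>M g)"
    using ty by simp
  also have "\<dots> = \<zero>\<^sub>M (src SM.Q y) (tgt SM.Q z)"
    unfolding z using ty SM.src_quot_Ob[of h] SM.tgt_quot_Ob[of g'] SM.src_quot_Ob[of h'] by simp
  finally show ?thesis .
qed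

section \<open>The projection onto the part in V\<close>

definition splits :: "'o \<Rightarrow> ('m \<times> 'm) set \<Rightarrow> bool" where
  "splits E e \<longleftrightarrow> e \<in> Hom SM.Q E E \<and> factors_through SM.Q e V \<and>
     factors_through SM.Q (ident SM.Q E \<boxplus>\<^sub>M neg_arr SM.Q e) U"

lemma splitsD:
  assumes "splits E e"
  shows "e \<in> Arr SM.Q" "src SM.Q e = E" "tgt SM.Q e = E" "E \<in> Ob T" "factors_through SM.Q e V"
    "factors_through SM.Q (ident SM.Q E \<boxplus>\<^sub>M neg_arr SM.Q e) U"
  using assms SM.src_quot_Ob[of e] unfolding splits_def Hom_iff by auto

text \<open>The off-diagonal pieces (1 - e') x e and e' x (1 - e) join U and V and hence vanish; so
  x e and e' x both equal e' x e.\<close>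

lemma splits_natural:
  assumes "splits E e" "splits E' e'" "x \<in> Arr SM.Q" "src SM.Q x = E" "tgt SM.Q x = E'"
  shows "x \<cdot>\<^sub>M e = e' \<cdot>\<^sub>M x"
proof -
  note e = splitsD[OF assms(1)] and e' = splitsD[OF assms(2)] and x = assms(3-5)
  let ?f = "ident SM.Q E \<boxplus>\<^sub>M neg_arr SM.Q e"
  let ?f' = "ident SM.Q E' \<boxplus>\<^sub>M neg_arr SM.Q e'"
  have "?f' \<cdot>\<^sub>M (x \<cdot>\<^sub>M e) = \<zero>\<^sub>M E E'"
    using through_orthogonal[of e V ?f' U x] e e' x by simp
  then have z: "x \<cdot>\<^sub>M e \<boxplus>\<^sub>M neg_arr SM.Q (e' \<cdot>\<^sub>M (x \<cdot>\<^sub>M e)) =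
      \<zero>\<^sub>M (src SM.Q (x \<cdot>\<^sub>M e)) (tgt SM.Q (x \<cdot>\<^sub>M e))"
    using e(1-4) e'(1-4) x by (simp add: SM.Q.comp_plus_dist_right SM.Q.neg_comp)
  have 1: "x \<cdot>\<^sub>M e = e' \<cdot>\<^sub>M (x \<cdot>\<^sub>M e)"
    by (rule SM.Q.diff_eq_zero_iff[THEN iffD1, OF _ _ _ _ z]) (use e(1-4) e'(1-4) x in simp_all)
  have "e' \<cdot>\<^sub>M (x \<cdot>\<^sub>M ?f) = \<zero>\<^sub>M E E'"
    using through_orthogonal[of ?f U e' V x] e e' x by simp
  then have "e' \<cdot>\<^sub>M x \<boxplus>\<^sub>M neg_arr SM.Q (e' \<cdot>\<^sub>M (x \<cdot>\<^sub>M e)) = \<zero>\<^sub>M E E'"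
    using e(1-4) e'(1-4) x by (simp add: SM.Q.comp_plus_dist_left SM.Q.comp_neg)
  then have "e' \<cdot>\<^sub>M x = e' \<cdot>\<^sub>M (x \<cdot>\<^sub>M e)"
    using SM.Q.diff_eq_zero_iff[of "e' \<cdot>\<^sub>M x" "e' \<cdot>\<^sub>M (x \<cdot>\<^sub>M e)"] e(1-4) e'(1-4) x by simp
  with 1 show ?thesis by simp
qed

lemma splits_unique:
  assumes "splits E e" "splits E e'" shows "e = e'"
  using splits_natural[OF assms, of "ident SM.Q E"] splitsD[OF assms(1)] splitsD[OF assms(2)] by simp

lemma zero_factors_through:
  assumes "X \<in> Ob T" "Y \<in> Ob T" "thick T S" shows "factors_through SM.Q (\<zero>\<^sub>M X Y) S"
proof -
  obtain O' where O': "is_zero_object T O'" "O' \<in> Ob T" by (rule zero_object_ex)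
  have "O' \<in> S" using thick_subcategory.S_zero[OF thick_subcategoryI[OF assms(3)] O'(1)] .
  then show ?thesis
    using SM.Q.factors_throughI[of "\<zero>\<^sub>M X O'" "\<zero>\<^sub>M O' Y" S] assms(1,2) O' by simp
qed

lemma ident_factors_through: "\<lbrakk>X \<in> Ob T; X \<in> S\<rbrakk> \<Longrightarrow> factors_through SM.Q (ident SM.Q X) S"
  using SM.Q.factors_throughI[of "ident SM.Q X" "ident SM.Q X" S] by simp

lemma splits_U: "E \<in> U \<Longrightarrow> splits E (\<zero>\<^sub>M E E)"
  unfolding splits_def by (simp add: Hom_iff zero_factors_through[OF _ _ thick_V] ident_factors_through)

lemma splits_V: "E \<in> V \<Longrightarrow> splits E (ident SM.Q E)"
  unfolding splits_def by (simp add: Hom_iff zero_factors_through[OF _ _ thick_U] ident_factors_through)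

text \<open>
  For \<open>p = u \<cdot> a = v \<cdot> b\<close> the cone of \<open>a\<close> maps to the cone \<open>E\<close> of \<open>p\<close>, which maps to the cone of \<open>v\<close>;
  the composite becomes invertible modulo \<open>U \<inter> V\<close> and exhibits the part of \<open>E\<close> lying in \<open>V\<close>.
\<close>

lemma mixed_splitting:
  assumes uv: "u \<in> cone_in T U" "a \<in> cone_in T V" "v \<in> cone_in T V" "b \<in> cone_in T U"
    and ty: "tgt T a = src T u" "tgt T b = src T v" "src T b = src T a" "tgt T v = tgt T u"
    and eq: "p = u \<cdot> a" "v \<cdot> b = u \<cdot> a" and t: "(p, q, h) \<in> exact_tri T"
  obtains a1 a2 v1 v2 i j r where "(a, a1, a2) \<in> exact_tri T" "(v, v1, v2) \<in> exact_tri T"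
    "i \<in> Arr T" "src T i = tgt T a1" "tgt T i = tgt T q" "j \<in> Arr T" "src T j = tgt T q" "tgt T j = tgt T v1"
    "i \<cdot> a1 = q \<cdot> u" "h \<cdot> i = a2" "j \<cdot> q = v1" "v2 \<cdot> j = susp_arr T b \<cdot> h"
    "r \<in> Arr SM.Q" "src SM.Q r = tgt T v1" "tgt SM.Q r = tgt T a1"
    "r \<cdot>\<^sub>M SM.q (j \<cdot> i) = ident SM.Q (tgt T a1)" "SM.q (j \<cdot> i) \<cdot>\<^sub>M r = ident SM.Q (tgt T v1)"
    "splits (tgt T q) (SM.q i \<cdot>\<^sub>M (r \<cdot>\<^sub>M SM.q j))"
proof -
  note A = uv(1,4)[THEN SU.cone_in_ArrD] uv(2,3)[THEN SV.cone_in_ArrD]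
  obtain a1 a2 where a: "(a, a1, a2) \<in> exact_tri T" using A cone_ex by blast
  obtain v1 v2 where v: "(v, v1, v2) \<in> exact_tri T" using A cone_ex by blast
  obtain u1 u2 where u: "(u, u1, u2) \<in> exact_tri T" using A cone_ex by blast
  obtain b1 b2 where b: "(b, b1, b2) \<in> exact_tri T" using A cone_ex by blast
  have pv: "p = v \<cdot> b" using eq by simp
  from TR4[OF a u t ty(1) eq(1)]
  obtain i k2 k3 where k: "(i, k2, k3) \<in> exact_tri T" "i \<in> Hom T (tgt T a1) (tgt T q)"
    "k2 \<in> Hom T (tgt T q) (tgt T u1)" "i \<cdot> a1 = q \<cdot> u" "h \<cdot> i = a2" by auto
  from TR4[OF b v t ty(2) pv]
  obtain l1 j l3 where l: "(l1, j, l3) \<in> exact_tri T" "l1 \<in> Hom T (tgt T b1) (tgt T q)"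
    "j \<in> Hom T (tgt T q) (tgt T v1)" "j \<cdot> q = v1" "v2 \<cdot> j = susp_arr T b \<cdot> h" by auto
  have i: "i \<in> Arr T" "src T i = tgt T a1" "tgt T i = tgt T q" using k by (auto simp: Hom_iff)
  have k2: "k2 \<in> Arr T" "src T k2 = tgt T q" "tgt T k2 = tgt T u1" using k by (auto simp: Hom_iff)
  have j: "j \<in> Arr T" "src T j = tgt T q" "tgt T j = tgt T v1" using l by (auto simp: Hom_iff)
  have a1V: "tgt T a1 \<in> V" and v1V: "tgt T v1 \<in> V" and u1U: "tgt T u1 \<in> U"
    using SV.cone_in_iff[OF a] SV.cone_in_iff[OF v] SU.cone_in_iff[OF u] uv by simp_all
  have "i \<in> cone_in T U" using SU.cone_in_iff[OF k(1)] k2 u1U by simp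
  moreover have "j \<in> cone_in T U" using SU.cone_in_iff_fibre[OF l(1)] l(2) SU.cone_in_iff[OF b] uv by (simp add: Hom_iff)
  ultimately have "j \<cdot> i \<in> cone_in T U" using i j by (intro SU.cone_in_comp) simp_all
  \<comment> \<open>Source and target of \<open>j \<cdot> i\<close> are the cones of a and of v,
    both in V.\<close>
  moreover have "j \<cdot> i \<in> cone_in T V" using i j a1V v1V by (intro SV.cone_in_between) simp_all
  ultimately have "j \<cdot> i \<in> cone_in T (U \<inter> V)" by (simp add: cone_in_M_iff)
  from SM.q_iso[OF this] obtain r where "r \<in> Arr SM.Q" "src SM.Q r = tgt SM.Q (SM.q (j \<cdot> i))" "tgt SM.Q r = src SM.Q (SM.q (j \<cdot> i))"
    "r \<cdot>\<^sub>M SM.q (j \<cdot> i) = ident SM.Q (src SM.Q (SM.q (j \<cdot> i)))"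
    "SM.q (j \<cdot> i) \<cdot>\<^sub>M r = ident SM.Q (tgt SM.Q (SM.q (j \<cdot> i)))" by (rule SM.Q.is_isoE)
  then have r: "r \<in> Arr SM.Q" "src SM.Q r = tgt T v1" "tgt SM.Q r = tgt T a1"
    "r \<cdot>\<^sub>M SM.q (j \<cdot> i) = ident SM.Q (tgt T a1)" "SM.q (j \<cdot> i) \<cdot>\<^sub>M r = ident SM.Q (tgt T v1)"
    using i j by (simp_all del: SM.q_comp)
  let ?e = "SM.q i \<cdot>\<^sub>M (r \<cdot>\<^sub>M SM.q j)"
  have E: "tgt T q \<in> Ob T" using exactD[OF t] by simp
  have e: "?e \<in> Arr SM.Q" "src SM.Q ?e = tgt T q" "tgt SM.Q ?e = tgt T q" using i j r(1-3) by simp_all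
  have eV: "factors_through SM.Q ?e V"
    using i j r(1-3) a1V by (intro SM.Q.factors_throughI) simp_all
  let ?f = "ident SM.Q (tgt T q) \<boxplus>\<^sub>M neg_arr SM.Q ?e"
  \<comment> \<open>e fixes i, so 1 - e kills i and factors through the cone of i, which is the cone
    of u and lies in U.\<close>
  have "?e \<cdot>\<^sub>M SM.q i = SM.q i \<cdot>\<^sub>M (r \<cdot>\<^sub>M SM.q (j \<cdot> i))"
    using i j r(1-3) by simp
  then have ei: "?e \<cdot>\<^sub>M SM.q i = SM.q i" unfolding r(4) using i by simp
  have f: "?f \<in> Arr SM.Q" "src SM.Q ?f = tgt T q" "tgt SM.Q ?f = tgt T q" using e E by simp_all
  have "?f \<cdot>\<^sub>M SM.q i = SM.q i \<boxplus>\<^sub>M neg_arr SM.Q (?e \<cdot>\<^sub>M SM.q i)"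
    using e E i by (simp add: SM.Q.comp_plus_dist_right SM.Q.neg_comp del: SM.Q.comp_assoc_Arr)
  also have "\<dots> = \<zero>\<^sub>M (src T i) (tgt SM.Q ?f)" unfolding ei using i f by simp
  finally obtain y where y: "y \<in> Arr SM.Q" "src SM.Q y = tgt T k2" "tgt SM.Q y = tgt SM.Q ?f" "y \<cdot>\<^sub>M SM.q k2 = ?f"
    by (rule SM.quot_weak_cokernel[OF k(1) f(1), rotated 1]) (use f(2) i in simp_all)
  have "factors_through SM.Q ?f U"
    unfolding y(4)[symmetric] using y(1,2) k2 u1U by (intro SM.Q.factors_throughI) simp_all
  then have "splits (tgt T q) ?e" unfolding splits_def Hom_iff using e eV by simp
  then show thesis by (rule that[OF a v i j k(4,5) l(4,5) r])
qed

text \<open>E is the cone of the mixed morphism 0 -> E, so the splitting of cones applies to E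
  itself.\<close>

lemma splits_UV_ex: assumes "E \<in> UV" shows "\<exists>e. splits E e"
proof -
  have E: "E \<in> Ob T" using assms by (rule UV_Ob)
  obtain O' where O': "is_zero_object T O'" "O' \<in> Ob T" by (rule zero_object_ex)
  have z: "(\<zero> O' E, ident T E, \<zero> E (susp T O')) \<in> exact_tri T" by (rule exact_zero_ident[OF E O'(1)])
  have "mixed (\<zero> O' E)" using mixed_iff_cone[OF z] assms E by simp
  then obtain u a v b where uv: "u \<in> cone_in T U" "a \<in> cone_in T V" "v \<in> cone_in T V" "b \<in> cone_in T U"
    "tgt T a = src T u" "tgt T b = src T v" "src T b = src T a" "tgt T v = tgt T u" "\<zero> O' E = u \<cdot> a" "v \<cdot> b = u \<cdot> a"
    by (rule mixedE)
  show ?thesis by (rule mixed_splitting[OF uv z]) (use E in auto)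
qed

text \<open>Because r i = 1, compressing 1 - e by r and i gives the complement of the compressed
  e.\<close>

lemma splits_retract:
  assumes "splits C e" "i \<in> Arr T" "src T i = E" "tgt T i = C" "r \<in> Arr T" "src T r = C" "tgt T r = E" "r \<cdot> i = ident T E"
  shows "splits E (SM.q r \<cdot>\<^sub>M (e \<cdot>\<^sub>M SM.q i))"
proof -
  note e = splitsD[OF assms(1)]
  have E: "E \<in> Ob T" using assms(2,3) by auto
  have "SM.q r \<cdot>\<^sub>M SM.q i = SM.q (r \<cdot> i)" using assms(2-7) by simp
  then have ri: "SM.q r \<cdot>\<^sub>M SM.q i = ident SM.Q E" unfolding assms(8) using E by simp
  have "factors_through SM.Q (SM.q r \<cdot>\<^sub>M ((ident SM.Q C \<boxplus>\<^sub>M neg_arr SM.Q e) \<cdot>\<^sub>M SM.q i)) U"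
    using e assms(2-7) by (intro SM.Q.factors_through_comp_left SM.Q.factors_through_comp_right) simp_all
  moreover have "SM.q r \<cdot>\<^sub>M ((ident SM.Q C \<boxplus>\<^sub>M neg_arr SM.Q e) \<cdot>\<^sub>M SM.q i) =
      ident SM.Q E \<boxplus>\<^sub>M neg_arr SM.Q (SM.q r \<cdot>\<^sub>M (e \<cdot>\<^sub>M SM.q i))"
    using e(1-4) assms(2-7) ri
    by (simp add: SM.Q.comp_plus_dist_right SM.Q.comp_plus_dist_left SM.Q.neg_comp SM.Q.comp_neg)
  moreover have "factors_through SM.Q (SM.q r \<cdot>\<^sub>M (e \<cdot>\<^sub>M SM.q i)) V"
    using e assms(2-7) by (intro SM.Q.factors_through_comp_left SM.Q.factors_through_comp_right) simp_all
  ultimately show ?thesis unfolding splits_def Hom_iff using e(1-4) assms(2-7) by simp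
qed

lemma splits_ex: assumes "E \<in> J" shows "\<exists>e. splits E e"
proof -
  have "E \<in> UV_retracts" using assms J_sub_UV_retracts by blast
  then obtain C i r where c: "C \<in> UV" "i \<in> Arr T" "src T i = E" "tgt T i = C" "r \<in> Arr T" "src T r = C" "tgt T r = E"
    "r \<cdot> i = ident T E" by (rule UV_retractsE)
  obtain e where "splits C e" using splits_UV_ex[OF c(1)] by blast
  from splits_retract[OF this c(2-8)] show ?thesis by blast
qed

definition proj_V :: "'o \<Rightarrow> ('m \<times> 'm) set" where
  "proj_V E = (SOME e. splits E e)"

lemma splits_proj_V: "E \<in> J \<Longrightarrow> splits E (proj_V E)"
  unfolding proj_V_def by (rule someI_ex[OF splits_ex])

lemma proj_V_eq: "\<lbrakk>splits E e; E \<in> J\<rbrakk> \<Longrightarrow> proj_V E = e"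
  using splits_unique splits_proj_V by blast

section \<open>The connecting morphism\<close>

definition connect :: "'m \<Rightarrow> 'm \<Rightarrow> ('m \<times> 'm) set" where
  "connect q h = SM.q h \<cdot>\<^sub>M (proj_V (tgt T q) \<cdot>\<^sub>M SM.q q)"

lemma connect_Arr:
  assumes "(s, q, h) \<in> exact_tri T" "s \<in> cone_in T J"
  shows "connect q h \<in> Arr SM.Q" "src SM.Q (connect q h) = tgt T s" "tgt SM.Q (connect q h) = susp T (src T s)"
  using assms SJ.cone_in_iff[OF assms(1)] exactD[OF assms(1)] splitsD[OF splits_proj_V[of "tgt T q"]]
  by (simp_all add: connect_def)

text \<open>TR3 extends the square to some map c of cones. It is not unique, but the projections
  commute with every map in T/M, so any choice carries one formula to the other.\<close>

lemma connect_natural: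
  assumes s: "(s, q, h) \<in> exact_tri T" "s \<in> cone_in T J" and s': "(s', q', h') \<in> exact_tri T" "s' \<in> cone_in T J"
    and a: "a \<in> Arr T" "src T a = src T s'" "tgt T a = src T s"
    and g: "g \<in> Arr T" "src T g = tgt T s'" "tgt T g = tgt T s" and sq: "s \<cdot> a = g \<cdot> s'"
  shows "SM.q (susp_arr T a) \<cdot>\<^sub>M connect q' h' = connect q h \<cdot>\<^sub>M SM.q g"
proof -
  obtain c where c: "c \<in> Arr T" "src T c = tgt T q'" "tgt T c = tgt T q" "c \<cdot> q' = q \<cdot> g" "h \<cdot> c = susp_arr T a \<cdot> h'"
    by (rule TR3_fill[OF s'(1) s(1) a g sq[symmetric]])
  have J: "tgt T q \<in> J" "tgt T q' \<in> J" using SJ.cone_in_iff[OF s(1)] SJ.cone_in_iff[OF s'(1)] s(2) s'(2) by simp_all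
  note e = splitsD[OF splits_proj_V[OF J(1)]] and e' = splitsD[OF splits_proj_V[OF J(2)]]
  note X = exactD[OF s(1)] and X' = exactD[OF s'(1)]
  have n: "SM.q c \<cdot>\<^sub>M proj_V (tgt T q') = proj_V (tgt T q) \<cdot>\<^sub>M SM.q c"
    by (rule splits_natural[OF splits_proj_V[OF J(2)] splits_proj_V[OF J(1)]]) (use c in simp_all)
  have "SM.q (susp_arr T a) \<cdot>\<^sub>M connect q' h' = SM.q (susp_arr T a \<cdot> h') \<cdot>\<^sub>M (proj_V (tgt T q') \<cdot>\<^sub>M SM.q q')"
    using a X' e'(1-4) by (simp add: connect_def)
  also have "\<dots> = SM.q h \<cdot>\<^sub>M ((SM.q c \<cdot>\<^sub>M proj_V (tgt T q')) \<cdot>\<^sub>M SM.q q')"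
    unfolding c(5)[symmetric] using c(1-3) X X' e'(1-4) by simp
  also have "\<dots> = SM.q h \<cdot>\<^sub>M (proj_V (tgt T q) \<cdot>\<^sub>M SM.q (c \<cdot> q'))"
    unfolding n using c(1-3) X X' e(1-4) by simp
  also have "\<dots> = connect q h \<cdot>\<^sub>M SM.q g"
    unfolding c(4) connect_def using g X e(1-4) by simp
  finally show ?thesis .
qed

text \<open>The value is described through an arbitrary representing fraction and an arbitrary
  triangle on its denominator; the choice becomes harmless once all such descriptions are shown to
  agree.\<close>

definition connecting :: "('m \<times> 'm) set \<Rightarrow> ('m \<times> 'm) set" where
  "connecting x = (SOME d. \<exists>s f q h. s \<in> cone_in T J \<and> f \<in> Arr T \<and> src T f = src T s \<and> x = SJ.cls s f \<and>
     (s, q, h) \<in> exact_tri T \<and> d = SM.q (susp_arr T f) \<cdot>\<^sub>M connect q h)"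

lemma connect_refine:
  assumes s: "(s, q, h) \<in> exact_tri T" "s \<in> cone_in T J" and f: "f \<in> Arr T" "src T f = src T s"
    and a: "a \<in> cone_in T J" "tgt T a = src T s" and t: "(s \<cdot> a, q', h') \<in> exact_tri T"
  shows "SM.q (susp_arr T f) \<cdot>\<^sub>M connect q h = SM.q (susp_arr T (f \<cdot> a)) \<cdot>\<^sub>M connect q' h'"
proof -
  have A: "a \<in> Arr T" using a SJ.cone_in_ArrD by blast
  have c: "s \<cdot> a \<in> cone_in T J" using s(2) a by (intro SJ.cone_in_comp)
  note X = exactD[OF s(1)]
  have "SM.q (susp_arr T a) \<cdot>\<^sub>M connect q' h' = connect q h \<cdot>\<^sub>M SM.q (ident T (tgt T s))"
    by (rule connect_natural[OF s t c]) (use A a X in simp_all)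
  then have "connect q h = SM.q (susp_arr T a) \<cdot>\<^sub>M connect q' h'"
    using connect_Arr[OF s] X by simp
  then show ?thesis using connect_Arr[OF t c] A a X f by simp
qed

text \<open>Two fractions of one class have a common refinement; a single triangle on its
  denominator compares both values with a third.\<close>

lemma connecting_cls:
  assumes s: "(s, q, h) \<in> exact_tri T" "s \<in> cone_in T J" and f: "f \<in> Arr T" "src T f = src T s"
  shows "connecting (SJ.cls s f) = SM.q (susp_arr T f) \<cdot>\<^sub>M connect q h"
  unfolding connecting_def
proof (rule some_equality)
  show "\<exists>s' f' q' h'. s' \<in> cone_in T J \<and> f' \<in> Arr T \<and> src T f' = src T s' \<and> SJ.cls s f = SJ.cls s' f' \<and>
     (s', q', h') \<in> exact_tri T \<and> SM.q (susp_arr T f) \<cdot>\<^sub>M connect q h = SM.q (susp_arr T f') \<cdot>\<^sub>M connect q' h'"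
    using s f by blast
next
  fix d assume "\<exists>s' f' q' h'. s' \<in> cone_in T J \<and> f' \<in> Arr T \<and> src T f' = src T s' \<and> SJ.cls s f = SJ.cls s' f' \<and>
     (s', q', h') \<in> exact_tri T \<and> d = SM.q (susp_arr T f') \<cdot>\<^sub>M connect q' h'"
  then obtain s' f' q' h' where s': "s' \<in> cone_in T J" "f' \<in> Arr T" "src T f' = src T s'" "SJ.cls s f = SJ.cls s' f'"
     "(s', q', h') \<in> exact_tri T" "d = SM.q (susp_arr T f') \<cdot>\<^sub>M connect q' h'" by blast
  obtain a b where ab: "a \<in> cone_in T J" "b \<in> cone_in T J" "src T a = src T b" "tgt T a = src T s" "tgt T b = src T s'"
    "s \<cdot> a = s' \<cdot> b" "f \<cdot> a = f' \<cdot> b"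
    by (rule SJ.cls_eqE[OF s'(4)]) (use s f s' in \<open>auto simp: fractions_iff\<close>)
  have "s \<cdot> a \<in> Arr T" using ab(1,4) s(2) SJ.cone_in_ArrD by simp
  then obtain k l where kl: "(s \<cdot> a, k, l) \<in> exact_tri T" by (rule cone_ex)
  show "d = SM.q (susp_arr T f) \<cdot>\<^sub>M connect q h"
    unfolding s'(6) connect_refine[OF s f ab(1,4) kl]
      connect_refine[OF s'(5,1,2,3) ab(2,5) kl[unfolded ab(6)]] ab(7) ..
qed

lemma connecting_Arr [simp]:
  assumes "x \<in> Arr SJ.Q"
  shows "connecting x \<in> Arr SM.Q" "src SM.Q (connecting x) = src SJ.Q x" "tgt SM.Q (connecting x) = susp T (tgt SJ.Q x)"
proof -
  obtain s f where s: "s \<in> cone_in T J" "f \<in> Arr T" "src T f = src T s" "x = SJ.cls s f"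
    "src SJ.Q x = tgt T s" "tgt SJ.Q x = tgt T f" "s \<in> Arr T" using assms by (rule SJ.Arr_quotE)
  obtain q h where t: "(s, q, h) \<in> exact_tri T" using s(7) by (rule cone_ex)
  show "connecting x \<in> Arr SM.Q" "src SM.Q (connecting x) = src SJ.Q x" "tgt SM.Q (connecting x) = susp T (tgt SJ.Q x)"
    unfolding s(5,6) unfolding s(4) connecting_cls[OF t s(1-3)] using s(2,3) connect_Arr[OF t s(1)] by simp_all
qed

lemma connecting_plus:
  assumes "x \<in> Arr SJ.Q" "y \<in> Arr SJ.Q" "src SJ.Q x = src SJ.Q y" "tgt SJ.Q x = tgt SJ.Q y"
  shows "connecting (x \<boxplus>\<^sub>J y) = connecting x \<boxplus>\<^sub>M connecting y"
proof -
  obtain s f g where s: "s \<in> cone_in T J" "f \<in> Arr T" "src T f = src T s" "g \<in> Arr T" "src T g = src T s"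
    "x = SJ.cls s f" "y = SJ.cls s g" "tgt T s = src SJ.Q x" "tgt T f = tgt SJ.Q x" "tgt T g = tgt SJ.Q y" "s \<in> Arr T"
    by (rule SJ.common_denominator[OF assms(1-3)])
  obtain q h where t: "(s, q, h) \<in> exact_tri T" using s(11) by (rule cone_ex)
  have fg: "tgt T f = tgt T g" using s(9,10) assms by simp
  show ?thesis
    unfolding s(6,7) SJ.plus_cls[OF s(1-5) fg] connecting_cls[OF t s(1-3)] connecting_cls[OF t s(1,4,5)]
    using s(2-5) fg connecting_cls[OF t s(1), of "f \<boxplus> g"] connect_Arr[OF t s(1)]
    by (simp add: SM.Q.comp_plus_dist_right)
qed

lemma connecting_zero [simp]: "\<lbrakk>X \<in> Ob T; Y \<in> Ob T\<rbrakk> \<Longrightarrow> connecting (\<zero>\<^sub>J X Y) = \<zero>\<^sub>M X (susp T Y)"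
  using connecting_plus[of "\<zero>\<^sub>J X Y" "\<zero>\<^sub>J X Y"] SM.Q.idempotent_zero[of "connecting (\<zero>\<^sub>J X Y)"] by simp

lemma connecting_neg:
  assumes "x \<in> Arr SJ.Q" shows "connecting (neg_arr SJ.Q x) = neg_arr SM.Q (connecting x)"
  by (rule SM.Q.neg_eqI[symmetric]) (use assms connecting_plus[of x "neg_arr SJ.Q x"] in simp_all)

lemma connecting_natural:
  assumes x: "x \<in> Arr SJ.Q" and a: "a \<in> Arr T" "tgt T a = src SJ.Q x" and b: "b \<in> Arr T" "src T b = tgt SJ.Q x"
  shows "connecting (SJ.q b \<cdot>\<^sub>J (x \<cdot>\<^sub>J SJ.q a)) =
    SM.q (susp_arr T b) \<cdot>\<^sub>M (connecting x \<cdot>\<^sub>M SM.q a)"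
proof -
  obtain s f where s: "s \<in> cone_in T J" "f \<in> Arr T" "src T f = src T s" "tgt T s = src SJ.Q x" "tgt T f = tgt SJ.Q x"
    "s \<in> Arr T" "x = SJ.cls s f" "x \<cdot>\<^sub>J SJ.q s = SJ.q f" using x by (rule SJ.quot_right_fraction)
  have st: "tgt T s = tgt T a" "tgt T f = src T b" using s(4,5) a b by simp_all
  \<comment> \<open>Precomposition with a replaces the denominator s by s' through an Ore square;
    naturality for this square carries a past the connecting map.\<close>
  obtain s' a' where o: "s' \<in> cone_in T J" "a' \<in> Arr T" "src T a' = src T s'" "tgt T s' = src T a" "tgt T a' = src T s"
    "s \<cdot> a' = a \<cdot> s'" by (rule SJ.ore_cone[OF s(1) a(1) st(1)])
  have s': "s' \<in> Arr T" using o SJ.cone_in_ArrD by blast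
  have e: "SJ.q b \<cdot>\<^sub>J (x \<cdot>\<^sub>J SJ.q a) = SJ.cls s' (b \<cdot> (f \<cdot> a'))"
  proof (rule SJ.cls_eq_if_comp_q)
    have "(SJ.q b \<cdot>\<^sub>J (x \<cdot>\<^sub>J SJ.q a)) \<cdot>\<^sub>J SJ.q s' = SJ.q b \<cdot>\<^sub>J (x \<cdot>\<^sub>J SJ.q (a \<cdot> s'))"
      using x a b o(1-5) s' by simp
    also have "\<dots> = SJ.q b \<cdot>\<^sub>J ((x \<cdot>\<^sub>J SJ.q s) \<cdot>\<^sub>J SJ.q a')"
      unfolding o(6)[symmetric] using x b s(2-6) o(1-5) by simp
    also have "\<dots> = SJ.q (b \<cdot> (f \<cdot> a'))" unfolding s(8) using b s(2-6) o(1-5) by simp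
    finally show "(SJ.q b \<cdot>\<^sub>J (x \<cdot>\<^sub>J SJ.q a)) \<cdot>\<^sub>J SJ.q s' = SJ.q (b \<cdot> (f \<cdot> a'))" .
  qed (use x a b s(2-6) o(1-5) s' in simp_all)
  obtain q h where t: "(s, q, h) \<in> exact_tri T" using s(6) by (rule cone_ex)
  obtain q' h' where t': "(s', q', h') \<in> exact_tri T" using s' by (rule cone_ex)
  have n: "SM.q (susp_arr T a') \<cdot>\<^sub>M connect q' h' = connect q h \<cdot>\<^sub>M SM.q a"
    by (rule connect_natural[OF t s(1) t' o(1)]) (use o st a in simp_all)
  note C = connect_Arr[OF t s(1)] and C' = connect_Arr[OF t' o(1)]
  have "connecting (SJ.cls s' (b \<cdot> (f \<cdot> a'))) = SM.q (susp_arr T (b \<cdot> (f \<cdot> a'))) \<cdot>\<^sub>M connect q' h'"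
    by (rule connecting_cls[OF t' o(1)]) (use b s(2,3) st o(2-5) in simp_all)
  also have "\<dots> = SM.q (susp_arr T b) \<cdot>\<^sub>M (SM.q (susp_arr T f) \<cdot>\<^sub>M (SM.q (susp_arr T a') \<cdot>\<^sub>M connect q' h'))"
    using b s(2,3) st o(2-5) C' by simp
  also have "\<dots> = SM.q (susp_arr T b) \<cdot>\<^sub>M ((SM.q (susp_arr T f) \<cdot>\<^sub>M connect q h) \<cdot>\<^sub>M SM.q a)"
    unfolding n using a b s(2,3) st C by simp
  also have "SM.q (susp_arr T f) \<cdot>\<^sub>M connect q h = connecting x"
    unfolding s(7) by (rule connecting_cls[OF t s(1-3), symmetric])
  finally show ?thesis unfolding e .
qed

end

section \<open>Exactness\<close>

context commuting_thick_pair
begin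

text \<open>On a mixed denominator the projection is i r j, and the octahedra identify h i with a2
  and j q with v1. The connecting map is thus read off from the cones of a and v, with c = j i as
  the comparison that r inverts.\<close>

lemma connect_mixed:
  assumes uv: "u \<in> cone_in T U" "a \<in> cone_in T V" "v \<in> cone_in T V" "b \<in> cone_in T U"
    and ty: "tgt T a = src T u" "tgt T b = src T v" "src T b = src T a" "tgt T v = tgt T u"
    and eq: "p = u \<cdot> a" "v \<cdot> b = u \<cdot> a" and t: "(p, q, h) \<in> exact_tri T"
  obtains a1 a2 v1 v2 c r where "(a, a1, a2) \<in> exact_tri T" "(v, v1, v2) \<in> exact_tri T"
    "c \<in> Arr T" "src T c = tgt T a1" "tgt T c = tgt T v1" "c \<cdot> a1 = v1 \<cdot> u" "v2 \<cdot> c = susp_arr T b \<cdot> a2"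
    "r \<in> Arr SM.Q" "src SM.Q r = tgt T v1" "tgt SM.Q r = tgt T a1"
    "r \<cdot>\<^sub>M SM.q c = ident SM.Q (tgt T a1)" "SM.q c \<cdot>\<^sub>M r = ident SM.Q (tgt T v1)"
    "connect q h = SM.q a2 \<cdot>\<^sub>M (r \<cdot>\<^sub>M SM.q v1)"
proof -
  obtain a1 a2 v1 v2 i j r where m: "(a, a1, a2) \<in> exact_tri T" "(v, v1, v2) \<in> exact_tri T"
    "i \<in> Arr T" "src T i = tgt T a1" "tgt T i = tgt T q" "j \<in> Arr T" "src T j = tgt T q" "tgt T j = tgt T v1"
    "i \<cdot> a1 = q \<cdot> u" "h \<cdot> i = a2" "j \<cdot> q = v1" "v2 \<cdot> j = susp_arr T b \<cdot> h"
    "r \<in> Arr SM.Q" "src SM.Q r = tgt T v1" "tgt SM.Q r = tgt T a1"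
    "r \<cdot>\<^sub>M SM.q (j \<cdot> i) = ident SM.Q (tgt T a1)" "SM.q (j \<cdot> i) \<cdot>\<^sub>M r = ident SM.Q (tgt T v1)"
    "splits (tgt T q) (SM.q i \<cdot>\<^sub>M (r \<cdot>\<^sub>M SM.q j))"
    by (rule mixed_splitting[OF uv ty eq t])
  note A = uv(1,4)[THEN SU.cone_in_ArrD] uv(2,3)[THEN SV.cone_in_ArrD]
  note X = exactD[OF t] and a = exactD[OF m(1)] and v = exactD[OF m(2)]
  have p: "tgt T p = tgt T u" "src T p = src T a" unfolding eq(1) using A ty by simp_all
  have "mixed p" unfolding eq(1) by (rule mixedI[OF uv(1,2) ty(1)])
  then have "tgt T q \<in> J" using SJ.cone_in_iff[OF t] mixed_cone_in_J by blast
  then have e: "proj_V (tgt T q) = SM.q i \<cdot>\<^sub>M (r \<cdot>\<^sub>M SM.q j)" by (rule proj_V_eq[OF m(18)])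
  have "connect q h = SM.q (h \<cdot> i) \<cdot>\<^sub>M (r \<cdot>\<^sub>M SM.q (j \<cdot> q))"
    unfolding connect_def e using X m(3-8,13-15) by simp
  then have c: "connect q h = SM.q a2 \<cdot>\<^sub>M (r \<cdot>\<^sub>M SM.q v1)" unfolding m(10,11) .
  have "j \<cdot> (i \<cdot> a1) = (j \<cdot> q) \<cdot> u" unfolding m(9) using m(3-8) X p A by simp
  then have 1: "(j \<cdot> i) \<cdot> a1 = v1 \<cdot> u" unfolding m(11) using m(3-8) a by simp
  have "(v2 \<cdot> j) \<cdot> i = susp_arr T b \<cdot> (h \<cdot> i)" unfolding m(12) using m(3-8) X p A ty by simp
  then have 2: "v2 \<cdot> (j \<cdot> i) = susp_arr T b \<cdot> a2" unfolding m(10) using m(3-8) v by simp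
  show thesis
    by (rule that[OF m(1,2) _ _ _ 1 2 m(13-17) c]) (use m(3-8) in simp_all)
qed

text \<open>The denominator has its cone in U, where the projection onto the part in V is
  zero.\<close>

lemma induced_connecting_U:
  assumes "x \<in> Arr SU.Q"
  shows "connecting (UJ.I x) = \<zero>\<^sub>M (src SU.Q x) (susp T (tgt SU.Q x))"
proof -
  obtain s f where s: "s \<in> cone_in T U" "f \<in> Arr T" "src T f = src T s" "x = SU.cls s f"
    "src SU.Q x = tgt T s" "tgt SU.Q x = tgt T f" "s \<in> Arr T" using assms by (rule SU.Arr_quotE)
  obtain q h where t: "(s, q, h) \<in> exact_tri T" using s(7) by (rule cone_ex)
  have E: "tgt T q \<in> U" using SU.cone_in_iff[OF t] s(1) by simp
  have "proj_V (tgt T q) = \<zero>\<^sub>M (tgt T q) (tgt T q)" by (rule proj_V_eq[OF splits_U]) (use E U_sub_J in auto)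
  then have "connect q h = \<zero>\<^sub>M (tgt T s) (susp T (src T s))"
    unfolding connect_def using exactD[OF t] by simp
  then show ?thesis
    unfolding s(5,6) unfolding s(4) UJ.induced_cls[OF s(1-3)] connecting_cls[OF t UJ.cone_in_mono[OF s(1)] s(2,3)]
    using s(2,3,7) by simp
qed

text \<open>On a cone in V the projection is the identity, which leaves the composite h q of two
  consecutive maps of a triangle.\<close>

lemma induced_connecting_V:
  assumes "x \<in> Arr SV.Q"
  shows "connecting (VJ.I x) = \<zero>\<^sub>M (src SV.Q x) (susp T (tgt SV.Q x))"
proof -
  obtain s f where s: "s \<in> cone_in T V" "f \<in> Arr T" "src T f = src T s" "x = SV.cls s f"
    "src SV.Q x = tgt T s" "tgt SV.Q x = tgt T f" "s \<in> Arr T" using assms by (rule SV.Arr_quotE)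
  obtain q h where t: "(s, q, h) \<in> exact_tri T" using s(7) by (rule cone_ex)
  have E: "tgt T q \<in> V" using SV.cone_in_iff[OF t] s(1) by simp
  have "proj_V (tgt T q) = ident SM.Q (tgt T q)" by (rule proj_V_eq[OF splits_V]) (use E V_sub_J in auto)
  then have "connect q h = SM.q (h \<cdot> q)"
    unfolding connect_def using exactD[OF t] by simp
  then have "connect q h = \<zero>\<^sub>M (tgt T s) (susp T (src T s))"
    unfolding exact_comp_zero2[OF t] using exactD[OF t] by simp
  then show ?thesis
    unfolding s(5,6) unfolding s(4) VJ.induced_cls[OF s(1-3)] connecting_cls[OF t VJ.cone_in_mono[OF s(1)] s(2,3)]
    using s(2,3,7) by simp
qed

text \<open>Write z = f/p with p = u a = v b. The aim is a decomposition f = k a + g b in T/M, for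
  then z = k/u + g/v in T/J. Vanishing of the connecting value supplies g, and the remainder
  supplies k.\<close>

lemma connecting_eq_zeroD:
  assumes z: "z \<in> Arr SJ.Q" and 0: "connecting z = \<zero>\<^sub>M (src SJ.Q z) (susp T (tgt SJ.Q z))"
  obtains x y where "x \<in> Arr SU.Q" "src SU.Q x = src SJ.Q z" "tgt SU.Q x = tgt SJ.Q z"
    "y \<in> Arr SV.Q" "src SV.Q y = src SJ.Q z" "tgt SV.Q y = tgt SJ.Q z" "z = UJ.I x \<boxplus>\<^sub>J VJ.I y"
proof -
  obtain s f0 where s: "s \<in> cone_in T J" "f0 \<in> Arr T" "src T f0 = src T s" "z = SJ.cls s f0"
    "src SJ.Q z = tgt T s" "tgt SJ.Q z = tgt T f0" "s \<in> Arr T" using z by (rule SJ.Arr_quotE)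
  obtain j where j: "mixed (s \<cdot> j)" "j \<in> Arr T" "tgt T j = src T s" using s(1) by (rule mixed_cofinal)
  define p where "p = s \<cdot> j"
  define f where "f = f0 \<cdot> j"
  have p: "mixed p" "p \<in> Arr T" "src T p = src T j" "tgt T p = src SJ.Q z"
    using j s(5,7) by (simp_all add: p_def)
  have f: "f \<in> Arr T" "src T f = src T p" "tgt T f = tgt SJ.Q z" using j s(2,3,6,7) by (simp_all add: f_def p_def)
  have pJ: "p \<in> cone_in T J" using mixed_cone_in_J[OF p(1)] .
  have "j \<in> cone_in T J" using SJ.cone_in_cancel_left[OF _ s(1) j(2,3)] pJ by (simp add: p_def)
  then have zc: "z = SJ.cls p f" unfolding s(4) p_def f_def by (intro SJ.cls_refine[symmetric]) (use s(1-3) j in simp_all)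
  obtain q h where t: "(p, q, h) \<in> exact_tri T" using p(2) by (rule cone_ex)
  obtain u a v b where uv: "u \<in> cone_in T U" "a \<in> cone_in T V" "v \<in> cone_in T V" "b \<in> cone_in T U"
    "tgt T a = src T u" "tgt T b = src T v" "src T b = src T a" "tgt T v = tgt T u" "p = u \<cdot> a" "v \<cdot> b = u \<cdot> a"
    using p(1) by (rule mixedE)
  obtain a1 a2 v1 v2 c r where m: "(a, a1, a2) \<in> exact_tri T" "(v, v1, v2) \<in> exact_tri T"
    "c \<in> Arr T" "src T c = tgt T a1" "tgt T c = tgt T v1" "c \<cdot> a1 = v1 \<cdot> u" "v2 \<cdot> c = susp_arr T b \<cdot> a2"
    "r \<in> Arr SM.Q" "src SM.Q r = tgt T v1" "tgt SM.Q r = tgt T a1"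
    "r \<cdot>\<^sub>M SM.q c = ident SM.Q (tgt T a1)" "SM.q c \<cdot>\<^sub>M r = ident SM.Q (tgt T v1)"
    "connect q h = SM.q a2 \<cdot>\<^sub>M (r \<cdot>\<^sub>M SM.q v1)"
    by (rule connect_mixed[OF uv t])
  note A = uv(1,4)[THEN SU.cone_in_ArrD] uv(2,3)[THEN SV.cone_in_ArrD]
  note Xa = exactD[OF m(1)] and Xv = exactD[OF m(2)]
  have pa: "src T p = src T a" "tgt T u = src SJ.Q z" using p(4) uv(5,9) A by simp_all
  have fa: "src T f = src T a" using f(2) pa by simp
  \<comment> \<open>The connecting value is d v1 by the formula for mixed denominators; its
    vanishing makes d factor through v2.\<close>
  define d where "d = SM.q (susp_arr T f) \<cdot>\<^sub>M (SM.q a2 \<cdot>\<^sub>M r)"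
  have d: "d \<in> Arr SM.Q" "src SM.Q d = tgt T v1" "tgt SM.Q d = susp T (tgt T f)"
    using f(1) fa m(8-10) Xa by (simp_all add: d_def)
  have "d \<cdot>\<^sub>M SM.q v1 = connecting z"
    unfolding zc connecting_cls[OF t pJ f(1,2)] m(13) d_def using f(1) fa m(8-10) Xa Xv by simp
  then have "d \<cdot>\<^sub>M SM.q v1 = \<zero>\<^sub>M (src T v1) (tgt SM.Q d)"
    unfolding 0 using pa(2) uv(8) Xv d f(3) by simp
  then obtain g' where g': "g' \<in> Arr SM.Q" "src SM.Q g' = tgt T v2" "tgt SM.Q g' = tgt SM.Q d" "g' \<cdot>\<^sub>M SM.q v2 = d"
    by (rule SM.quot_weak_cokernel2[OF m(2) d(1,2)])
  have "SM.q (susp_arr T f) \<cdot>\<^sub>M SM.q a2 = SM.q (susp_arr T f) \<cdot>\<^sub>M (SM.q a2 \<cdot>\<^sub>M (r \<cdot>\<^sub>M SM.q c))"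
    unfolding m(11) using f(1) fa Xa by simp
  also have "\<dots> = d \<cdot>\<^sub>M SM.q c" unfolding d_def using f(1) fa Xa m(3-5,8-10) by simp
  also have "\<dots> = g' \<cdot>\<^sub>M SM.q (v2 \<cdot> c)" unfolding g'(4)[symmetric] using g'(1,2) m(3-5) Xv by simp
  also have "\<dots> = (g' \<cdot>\<^sub>M SM.q (susp_arr T b)) \<cdot>\<^sub>M SM.q a2"
    unfolding m(7) using g'(1,2) A uv(6,7) Xa Xv by simp
  finally have e: "SM.q (susp_arr T f) \<cdot>\<^sub>M SM.q a2 = (g' \<cdot>\<^sub>M SM.q (susp_arr T b)) \<cdot>\<^sub>M SM.q a2" .
  let ?gb = "g' \<cdot>\<^sub>M SM.q (susp_arr T b)"
  have gb: "?gb \<in> Arr SM.Q" "src SM.Q ?gb = susp T (src T a)" "tgt SM.Q ?gb = susp T (tgt T f)"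
    using g'(1-3) d A uv(6,7) Xv by simp_all
  \<comment> \<open>Removing the part that comes from b leaves a map that kills a2, hence one that
    factors through \<Sigma>a.\<close>
  let ?d = "SM.q (susp_arr T f) \<boxplus>\<^sub>M neg_arr SM.Q ?gb"
  have dd: "?d \<in> Arr SM.Q" "src SM.Q ?d = susp T (src T a)" "tgt SM.Q ?d = susp T (tgt T f)"
    using gb f(1) fa by (simp_all del: SM.Q.comp_assoc_Arr)
  have "?d \<cdot>\<^sub>M SM.q a2 = SM.q (susp_arr T f) \<cdot>\<^sub>M SM.q a2 \<boxplus>\<^sub>M neg_arr SM.Q (?gb \<cdot>\<^sub>M SM.q a2)"
    using SM.Q.comp_plus_dist_right[of "SM.q a2" "SM.q (susp_arr T f)" "neg_arr SM.Q ?gb"]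
      SM.Q.neg_comp[of "SM.q a2" ?gb] gb f(1) fa Xa by simp
  also have "\<dots> = \<zero>\<^sub>M (src T a2) (tgt SM.Q ?d)"
    unfolding e[symmetric] dd(3) using f(1) fa Xa by simp
  finally obtain k' where k': "k' \<in> Arr SM.Q" "src SM.Q k' = susp T (tgt T a)" "tgt SM.Q k' = tgt SM.Q ?d"
    "k' \<cdot>\<^sub>M SM.q (susp_arr T a) = ?d"
    by (rule SM.quot_weak_cokernel3[OF m(1) dd(1), rotated 1]) (use dd Xa in simp_all)
  \<comment> \<open>Both extensions live between suspended objects; desuspending them gives f = k a
    + g b.\<close>
  obtain g where g: "g \<in> Arr SM.Q" "src SM.Q g = tgt T b" "tgt SM.Q g = tgt T f" "g' = SM.susp_quot g"
    by (rule SM.susp_quot_full[of g' "tgt T b" "tgt T f"]) (use g' d A uv(6) Xv f(1) in simp_all)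
  obtain k where k: "k \<in> Arr SM.Q" "src SM.Q k = tgt T a" "tgt SM.Q k = tgt T f" "k' = SM.susp_quot k"
    by (rule SM.susp_quot_full[of k' "tgt T a" "tgt T f"]) (use k' dd A f(1) in simp_all)
  have "SM.susp_quot (k \<cdot>\<^sub>M SM.q a \<boxplus>\<^sub>M g \<cdot>\<^sub>M SM.q b) = k' \<cdot>\<^sub>M SM.q (susp_arr T a) \<boxplus>\<^sub>M ?gb"
    unfolding k(4) g(4) using k(1-3) g(1-3) A uv(7) by (simp add: SM.susp_quot_plus SM.susp_quot_comp SM.susp_q)
  also have "\<dots> = SM.susp_quot (SM.q f)"
    unfolding k'(4) using gb f(1) fa by (simp add: SM.susp_q)
  finally have "k \<cdot>\<^sub>M SM.q a \<boxplus>\<^sub>M g \<cdot>\<^sub>M SM.q b = SM.q f"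
    by (rule SM.susp_quot_faithful) (use k(1-3) g(1-3) A uv(7) f(1) fa in simp_all)
  then have "MJ.I (k \<cdot>\<^sub>M SM.q a \<boxplus>\<^sub>M g \<cdot>\<^sub>M SM.q b) = MJ.I (SM.q f)" by simp
  then have fJ: "MJ.I k \<cdot>\<^sub>J SJ.q a \<boxplus>\<^sub>J MJ.I g \<cdot>\<^sub>J SJ.q b = SJ.q f"
    using k(1-3) g(1-3) A uv(7) f(1) by simp
  obtain x where x: "x \<in> Arr SU.Q" "src SU.Q x = tgt T u" "tgt SU.Q x = tgt SU.Q (MU.I k)" "x \<cdot>\<^bsub>SU.Q\<^esub> SU.q u = MU.I k"
    by (rule SU.quot_divide[of "MU.I k" u]) (use k uv in simp_all)
  obtain y where y: "y \<in> Arr SV.Q" "src SV.Q y = tgt T v" "tgt SV.Q y = tgt SV.Q (MV.I g)" "y \<cdot>\<^bsub>SV.Q\<^esub> SV.q v = MV.I g"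
    by (rule SV.quot_divide[of "MV.I g" v]) (use g uv in simp_all)
  have x': "tgt SU.Q x = tgt T f" using x(3) k by simp
  have y': "tgt SV.Q y = tgt T f" using y(3) g by simp
  have xJ: "UJ.I x \<cdot>\<^sub>J SJ.q u = MJ.I k"
  proof -
    have "UJ.I (x \<cdot>\<^bsub>SU.Q\<^esub> SU.q u) = UJ.I (MU.I k)" by (simp only: x(4))
    then show ?thesis unfolding induced_induced(1)[OF k(1)] using x(1,2) A by simp
  qed
  have yJ: "VJ.I y \<cdot>\<^sub>J SJ.q v = MJ.I g"
  proof -
    have "VJ.I (y \<cdot>\<^bsub>SV.Q\<^esub> SV.q v) = VJ.I (MV.I g)" by (simp only: y(4))
    then show ?thesis unfolding induced_induced(2)[OF g(1)] using y(1,2) A by simp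
  qed
  have zxy: "z = UJ.I x \<boxplus>\<^sub>J VJ.I y"
  proof (rule SJ.Q.iso_cancel_right[OF SJ.q_iso[OF pJ]])
    have "(UJ.I x \<boxplus>\<^sub>J VJ.I y) \<cdot>\<^sub>J SJ.q p = UJ.I x \<cdot>\<^sub>J SJ.q (u \<cdot> a) \<boxplus>\<^sub>J VJ.I y \<cdot>\<^sub>J SJ.q (v \<cdot> b)"
      unfolding uv(10) uv(9)[symmetric] using x(1,2) x' y(1,2) y' uv(8) p(2,4) pa(2)
      by (simp add: SJ.Q.comp_plus_dist_right)
    also have "\<dots> = (UJ.I x \<cdot>\<^sub>J SJ.q u) \<cdot>\<^sub>J SJ.q a \<boxplus>\<^sub>J (VJ.I y \<cdot>\<^sub>J SJ.q v) \<cdot>\<^sub>J SJ.q b"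
      using x(1,2) y(1,2) A uv(5,6) by simp
    also have "\<dots> = SJ.q f" unfolding xJ yJ fJ ..
    also have "\<dots> = z \<cdot>\<^sub>J SJ.q p" unfolding zc by (rule SJ.cls_comp_q_self[OF pJ f(1,2), symmetric])
    finally show "z \<cdot>\<^sub>J SJ.q p = (UJ.I x \<boxplus>\<^sub>J VJ.I y) \<cdot>\<^sub>J SJ.q p" ..
  qed (use z p x(1,2) x' y(1,2) y' uv(8) pa(2) f(3) in simp_all)
  show thesis
    by (rule that[OF _ _ _ _ _ _ zxy]) (use x(1,2) x' y(1,2) y' uv(8) pa(2) f(3) in simp_all)
qed

text \<open>In T/V the projection vanishes because it factors through V. In T/U it becomes the
  identity because its complement factors through U, and what remains is h q = 0.\<close>

lemma induced_connecting:
  assumes "z \<in> Arr SJ.Q"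
  shows "MU.I (connecting z) = \<zero>\<^sub>U (src SJ.Q z) (susp T (tgt SJ.Q z))"
    and "MV.I (connecting z) = \<zero>\<^sub>V (src SJ.Q z) (susp T (tgt SJ.Q z))"
proof -
  obtain s f where s: "s \<in> cone_in T J" "f \<in> Arr T" "src T f = src T s" "z = SJ.cls s f"
    "src SJ.Q z = tgt T s" "tgt SJ.Q z = tgt T f" "s \<in> Arr T" using assms by (rule SJ.Arr_quotE)
  obtain q h where t: "(s, q, h) \<in> exact_tri T" using s(7) by (rule cone_ex)
  note X = exactD[OF t]
  have E: "tgt T q \<in> J" using SJ.cone_in_iff[OF t] s(1) by simp
  let ?e = "proj_V (tgt T q)"
  note e = splitsD[OF splits_proj_V[OF E]]
  have eV: "MV.I ?e = \<zero>\<^sub>V (tgt T q) (tgt T q)"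
  proof -
    obtain W g k where W: "W \<in> V" "g \<in> Hom SM.Q (src SM.Q ?e) W" "k \<in> Hom SM.Q W (tgt SM.Q ?e)" "?e = k \<cdot>\<^sub>M g"
      using e(5) unfolding factors_through_def by blast
    have g: "g \<in> Arr SM.Q" "src SM.Q g = tgt T q" "tgt SM.Q g = W" "k \<in> Arr SM.Q" "src SM.Q k = W" "tgt SM.Q k = tgt T q"
      using W(2,3) e(2,3) by (simp_all add: Hom_iff)
    have "MV.I k = \<zero>\<^sub>V W (tgt T q)" using SV.zero_if_through_S[of "MV.I k"] g W(1) by simp
    then show ?thesis unfolding W(4) using g e(4) by simp
  qed
  have eU: "MU.I ?e = ident SU.Q (tgt T q)"
  proof -
    let ?f = "ident SM.Q (tgt T q) \<boxplus>\<^sub>M neg_arr SM.Q ?e"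
    obtain W g k where W: "W \<in> U" "g \<in> Hom SM.Q (src SM.Q ?f) W" "k \<in> Hom SM.Q W (tgt SM.Q ?f)" "?f = k \<cdot>\<^sub>M g"
      using e(6) unfolding factors_through_def by blast
    have g: "g \<in> Arr SM.Q" "src SM.Q g = tgt T q" "tgt SM.Q g = W" "k \<in> Arr SM.Q" "src SM.Q k = W" "tgt SM.Q k = tgt T q"
      using W(2,3) e(1-4) by (simp_all add: Hom_iff)
    have k0: "MU.I k = \<zero>\<^sub>U W (tgt T q)" using SU.zero_if_through_S[of "MU.I k"] g W(1) by simp
    have "MU.I ?f = \<zero>\<^sub>U (tgt T q) (tgt T q)" unfolding W(4) using g e(4) k0 by simp
    then have "ident SU.Q (tgt T q) \<boxplus>\<^bsub>SU.Q\<^esub> neg_arr SU.Q (MU.I ?e) = \<zero>\<^sub>U (tgt T q) (tgt T q)"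
      using e(1-4) by simp
    then show ?thesis using SU.Q.diff_eq_zero_iff[of "ident SU.Q (tgt T q)" "MU.I ?e"] e(1-4) by simp
  qed
  have "MV.I (connect q h) = SV.q h \<cdot>\<^bsub>SV.Q\<^esub> (MV.I ?e \<cdot>\<^bsub>SV.Q\<^esub> SV.q q)"
    unfolding connect_def using e(1-4) X by simp
  then have V: "MV.I (connect q h) = \<zero>\<^sub>V (tgt T s) (susp T (src T s))"
    unfolding eV using X e(4) by simp
  have "MU.I (connect q h) = SU.q h \<cdot>\<^bsub>SU.Q\<^esub> (MU.I ?e \<cdot>\<^bsub>SU.Q\<^esub> SU.q q)"
    unfolding connect_def using e(1-4) X by simp
  also have "\<dots> = SU.q (h \<cdot> q)" unfolding eU using X e(4) by simp
  finally have U: "MU.I (connect q h) = \<zero>\<^sub>U (tgt T s) (susp T (src T s))"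
    unfolding exact_comp_zero2[OF t] using X by simp
  note c = connect_Arr[OF t s(1)]
  show "MU.I (connecting z) = \<zero>\<^sub>U (src SJ.Q z) (susp T (tgt SJ.Q z))"
    "MV.I (connecting z) = \<zero>\<^sub>V (src SJ.Q z) (susp T (tgt SJ.Q z))"
    unfolding s(5,6) unfolding s(4) connecting_cls[OF t s(1-3)] using c s(2,3,7) U V by simp_all
qed

text \<open>Vanishing in T/U and in T/V gives u and v, with cones in U and V, on which d becomes
  zero. Their Ore square is a mixed p, and d is lifted backwards through the formula for its
  connecting map: over v1, then over a2, and finally down one suspension.\<close>

lemma connecting_surj:
  assumes d: "d \<in> Arr SM.Q" "src SM.Q d = X" "tgt SM.Q d = susp T Y" "Y \<in> Ob T"
    and dU: "MU.I d = \<zero>\<^sub>U X (susp T Y)" and dV: "MV.I d = \<zero>\<^sub>V X (susp T Y)"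
  obtains z where "z \<in> Arr SJ.Q" "src SJ.Q z = X" "tgt SJ.Q z = Y" "connecting z = d"
proof -
  obtain m g where s: "m \<in> cone_in T (U \<inter> V)" "g \<in> Arr T" "src T g = src T m" "tgt T m = src SM.Q d" "tgt T g = tgt SM.Q d"
    "m \<in> Arr T" "d = SM.cls m g" "d \<cdot>\<^sub>M SM.q m = SM.q g" using d(1) by (rule SM.quot_right_fraction)
  have mUV: "m \<in> cone_in T U" "m \<in> cone_in T V" using s(1) cone_in_M_iff by auto
  have dt: "d \<cdot>\<^sub>M SM.q (m \<cdot> w) = \<zero>\<^sub>M (src T w) (susp T Y)"
    if w: "w \<in> Arr T" "tgt T w = src T g" "g \<cdot> w = \<zero> (src T w) (tgt T g)" for w
  proof -
    have "d \<cdot>\<^sub>M SM.q (m \<cdot> w) = (d \<cdot>\<^sub>M SM.q m) \<cdot>\<^sub>M SM.q w" using d(1) s(2-6) w(1,2) by simp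
    also have "\<dots> = SM.q (g \<cdot> w)" unfolding s(8) using s(2) w(1,2) by simp
    finally show ?thesis unfolding w(3) using w(1) s(5) d by simp
  qed
  have "SU.q g = \<zero>\<^sub>U (src T g) (tgt T g)"
    using SU.cls_eq_zero_iff[OF mUV(1) s(2,3)] dU s(4,5) d MU.induced_cls[OF s(1-3)] unfolding s(7) by simp
  then obtain w where w: "w \<in> cone_in T U" "tgt T w = src T g" "g \<cdot> w = \<zero> (src T w) (tgt T g)"
    using SU.q_eq_zero_iff_annihilated[OF s(2)] by blast
  have "SV.q g = \<zero>\<^sub>V (src T g) (tgt T g)"
    using SV.cls_eq_zero_iff[OF mUV(2) s(2,3)] dV s(4,5) d MV.induced_cls[OF s(1-3)] unfolding s(7) by simp
  then obtain w' where w': "w' \<in> cone_in T V" "tgt T w' = src T g" "g \<cdot> w' = \<zero> (src T w') (tgt T g)"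
    using SV.q_eq_zero_iff_annihilated[OF s(2)] by blast
  define u where "u = m \<cdot> w"
  define v where "v = m \<cdot> w'"
  have wA: "w \<in> Arr T" "w' \<in> Arr T" using w w' SU.cone_in_ArrD SV.cone_in_ArrD by auto
  have u: "u \<in> cone_in T U" "u \<in> Arr T" "tgt T u = X" using w mUV wA s(3,4,6) d by (simp_all add: u_def SU.cone_in_comp)
  have v: "v \<in> cone_in T V" "v \<in> Arr T" "tgt T v = X" using w' mUV wA s(3,4,6) d by (simp_all add: v_def SV.cone_in_comp)
  have du: "d \<cdot>\<^sub>M SM.q u = \<zero>\<^sub>M (src T u) (susp T Y)"
    using dt[OF wA(1) w(2,3)] wA w s(3,6) by (simp add: u_def del: SM.q_comp)
  have dv: "d \<cdot>\<^sub>M SM.q v = \<zero>\<^sub>M (src T v) (susp T Y)"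
    using dt[OF wA(2) w'(2,3)] wA w' s(3,6) by (simp add: v_def del: SM.q_comp)
  have uvX: "tgt T v = tgt T u" using u v by simp
  \<comment> \<open>One Ore square serves two thick subcategories: a inherits the cone condition of
    v, and b that of u.\<close>
  obtain a b where ab: "a \<in> Arr T" "b \<in> Arr T" "src T b = src T a" "tgt T a = src T u" "tgt T b = src T v" "v \<cdot> b = u \<cdot> a"
    "\<And>S. thick T S \<Longrightarrow> v \<in> cone_in T S \<Longrightarrow> a \<in> cone_in T S" "\<And>S. thick T S \<Longrightarrow> u \<in> cone_in T S \<Longrightarrow> b \<in> cone_in T S"
    using ore_right[OF v(2) u(2) uvX] by metis
  have abc: "a \<in> cone_in T V" "b \<in> cone_in T U" using ab(7)[OF thick_V v(1)] ab(8)[OF thick_U u(1)] by auto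
  define p where "p = u \<cdot> a"
  have p: "p \<in> Arr T" "src T p = src T a" "tgt T p = X" using u ab by (simp_all add: p_def)
  have pJ: "p \<in> cone_in T J" unfolding p_def by (rule mixed_cone_in_J[OF mixedI[OF u(1) abc(1) ab(4)]])
  obtain q h where t: "(p, q, h) \<in> exact_tri T" using p(1) by (rule cone_ex)
  obtain a1 a2 v1 v2 c r where m: "(a, a1, a2) \<in> exact_tri T" "(v, v1, v2) \<in> exact_tri T"
    "c \<in> Arr T" "src T c = tgt T a1" "tgt T c = tgt T v1" "c \<cdot> a1 = v1 \<cdot> u" "v2 \<cdot> c = susp_arr T b \<cdot> a2"
    "r \<in> Arr SM.Q" "src SM.Q r = tgt T v1" "tgt SM.Q r = tgt T a1"
    "r \<cdot>\<^sub>M SM.q c = ident SM.Q (tgt T a1)" "SM.q c \<cdot>\<^sub>M r = ident SM.Q (tgt T v1)"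
    "connect q h = SM.q a2 \<cdot>\<^sub>M (r \<cdot>\<^sub>M SM.q v1)"
    by (rule connect_mixed[OF u(1) abc(1) v(1) abc(2) ab(4,5,3) uvX p_def ab(6) t])
  note Xa = exactD[OF m(1)] and Xv = exactD[OF m(2)]
  obtain d' where d': "d' \<in> Arr SM.Q" "src SM.Q d' = tgt T v1" "tgt SM.Q d' = susp T Y" "d' \<cdot>\<^sub>M SM.q v1 = d"
    by (rule SM.quot_weak_cokernel[OF m(2) d(1)]) (use d v dv in simp_all)
  have "(d' \<cdot>\<^sub>M SM.q c) \<cdot>\<^sub>M SM.q a1 = d' \<cdot>\<^sub>M SM.q (c \<cdot> a1)" using d'(1,2) m(3-5) Xa by simp
  also have "\<dots> = (d' \<cdot>\<^sub>M SM.q v1) \<cdot>\<^sub>M SM.q u" unfolding m(6) using d'(1,2) u uvX Xv by simp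
  also have "\<dots> = \<zero>\<^sub>M (src T a1) (tgt SM.Q (d' \<cdot>\<^sub>M SM.q c))"
    unfolding d'(4) du using d'(1-3) m(3-5) Xa ab(4) by simp
  finally obtain k where k: "k \<in> Arr SM.Q" "src SM.Q k = tgt T a2" "tgt SM.Q k = tgt SM.Q (d' \<cdot>\<^sub>M SM.q c)"
    "k \<cdot>\<^sub>M SM.q a2 = d' \<cdot>\<^sub>M SM.q c"
    by (rule SM.quot_weak_cokernel2[OF m(1), rotated 2]) (use d'(1-3) m(3-5) Xa in simp_all)
  obtain x where x: "x \<in> Arr SM.Q" "src SM.Q x = src T a" "tgt SM.Q x = Y" "k = SM.susp_quot x"
    by (rule SM.susp_quot_full[of k "src T a" Y]) (use k d'(1-3) m(3-5) Xa d(4) in simp_all)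
  \<comment> \<open>x is only a morphism of T/M. Its denominator n is absorbed into p, and
    naturality relates the connecting maps of p and \<open>p \<cdot> n\<close>.\<close>
  obtain n f where nf: "n \<in> cone_in T (U \<inter> V)" "f \<in> Arr T" "src T f = src T n" "tgt T n = src SM.Q x" "tgt T f = tgt SM.Q x"
    "n \<in> Arr T" "x = SM.cls n f" "x \<cdot>\<^sub>M SM.q n = SM.q f" using x(1) by (rule SM.quot_right_fraction)
  have pn: "p \<cdot> n \<in> cone_in T J" "p \<cdot> n \<in> Arr T" "src T f = src T (p \<cdot> n)" "tgt T n = src T p"
    using pJ MJ.cone_in_mono[OF nf(1)] nf(3,4,6) x(2) p by (simp_all add: SJ.cone_in_comp)
  obtain q' h' where t': "(p \<cdot> n, q', h') \<in> exact_tri T" using pn(2) by (rule cone_ex)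
  have "SM.q (susp_arr T n) \<cdot>\<^sub>M connect q' h' = connect q h \<cdot>\<^sub>M SM.q (ident T X)"
    by (rule connect_natural[OF t pJ t' pn(1)]) (use nf(6) p pn(4) in auto)
  then have cn: "SM.q (susp_arr T n) \<cdot>\<^sub>M connect q' h' = connect q h"
    using connect_Arr[OF t pJ] p tgt_Ob[OF p(1)] by simp
  note C' = connect_Arr[OF t' pn(1)]
  have "connecting (SJ.cls (p \<cdot> n) f) = SM.q (susp_arr T f) \<cdot>\<^sub>M connect q' h'"
    by (rule connecting_cls[OF t' pn(1) nf(2) pn(3)])
  also have "\<dots> = SM.susp_quot (x \<cdot>\<^sub>M SM.q n) \<cdot>\<^sub>M connect q' h'"
    unfolding nf(8) using nf(2) by (simp add: SM.susp_q)
  also have "\<dots> = k \<cdot>\<^sub>M (SM.q (susp_arr T n) \<cdot>\<^sub>M connect q' h')"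
    unfolding x(4) using x(1) nf(4,6) C' pn p by (simp add: SM.susp_quot_comp SM.susp_q)
  also have "\<dots> = (k \<cdot>\<^sub>M SM.q a2) \<cdot>\<^sub>M (r \<cdot>\<^sub>M SM.q v1)"
    unfolding cn m(13) using k(1,2) m(8-10) Xa Xv by simp
  also have "\<dots> = d' \<cdot>\<^sub>M ((SM.q c \<cdot>\<^sub>M r) \<cdot>\<^sub>M SM.q v1)"
    unfolding k(4) using d'(1,2) m(3-5,8-10) Xv by simp
  also have "\<dots> = d" unfolding m(12) using d'(4) Xv by simp
  finally have fin: "connecting (SJ.cls (p \<cdot> n) f) = d" .
  show thesis
    by (rule that[OF _ _ _ fin]) (use pn nf(2,5,6) p x(3) in simp_all)
qed

text \<open>The task is to find w in T/M with w u = f and w v = g, where x = f/u and y = g/v.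
  Equality in T/J is first turned into honest equations u a = v b and f a = g b in T; then w is an
  extension of g along v plus a correction that vanishes on v.\<close>

lemma glue:
  assumes x: "x \<in> Arr SU.Q" "src SU.Q x = X" "tgt SU.Q x = Y" and y: "y \<in> Arr SV.Q" "src SV.Q y = X" "tgt SV.Q y = Y"
    and xy: "UJ.I x = VJ.I y"
  obtains w where "w \<in> Arr SM.Q" "src SM.Q w = X" "tgt SM.Q w = Y" "MU.I w = x" "MV.I w = y"
proof -
  obtain u0 f0 where u0: "u0 \<in> cone_in T U" "f0 \<in> Arr T" "src T f0 = src T u0" "x = SU.cls u0 f0"
    "src SU.Q x = tgt T u0" "tgt SU.Q x = tgt T f0" "u0 \<in> Arr T" using x(1) by (rule SU.Arr_quotE)
  obtain v0 g0 where v0: "v0 \<in> cone_in T V" "g0 \<in> Arr T" "src T g0 = src T v0" "y = SV.cls v0 g0"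
    "src SV.Q y = tgt T v0" "tgt SV.Q y = tgt T g0" "v0 \<in> Arr T" using y(1) by (rule SV.Arr_quotE)
  have ty: "tgt T u0 = X" "tgt T f0 = Y" "tgt T v0 = X" "tgt T g0 = Y" using u0(5,6) v0(5,6) x y by simp_all
  have uvX: "tgt T v0 = tgt T u0" using ty by simp
  obtain a0 b0 where ab: "a0 \<in> Arr T" "b0 \<in> Arr T" "src T b0 = src T a0" "tgt T a0 = src T u0" "tgt T b0 = src T v0" "v0 \<cdot> b0 = u0 \<cdot> a0"
    "\<And>S. thick T S \<Longrightarrow> v0 \<in> cone_in T S \<Longrightarrow> a0 \<in> cone_in T S" "\<And>S. thick T S \<Longrightarrow> u0 \<in> cone_in T S \<Longrightarrow> b0 \<in> cone_in T S"
    using ore_right[OF v0(7) u0(7) uvX] by metis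
  have abc: "a0 \<in> cone_in T V" "b0 \<in> cone_in T U" using ab(7)[OF thick_V v0(1)] ab(8)[OF thick_U u0(1)] by auto
  have aJ: "a0 \<in> cone_in T J" "b0 \<in> cone_in T J" using abc VJ.cone_in_mono UJ.cone_in_mono by auto
  have "SJ.cls u0 f0 = SJ.cls v0 g0"
    using xy unfolding u0(4) v0(4) UJ.induced_cls[OF u0(1-3)] VJ.induced_cls[OF v0(1-3)] .
  then have "SJ.cls u0 f0 \<cdot>\<^sub>J SJ.q (u0 \<cdot> a0) = SJ.cls v0 g0 \<cdot>\<^sub>J SJ.q (v0 \<cdot> b0)" unfolding ab(6) by simp
  then have "SJ.q (f0 \<cdot> a0) = SJ.q (g0 \<cdot> b0)"
    using SJ.cls_comp_q[OF UJ.cone_in_mono[OF u0(1)] u0(2,3) ab(1)] SJ.cls_comp_q[OF VJ.cone_in_mono[OF v0(1)] v0(2,3) ab(2)]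
      ab(4,5) u0(3) v0(3) by (simp del: SJ.q_comp)
  \<comment> \<open>k measures how far the numerators are from agreeing in T. It dies in T/J, so a
    morphism with cone in J kills it, and this morphism may be refined to a mixed p.\<close>
  moreover define k where "k = f0 \<cdot> a0 \<boxplus> neg_arr T (g0 \<cdot> b0)"
  ultimately have "SJ.q k = \<zero>\<^sub>J (src T k) (tgt T k)"
    using u0(2,3) v0(2,3) ab(1-5) ty by simp
  moreover have k: "k \<in> Arr T" "src T k = src T a0" "tgt T k = Y" using u0(2,3) v0(2,3) ab(1-5) ty by (simp_all add: k_def)
  ultimately obtain s where s: "s \<in> cone_in T J" "tgt T s = src T k" "k \<cdot> s = \<zero> (src T s) (tgt T k)"
    using SJ.q_eq_zero_iff_annihilated[OF k(1)] by blast
  obtain j where j: "mixed (s \<cdot> j)" "j \<in> Arr T" "tgt T j = src T s" using s(1) by (rule mixed_cofinal)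
  have sA: "s \<in> Arr T" using s(1) SJ.cone_in_ArrD by blast
  define p where "p = s \<cdot> j"
  have "Y \<in> Ob T" using tgt_Ob[OF k(1)] k(3) by simp
  then have p: "mixed p" "p \<in> Arr T" "tgt T p = src T a0" "k \<cdot> p = \<zero> (src T p) Y"
    using j sA s(2) k comp_reduce[OF s(3) j(2) sA k(1) j(3) s(2)] by (simp_all add: p_def)
  obtain u2 a2 v2 b2 where w: "u2 \<in> cone_in T U" "a2 \<in> cone_in T V" "v2 \<in> cone_in T V" "b2 \<in> cone_in T U"
    "tgt T a2 = src T u2" "tgt T b2 = src T v2" "src T b2 = src T a2" "tgt T v2 = tgt T u2" "p = u2 \<cdot> a2" "v2 \<cdot> b2 = u2 \<cdot> a2"
    using p(1) by (rule mixedE)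
  note W = w(1,4)[THEN SU.cone_in_ArrD] w(2,3)[THEN SV.cone_in_ArrD]
  have tp: "tgt T u2 = src T a0" "tgt T v2 = src T b0" using p(3) w(5,8,9) W ab(3) by simp_all
  \<comment> \<open>Composing with p = u2 a2 spoils the shape, since a0 u2 has its factors in the
    wrong order. After the swap u3 joins u0 and a3 joins a2, so the enlarged denominators have their
    cones in U and V again; the same is done for b0 and v2.\<close>
  obtain a3 u3 where c: "a3 \<in> cone_in T V" "u3 \<in> cone_in T U" "tgt T a3 = src T u3" "src T a3 = src T u2" "tgt T u3 = tgt T a0" "a0 \<cdot> u2 = u3 \<cdot> a3"
    by (rule swap_cones[OF thick_U thick_V factors_VU w(1) abc(1) tp(1)])
  have fVU: "factors_through T f (V \<inter> U)" if "f \<in> Arr T" "src T f \<in> U" "tgt T f \<in> V" for f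
    using factors_UV[OF that] by (simp add: Int_commute)
  obtain b3 v3 where e: "b3 \<in> cone_in T U" "v3 \<in> cone_in T V" "tgt T b3 = src T v3" "src T b3 = src T v2" "tgt T v3 = tgt T b0" "b0 \<cdot> v2 = v3 \<cdot> b3"
    by (rule swap_cones[OF thick_V thick_U fVU w(3) abc(2) tp(2)])
  note B = c(1)[THEN SV.cone_in_ArrD] c(2)[THEN SU.cone_in_ArrD] e(1)[THEN SU.cone_in_ArrD] e(2)[THEN SV.cone_in_ArrD]
  define u where "u = u0 \<cdot> u3"
  define v where "v = v0 \<cdot> v3"
  define a where "a = a3 \<cdot> a2"
  define b where "b = b3 \<cdot> b2"
  define f where "f = f0 \<cdot> u3"
  define g where "g = g0 \<cdot> v3"
  have uv: "u \<in> cone_in T U" "a \<in> cone_in T V" "v \<in> cone_in T V" "b \<in> cone_in T U"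
    using u0(1,7) v0(1,7) w(1-8) c(1-5) e(1-5) W B ab(4,5)
    by (simp_all add: u_def v_def a_def b_def SU.cone_in_comp SV.cone_in_comp)
  note A = uv(1,4)[THEN SU.cone_in_ArrD] uv(2,3)[THEN SV.cone_in_ArrD]
  have uvt: "tgt T a = src T u" "tgt T b = src T v" "src T b = src T a" "tgt T v = tgt T u" "tgt T u = X" "tgt T v = X" "src T a = src T p"
    using u0(7) v0(7) w(5-9) c(3-5) e(3-5) W B ab(4,5) ty by (simp_all add: u_def v_def a_def b_def)
  have fg: "f \<in> Arr T" "src T f = src T u" "tgt T f = Y" "g \<in> Arr T" "src T g = src T v" "tgt T g = Y"
    using u0(2,3,7) v0(2,3,7) B c(5) e(5) ab(4,5) ty by (simp_all add: f_def g_def u_def v_def)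
  have ap: "u3 \<cdot> a = a0 \<cdot> p"
    using comp_reduce[OF c(6)[symmetric], of a2] comp_reduce[OF refl, of a0 u2 a2] W B c(3-5) w(5,9) tp ab(1) by (simp add: a_def)
  have "v3 \<cdot> b = b0 \<cdot> (v2 \<cdot> b2)"
    using comp_reduce[OF e(6)[symmetric], of b2] W B e(3-5) w(6,9) tp ab(2) by (simp add: b_def)
  then have bp: "v3 \<cdot> b = b0 \<cdot> p" unfolding w(10) w(9)[symmetric] .
  have ua: "v \<cdot> b = u \<cdot> a"
  proof -
    have "v \<cdot> b = v0 \<cdot> (v3 \<cdot> b)" using v0(7) B A e(5) ab(5) uvt by (simp add: v_def)
    also have "\<dots> = (v0 \<cdot> b0) \<cdot> p" unfolding bp using v0(7) ab(1-5) p(2,3) by simp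
    also have "\<dots> = u0 \<cdot> (u3 \<cdot> a)" unfolding ab(6) ap using u0(7) ab(1-5) p(2,3) by simp
    also have "\<dots> = u \<cdot> a" using u0(7) B A c(5) ab(4) uvt by (simp add: u_def)
    finally show ?thesis .
  qed
  have fa: "f \<cdot> a = g \<cdot> b"
  proof -
    have 1: "f \<cdot> a = (f0 \<cdot> a0) \<cdot> p"
      using u0(2,3,7) B A c(5) ab(1-5) uvt ap p(2,3) by (simp add: f_def u_def)
    have 2: "g \<cdot> b = (g0 \<cdot> b0) \<cdot> p"
      using v0(2,3,7) B A e(5) ab(1-5) uvt bp p(2,3) by (simp add: g_def v_def)
    have "k \<cdot> p = (f0 \<cdot> a0) \<cdot> p \<boxplus> neg_arr T ((g0 \<cdot> b0) \<cdot> p)"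
      unfolding k_def using u0(2,3) v0(2,3) ab(1-5) ty p(2,3) by (simp add: comp_plus_dist_right neg_comp)
    then have z: "f \<cdot> a \<boxplus> neg_arr T (g \<cdot> b) = \<zero> (src T (f \<cdot> a)) (tgt T (f \<cdot> a))"
      unfolding 1[symmetric] 2[symmetric] p(4) using fg A uvt by simp
    show ?thesis by (rule diff_eq_zero_iff[THEN iffD1, OF _ _ _ _ z]) (use fg A uvt in simp_all)
  qed
  obtain q h where t: "(u \<cdot> a, q, h) \<in> exact_tri T" using A uvt cone_ex by (metis comp_Arr)
  obtain a1 a2' v1 v2' c r where m: "(a, a1, a2') \<in> exact_tri T" "(v, v1, v2') \<in> exact_tri T"
    "c \<in> Arr T" "src T c = tgt T a1" "tgt T c = tgt T v1" "c \<cdot> a1 = v1 \<cdot> u" "v2' \<cdot> c = susp_arr T b \<cdot> a2'"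
    "r \<in> Arr SM.Q" "src SM.Q r = tgt T v1" "tgt SM.Q r = tgt T a1"
    "r \<cdot>\<^sub>M SM.q c = ident SM.Q (tgt T a1)" "SM.q c \<cdot>\<^sub>M r = ident SM.Q (tgt T v1)"
    "connect q h = SM.q a2' \<cdot>\<^sub>M (r \<cdot>\<^sub>M SM.q v1)"
    by (rule connect_mixed[OF uv uvt(1-4) refl ua t])
  note Xa = exactD[OF m(1)] and Xv = exactD[OF m(2)]
  \<comment> \<open>g extends along v once \<Sigma>g v2' vanishes. Since c is invertible it suffices
    to compose with c: v2' c equals \<Sigma>b a2', then g b = f a, and \<Sigma>a a2' = 0.\<close>
  obtain w1 where w1: "w1 \<in> Arr SM.Q" "src SM.Q w1 = X" "tgt SM.Q w1 = Y" "w1 \<cdot>\<^sub>M SM.q v = SM.q g"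
  proof -
    have "SM.q (susp_arr T g) \<cdot>\<^sub>M (SM.q v2' \<cdot>\<^sub>M SM.q c) = SM.q (susp_arr T g \<cdot> (v2' \<cdot> c))"
      using fg uvt Xv m(3-5) by simp
    also have "\<dots> = SM.q (susp_arr T (g \<cdot> b) \<cdot> a2')" unfolding m(7) using fg uvt A Xa by simp
    also have "\<dots> = SM.q (susp_arr T f) \<cdot>\<^sub>M SM.q (susp_arr T a \<cdot> a2')" unfolding fa[symmetric] using fg uvt A Xa by simp
    also have "\<dots> = \<zero>\<^sub>M (tgt T a1) (susp T Y)" unfolding exact_comp_zero3[OF m(1)] using fg uvt A Xa by simp
    finally have z: "SM.q (susp_arr T g) \<cdot>\<^sub>M (SM.q v2' \<cdot>\<^sub>M SM.q c) = \<zero>\<^sub>M (tgt T a1) (susp T Y)" .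
    have Y: "Y \<in> Ob T" using fg by auto
    have "SM.q (susp_arr T g) \<cdot>\<^sub>M (SM.q v2' \<cdot>\<^sub>M (SM.q c \<cdot>\<^sub>M r)) =
        (SM.q (susp_arr T g) \<cdot>\<^sub>M (SM.q v2' \<cdot>\<^sub>M SM.q c)) \<cdot>\<^sub>M r"
      using fg uvt Xv m(3-5,8-10) by simp
    also have "\<dots> = \<zero>\<^sub>M (tgt T v1) (susp T Y)" unfolding z using m(8-10) Y by simp
    finally have z2: "SM.q (susp_arr T g) \<cdot>\<^sub>M SM.q v2' = \<zero>\<^sub>M (src T v2') (tgt SM.Q (SM.q (susp_arr T g)))"
      unfolding m(12) using fg uvt Xv by simp
    obtain y' where y': "y' \<in> Arr SM.Q" "src SM.Q y' = susp T (tgt T v)" "tgt SM.Q y' = tgt SM.Q (SM.q (susp_arr T g))"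
      "y' \<cdot>\<^sub>M SM.q (susp_arr T v) = SM.q (susp_arr T g)"
      by (rule SM.quot_weak_cokernel3[OF m(2) _ _ z2]) (use fg Xv in simp_all)
    obtain w1 where w1: "w1 \<in> Arr SM.Q" "src SM.Q w1 = X" "tgt SM.Q w1 = Y" "y' = SM.susp_quot w1"
      by (rule SM.susp_quot_full[of y' X Y]) (use y' fg uvt A Y in auto)
    have "SM.susp_quot (w1 \<cdot>\<^sub>M SM.q v) = SM.susp_quot (SM.q g)"
      using y'(4) w1 uvt A fg by (simp add: SM.susp_quot_comp SM.susp_q)
    then have "w1 \<cdot>\<^sub>M SM.q v = SM.q g"
      by (rule SM.susp_quot_faithful) (use w1 uvt A fg in simp_all)
    then show thesis using that w1 by blast
  qed
  \<comment> \<open>w1 need not restrict to f along u. The error vanishes on a, so it factors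
    through a1; by way of r and v1 this becomes a correction n that takes the error as its value on
    u and vanishes on v.\<close>
  let ?d = "SM.q f \<boxplus>\<^sub>M neg_arr SM.Q (w1 \<cdot>\<^sub>M SM.q u)"
  have dd: "?d \<in> Arr SM.Q" "src SM.Q ?d = src T u" "tgt SM.Q ?d = Y" using w1 fg uvt A by simp_all
  have "?d \<cdot>\<^sub>M SM.q a = SM.q (f \<cdot> a) \<boxplus>\<^sub>M neg_arr SM.Q (w1 \<cdot>\<^sub>M SM.q (u \<cdot> a))"
    using w1(1-3) fg uvt A by (simp add: SM.Q.comp_plus_dist_right SM.Q.neg_comp)
  also have "w1 \<cdot>\<^sub>M SM.q (u \<cdot> a) = (w1 \<cdot>\<^sub>M SM.q v) \<cdot>\<^sub>M SM.q b"
    unfolding ua[symmetric] using w1(1-3) uvt A by simp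
  also have "\<dots> = SM.q (f \<cdot> a)" unfolding w1(4) fa using fg uvt A by simp
  also have "SM.q (f \<cdot> a) \<boxplus>\<^sub>M neg_arr SM.Q (SM.q (f \<cdot> a)) = \<zero>\<^sub>M (src T a) (tgt SM.Q ?d)"
    unfolding dd(3) using fg uvt A by simp
  finally obtain k1 where k1: "k1 \<in> Arr SM.Q" "src SM.Q k1 = tgt T a1" "tgt SM.Q k1 = tgt SM.Q ?d" "k1 \<cdot>\<^sub>M SM.q a1 = ?d"
    by (rule SM.quot_weak_cokernel[OF m(1) dd(1), rotated 1]) (use dd(2) uvt in simp_all)
  define n where "n = (k1 \<cdot>\<^sub>M r) \<cdot>\<^sub>M SM.q v1"
  have n: "n \<in> Arr SM.Q" "src SM.Q n = X" "tgt SM.Q n = Y" using k1 dd m(8-10) Xv uvt by (simp_all add: n_def)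
  have nu: "n \<cdot>\<^sub>M SM.q u = ?d"
  proof -
    have "n \<cdot>\<^sub>M SM.q u = k1 \<cdot>\<^sub>M (r \<cdot>\<^sub>M SM.q (v1 \<cdot> u))"
      unfolding n_def using k1(1-3) m(8-10) Xv uvt A by simp
    also have "\<dots> = k1 \<cdot>\<^sub>M ((r \<cdot>\<^sub>M SM.q c) \<cdot>\<^sub>M SM.q a1)"
      unfolding m(6)[symmetric] using k1(1-3) m(3-5,8-10) Xa by simp
    also have "\<dots> = ?d" unfolding m(11) k1(4)[symmetric] using k1(1,2) Xa by simp
    finally show ?thesis .
  qed
  have nv: "n \<cdot>\<^sub>M SM.q v = \<zero>\<^sub>M (src T v) Y"
  proof -
    have "n \<cdot>\<^sub>M SM.q v = (k1 \<cdot>\<^sub>M r) \<cdot>\<^sub>M SM.q (v1 \<cdot> v)"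
      unfolding n_def using k1(1-3) m(8-10) Xv A by simp
    then show ?thesis unfolding exact_comp_zero1[OF m(2)] using k1(1-3) dd m(8-10) Xv A by simp
  qed
  define w where "w = n \<boxplus>\<^sub>M w1"
  have w: "w \<in> Arr SM.Q" "src SM.Q w = X" "tgt SM.Q w = Y" using n w1 by (simp_all add: w_def)
  have wv: "w \<cdot>\<^sub>M SM.q v = SM.q g"
    unfolding w_def using n w1 uvt A fg nv by (simp add: SM.Q.comp_plus_dist_right)
  have wu: "w \<cdot>\<^sub>M SM.q u = SM.q f"
    unfolding w_def using n w1(1-3) uvt A fg nu by (simp add: SM.Q.comp_plus_dist_right)
  have "MU.I (w \<cdot>\<^sub>M SM.q u) = MU.I (SM.q f)" by (simp only: wu)
  then have "MU.I w = SU.cls u f"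
    by (intro SU.cls_eq_if_comp_q) (use w uv uvt A fg in simp_all)
  also have "\<dots> = x" unfolding u0(4) u_def f_def by (rule SU.cls_refine) (use u0(1-3) c(2,5) B ab(4) in simp_all)
  finally have wx: "MU.I w = x" .
  have "MV.I (w \<cdot>\<^sub>M SM.q v) = MV.I (SM.q g)" by (simp only: wv)
  then have "MV.I w = SV.cls v g"
    by (intro SV.cls_eq_if_comp_q) (use w uv uvt A fg in simp_all)
  also have "\<dots> = y" unfolding v0(4) v_def g_def by (rule SV.cls_refine) (use v0(1-3) e(2,5) B ab(5) in simp_all)
  finally have wy: "MV.I w = y" .
  show thesis by (rule that[OF w wx wy])
qed

end

section \<open>The Mayer--Vietoris sequence\<close>

context triangulated_category
begin

lemma desusp:
  assumes "Y \<in> Ob T"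
  shows desusp_Ob: "desusp T Y \<in> Ob T"
    and susp_desusp_iso: "susp_desusp_iso T Y \<in> Hom T (susp T (desusp T Y)) Y \<and> is_iso T (susp_desusp_iso T Y)"
proof -
  have "\<exists>X. X \<in> Ob T \<and> (\<exists>e \<in> Hom T (susp T X) Y. is_iso T e)" using susp_ess_surj[OF assms] by blast
  then have 1: "desusp T Y \<in> Ob T \<and> (\<exists>e \<in> Hom T (susp T (desusp T Y)) Y. is_iso T e)"
    unfolding desusp_def by (rule someI_ex)
  then show "desusp T Y \<in> Ob T" by blast
  have "\<exists>e. e \<in> Hom T (susp T (desusp T Y)) Y \<and> is_iso T e" using 1 by blast
  then show "susp_desusp_iso T Y \<in> Hom T (susp T (desusp T Y)) Y \<and> is_iso T (susp_desusp_iso T Y)"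
    unfolding susp_desusp_iso_def by (rule someI_ex)
qed

lemma shift_Ob: assumes "Y \<in> Ob T" shows "shift T n Y \<in> Ob T"
proof -
  have "(susp T ^^ k) Y \<in> Ob T" "(desusp T ^^ k) Y \<in> Ob T" for k
    by (induction k) (simp_all add: assms desusp_Ob)
  then show ?thesis by (simp add: shift_def)
qed

lemma shift_iso:
  assumes "Y \<in> Ob T"
  shows "shift_iso T n Y \<in> Hom T (susp T (shift T n Y)) (shift T (n + 1) Y)" "is_iso T (shift_iso T n Y)"
proof -
  have "shift_iso T n Y \<in> Hom T (susp T (shift T n Y)) (shift T (n + 1) Y) \<and> is_iso T (shift_iso T n Y)"
  proof (cases "n \<ge> 0")
    case True
    then have "nat (n + 1) = Suc (nat n)" by simp
    then have "susp T (shift T n Y) = shift T (n + 1) Y" using True by (simp add: shift_def)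
    then show ?thesis using True shift_Ob[OF assms, of "n + 1"] by (simp add: shift_iso_def Hom_iff)
  next
    case False
    then have "nat (- n) = Suc (nat (- (n + 1)))" by simp
    then have "shift T n Y = desusp T ((desusp T ^^ nat (- (n + 1))) Y)" using False by (simp add: shift_def)
    \<comment> \<open>For n = -1 the index n + 1 = 0 already belongs to the branch of nonnegative
      powers, so this case is treated apart.\<close>
    also have "(desusp T ^^ nat (- (n + 1))) Y = shift T (n + 1) Y"
      using False by (cases "n = - 1") (simp_all add: shift_def)
    finally show ?thesis
      using False susp_desusp_iso[OF shift_Ob[OF assms, of "n + 1"]] by (simp add: shift_iso_def)
  qed
  then show "shift_iso T n Y \<in> Hom T (susp T (shift T n Y)) (shift T (n + 1) Y)" "is_iso T (shift_iso T n Y)"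
    by auto
qed

end

lemma comm_group_DirProd:
  assumes "comm_group G" "comm_group H" shows "comm_group (G \<times>\<times> H)"
proof -
  interpret G: comm_group G by fact
  interpret H: comm_group H by fact
  interpret GH: group "G \<times>\<times> H" by (rule DirProd_group) unfold_locales
  show ?thesis by (rule GH.group_comm_groupI) (auto simp: G.m_comm H.m_comm)
qed

context thick_pair
begin

lemma mv_restrict_hom:
  "mv_restrict T U V \<in> hom (hom_group SM.Q X Y) (hom_group SU.Q X Y \<times>\<times> hom_group SV.Q X Y)"
  by (auto simp: hom_def mv_restrict_def Hom_iff)

lemma mv_diff_hom:
  "mv_diff T U V \<in> hom (hom_group SU.Q X Y \<times>\<times> hom_group SV.Q X Y) (hom_group SJ.Q X Y)"
proof (rule homI)
  fix x y assume "x \<in> carrier (hom_group SU.Q X Y \<times>\<times> hom_group SV.Q X Y)"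
    "y \<in> carrier (hom_group SU.Q X Y \<times>\<times> hom_group SV.Q X Y)"
  moreover obtain a b c d where e: "x = (a, b)" "y = (c, d)" by (cases x, cases y) auto
  ultimately have ty: "a \<in> Arr SU.Q" "src SU.Q a = X" "tgt SU.Q a = Y" "c \<in> Arr SU.Q" "src SU.Q c = X" "tgt SU.Q c = Y"
    "b \<in> Arr SV.Q" "src SV.Q b = X" "tgt SV.Q b = Y" "d \<in> Arr SV.Q" "src SV.Q d = X" "tgt SV.Q d = Y"
    by (simp_all add: Hom_iff)
  have n: "neg_arr SJ.Q (VJ.I b \<boxplus>\<^sub>J VJ.I d) = neg_arr SJ.Q (VJ.I b) \<boxplus>\<^sub>J neg_arr SJ.Q (VJ.I d)"
  proof (rule SJ.Q.neg_eqI)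
    have "VJ.I b \<boxplus>\<^sub>J VJ.I d \<boxplus>\<^sub>J (neg_arr SJ.Q (VJ.I b) \<boxplus>\<^sub>J neg_arr SJ.Q (VJ.I d)) =
       (VJ.I b \<boxplus>\<^sub>J neg_arr SJ.Q (VJ.I b)) \<boxplus>\<^sub>J (VJ.I d \<boxplus>\<^sub>J neg_arr SJ.Q (VJ.I d))"
      using ty by (simp only: SJ.Q.plus_ac VJ.induced_Arr VJ.src_induced VJ.tgt_induced SJ.Q.neg_Arr SJ.Q.src_neg SJ.Q.tgt_neg
          SJ.Q.plus_Arr SJ.Q.src_plus SJ.Q.tgt_plus)
    then show "VJ.I b \<boxplus>\<^sub>J VJ.I d \<boxplus>\<^sub>J (neg_arr SJ.Q (VJ.I b) \<boxplus>\<^sub>J neg_arr SJ.Q (VJ.I d)) =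
        \<zero>\<^sub>J (src SJ.Q (VJ.I b \<boxplus>\<^sub>J VJ.I d)) (tgt SJ.Q (VJ.I b \<boxplus>\<^sub>J VJ.I d))"
      using ty SV.src_quot_Ob[OF ty(7)] SV.tgt_quot_Ob[OF ty(7)] by simp
  qed (use ty in simp_all)
  have "mv_diff T U V (a \<boxplus>\<^bsub>SU.Q\<^esub> c, b \<boxplus>\<^bsub>SV.Q\<^esub> d) = mv_diff T U V (a, b) \<boxplus>\<^sub>J mv_diff T U V (c, d)"
    unfolding mv_diff_def prod.case using ty
    by (simp add: n) (simp only: SJ.Q.plus_ac VJ.induced_Arr VJ.src_induced VJ.tgt_induced UJ.induced_Arr UJ.src_induced
        UJ.tgt_induced SJ.Q.neg_Arr SJ.Q.src_neg SJ.Q.tgt_neg SJ.Q.plus_Arr SJ.Q.src_plus SJ.Q.tgt_plus)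
  then show "mv_diff T U V (x \<otimes>\<^bsub>hom_group SU.Q X Y \<times>\<times> hom_group SV.Q X Y\<^esub> y) =
      mv_diff T U V x \<otimes>\<^bsub>hom_group SJ.Q X Y\<^esub> mv_diff T U V y"
    unfolding e by simp
next
  fix x assume "x \<in> carrier (hom_group SU.Q X Y \<times>\<times> hom_group SV.Q X Y)"
  then show "mv_diff T U V x \<in> carrier (hom_group SJ.Q X Y)"
    by (auto simp: mv_diff_def Hom_iff)
qed

lemma mv_diff_eq_zero_iff:
  assumes "x \<in> Hom SU.Q X Y" "y \<in> Hom SV.Q X Y"
  shows "mv_diff T U V (x, y) = \<zero>\<^sub>J X Y \<longleftrightarrow> UJ.I x = VJ.I y"
  using SJ.Q.diff_eq_zero_iff[of "UJ.I x" "VJ.I y"] assms unfolding mv_diff_def Hom_iff by simp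

lemma commuting_if_exact:
  assumes ex: "\<And>X Y. \<lbrakk>X \<in> Ob T; Y \<in> Ob T\<rbrakk> \<Longrightarrow> mayer_vietoris_exact T U V \<delta> X Y"
  shows "commuting_pair T U V"
proof -
  have "factors_through T f (U \<inter> V)" if f: "f \<in> Hom T X Y" and XY: "X \<in> U \<and> Y \<in> V \<or> X \<in> V \<and> Y \<in> U" for f X Y
  proof -
    have ob: "X \<in> Ob T" "Y \<in> Ob T" using XY by auto
    have fA: "f \<in> Arr T" "src T f = X" "tgt T f = Y" using f by (simp_all add: Hom_iff)
    \<comment> \<open>The connecting map with index -1 is the one that ends in degree 0, that is, in
      Hom(X, Y) itself.\<close>
    define D where "D = (\<lambda>x. SM.q (shift_iso T (- 1) Y) \<cdot>\<^sub>M \<delta> X (shift T (- 1) Y) x)"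
    let ?C = "hom_group SJ.Q X (shift T (- 1) Y)"
    have [simp]: "shift T 0 Y = Y" by (simp add: shift_def)
    have "long_exact
       (\<lambda>n. hom_group SM.Q X (shift T n Y))
       (\<lambda>n. hom_group SU.Q X (shift T n Y) \<times>\<times> hom_group SV.Q X (shift T n Y))
       (\<lambda>n. hom_group SJ.Q X (shift T n Y))
       (\<lambda>n. mv_restrict T U V) (\<lambda>n. mv_diff T U V)
       (\<lambda>n x. SM.q (shift_iso T n Y) \<cdot>\<^sub>M \<delta> X (shift T n Y) x)"
      using ex[OF ob] unfolding mayer_vietoris_exact_def .
    from this[unfolded long_exact_def, rule_format, of "- 1"]
    have D: "D \<in> hom ?C (hom_group SM.Q X Y)"
      and im: "D ` carrier ?C = kernel (hom_group SM.Q X Y) (hom_group SU.Q X Y \<times>\<times> hom_group SV.Q X Y) (mv_restrict T U V)"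
      by (simp_all add: D_def)
    have "SU.q f = \<zero>\<^sub>U X Y" "SV.q f = \<zero>\<^sub>V X Y"
      using SU.zero_if_through_S[of "SU.q f"] SV.zero_if_through_S[of "SV.q f"] fA XY by auto
    then have "SM.q f \<in> D ` carrier ?C"
      unfolding im kernel_def mv_restrict_def using fA by (simp add: Hom_iff)
    then obtain z where z: "z \<in> Hom SJ.Q X (shift T (- 1) Y)" "SM.q f = D z" by auto
    have Y': "shift T (- 1) Y \<in> Ob T" by (rule shift_Ob[OF ob(2)])
    \<comment> \<open>Reading the vanishing off from X covers morphisms in both directions at
      once.\<close>
    have "X \<in> J" using XY U_sub_J V_sub_J by auto
    then have z0: "z = \<zero>\<^sub>J X (shift T (- 1) Y)" using SJ.zero_if_through_S[of z] z(1) by (simp add: Hom_iff)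
    have "D (z \<boxplus>\<^sub>J z) = D z \<boxplus>\<^sub>M D z" using D z(1) by (simp add: hom_def)
    then have "SM.q f \<boxplus>\<^sub>M SM.q f = SM.q f" using z(2) z0 ob Y' by simp
    then have "SM.q f = \<zero>\<^sub>M X Y" using SM.Q.idempotent_zero[of "SM.q f"] fA by simp
    then show ?thesis using SM.q_eq_zero_iff[of f] fA by simp
  qed
  then show ?thesis unfolding commuting_pair_def by blast
qed

end

section \<open>Assembling the sequence for a commuting pair\<close>

context commuting_thick_pair
begin

lemma mv_exact_restrict:
  "mv_restrict T U V ` Hom SM.Q X Y =
    kernel (hom_group SU.Q X Y \<times>\<times> hom_group SV.Q X Y) (hom_group SJ.Q X Y) (mv_diff T U V)"
proof (intro equalityI subsetI)
  fix z assume "z \<in> mv_restrict T U V ` Hom SM.Q X Y"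
  then obtain w where w: "w \<in> Hom SM.Q X Y" "z = (MU.I w, MV.I w)" by (auto simp: mv_restrict_def)
  have "MU.I w \<in> Hom SU.Q X Y" "MV.I w \<in> Hom SV.Q X Y" "w \<in> Arr SM.Q" using w(1) by (simp_all add: Hom_iff)
  then show "z \<in> kernel (hom_group SU.Q X Y \<times>\<times> hom_group SV.Q X Y) (hom_group SJ.Q X Y) (mv_diff T U V)"
    unfolding kernel_def w(2) using mv_diff_eq_zero_iff[of "MU.I w" X Y "MV.I w"] induced_induced[of w] by simp
next
  fix z assume "z \<in> kernel (hom_group SU.Q X Y \<times>\<times> hom_group SV.Q X Y) (hom_group SJ.Q X Y) (mv_diff T U V)"
  then obtain x y where z: "z = (x, y)" "x \<in> Hom SU.Q X Y" "y \<in> Hom SV.Q X Y" "mv_diff T U V (x, y) = \<zero>\<^sub>J X Y"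
    by (auto simp: kernel_def)
  have e: "UJ.I x = VJ.I y" using z mv_diff_eq_zero_iff by blast
  have ty: "x \<in> Arr SU.Q" "src SU.Q x = X" "tgt SU.Q x = Y" "y \<in> Arr SV.Q" "src SV.Q y = X" "tgt SV.Q y = Y"
    using z(2,3) by (simp_all add: Hom_iff)
  obtain w where w: "w \<in> Arr SM.Q" "src SM.Q w = X" "tgt SM.Q w = Y" "MU.I w = x" "MV.I w = y"
    by (rule glue[OF ty e])
  show "z \<in> mv_restrict T U V ` Hom SM.Q X Y"
    by (rule image_eqI[of _ _ w]) (use w z(1) in \<open>simp_all add: mv_restrict_def Hom_iff\<close>)
qed

lemma mv_exact_connecting:
  "mv_diff T U V ` (Hom SU.Q X Y \<times> Hom SV.Q X Y) = {z \<in> Hom SJ.Q X Y. connecting z = \<zero>\<^sub>M X (susp T Y)}"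
proof (intro equalityI subsetI)
  fix z assume "z \<in> mv_diff T U V ` (Hom SU.Q X Y \<times> Hom SV.Q X Y)"
  then obtain x y where z: "z = UJ.I x \<boxplus>\<^sub>J neg_arr SJ.Q (VJ.I y)"
    and ty: "x \<in> Arr SU.Q" "src SU.Q x = X" "tgt SU.Q x = Y" "y \<in> Arr SV.Q" "src SV.Q y = X" "tgt SV.Q y = Y"
    by (auto simp: mv_diff_def Hom_iff)
  have ob: "X \<in> Ob T" "Y \<in> Ob T" using SU.src_quot_Ob[OF ty(1)] SU.tgt_quot_Ob[OF ty(1)] ty by simp_all
  show "z \<in> {z \<in> Hom SJ.Q X Y. connecting z = \<zero>\<^sub>M X (susp T Y)}"
    unfolding z using ty ob
    by (simp add: Hom_iff connecting_plus connecting_neg induced_connecting_U induced_connecting_V)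
next
  fix z assume "z \<in> {z \<in> Hom SJ.Q X Y. connecting z = \<zero>\<^sub>M X (susp T Y)}"
  then have z: "z \<in> Arr SJ.Q" "src SJ.Q z = X" "tgt SJ.Q z = Y"
    "connecting z = \<zero>\<^sub>M (src SJ.Q z) (susp T (tgt SJ.Q z))" by (simp_all add: Hom_iff)
  obtain x y where x: "x \<in> Arr SU.Q" "src SU.Q x = src SJ.Q z" "tgt SU.Q x = tgt SJ.Q z"
    and y: "y \<in> Arr SV.Q" "src SV.Q y = src SJ.Q z" "tgt SV.Q y = tgt SJ.Q z" and e: "z = UJ.I x \<boxplus>\<^sub>J VJ.I y"
    using z(1,4) by (rule connecting_eq_zeroD)
  show "z \<in> mv_diff T U V ` (Hom SU.Q X Y \<times> Hom SV.Q X Y)"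
  proof (rule image_eqI)
    \<comment> \<open>The decomposition of z is a sum while the map is a difference; hence the sign
      on y.\<close>
    show "z = mv_diff T U V (x, neg_arr SV.Q y)" using e y(1) by (simp add: mv_diff_def)
    show "(x, neg_arr SV.Q y) \<in> Hom SU.Q X Y \<times> Hom SV.Q X Y" using x y z(2,3) by (simp add: Hom_iff)
  qed
qed

lemma mv_exact_induced:
  assumes "Y \<in> Ob T"
  shows "connecting ` Hom SJ.Q X Y =
    {d \<in> Hom SM.Q X (susp T Y). mv_restrict T U V d = (\<zero>\<^sub>U X (susp T Y), \<zero>\<^sub>V X (susp T Y))}"
proof (intro equalityI subsetI)
  fix d assume "d \<in> connecting ` Hom SJ.Q X Y"
  then obtain z where "z \<in> Arr SJ.Q" "src SJ.Q z = X" "tgt SJ.Q z = Y" "d = connecting z" by (auto simp: Hom_iff)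
  then show "d \<in> {d \<in> Hom SM.Q X (susp T Y). mv_restrict T U V d = (\<zero>\<^sub>U X (susp T Y), \<zero>\<^sub>V X (susp T Y))}"
    by (simp add: Hom_iff mv_restrict_def induced_connecting)
next
  fix d assume "d \<in> {d \<in> Hom SM.Q X (susp T Y). mv_restrict T U V d = (\<zero>\<^sub>U X (susp T Y), \<zero>\<^sub>V X (susp T Y))}"
  then have d: "d \<in> Arr SM.Q" "src SM.Q d = X" "tgt SM.Q d = susp T Y"
    "MU.I d = \<zero>\<^sub>U X (susp T Y)" "MV.I d = \<zero>\<^sub>V X (susp T Y)"
    by (simp_all add: Hom_iff mv_restrict_def)
  obtain z where z: "z \<in> Arr SJ.Q" "src SJ.Q z = X" "tgt SJ.Q z = Y" "connecting z = d"
    by (rule connecting_surj[OF d(1-3) assms d(4,5)])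
  show "d \<in> connecting ` Hom SJ.Q X Y"
    by (rule image_eqI[of _ _ z]) (use z in \<open>simp_all add: Hom_iff\<close>)
qed

lemma connecting_hom: "connecting \<in> hom (hom_group SJ.Q X Y) (hom_group SM.Q X (susp T Y))"
  by (auto simp: hom_def Hom_iff connecting_plus)

lemma natural_connecting: "natural_connecting T U V (\<lambda>X Y. connecting)"
  unfolding natural_connecting_def Let_def
  using connecting_hom connecting_natural by (auto simp: Hom_iff)

lemma mayer_vietoris: 
  assumes X: "X \<in> Ob T" and Y: "Y \<in> Ob T"
  shows "mayer_vietoris_exact T U V (\<lambda>X Y. connecting) X Y"
  unfolding mayer_vietoris_exact_def long_exact_def
proof (intro allI conjI)
  fix n
  define Y' where "Y' = shift T n Y"
  define Z where "Z = shift T (n + 1) Y"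
  define i where "i = shift_iso T n Y"
  have ob: "Y' \<in> Ob T" "Z \<in> Ob T" unfolding Y'_def Z_def using shift_Ob[OF Y] by auto
  have i: "i \<in> Arr T" "src T i = susp T Y'" "tgt T i = Z" "is_iso T i"
    using shift_iso[OF Y, of n] unfolding i_def Y'_def Z_def Hom_iff by auto
  obtain j where j: "j \<in> Arr T" "src T j = Z" "tgt T j = susp T Y'" "j \<cdot> i = ident T (susp T Y')" "i \<cdot> j = ident T Z"
    using is_isoE[OF i(4)] i(2,3) by metis
  let ?D = "\<lambda>x. SM.q i \<cdot>\<^sub>M connecting x"
  show "comm_group (hom_group SM.Q X (shift T n Y))" "comm_group (hom_group SJ.Q X (shift T n Y))"
    using SM.comm_group_hom_quot[OF X] SJ.comm_group_hom_quot[OF X] shift_Ob[OF Y] by auto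
  show "comm_group (hom_group SU.Q X (shift T n Y) \<times>\<times> hom_group SV.Q X (shift T n Y))"
    using SU.comm_group_hom_quot[OF X] SV.comm_group_hom_quot[OF X] shift_Ob[OF Y] by (intro comm_group_DirProd) auto
  show "mv_restrict T U V \<in> hom (hom_group SM.Q X (shift T n Y)) (hom_group SU.Q X (shift T n Y) \<times>\<times> hom_group SV.Q X (shift T n Y))"
    by (rule mv_restrict_hom)
  show "mv_diff T U V \<in> hom (hom_group SU.Q X (shift T n Y) \<times>\<times> hom_group SV.Q X (shift T n Y)) (hom_group SJ.Q X (shift T n Y))"
    by (rule mv_diff_hom)
  have "?D \<in> hom (hom_group SJ.Q X Y') (hom_group SM.Q X Z)"
    using i(1-3) by (auto simp: hom_def Hom_iff connecting_plus SM.Q.comp_plus_dist_left)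
  then show "(\<lambda>x. SM.q (shift_iso T n Y) \<cdot>\<^sub>M connecting x) \<in> hom (hom_group SJ.Q X (shift T n Y)) (hom_group SM.Q X (shift T (n + 1) Y))"
    unfolding Y'_def Z_def i_def .
  show "mv_restrict T U V ` carrier (hom_group SM.Q X (shift T n Y)) =
      kernel (hom_group SU.Q X (shift T n Y) \<times>\<times> hom_group SV.Q X (shift T n Y)) (hom_group SJ.Q X (shift T n Y)) (mv_diff T U V)"
    using mv_exact_restrict by simp
  \<comment> \<open>i is an isomorphism, so composing with it does not change the kernel.\<close>
  have Di: "?D x = \<zero>\<^sub>M X Z \<longleftrightarrow> connecting x = \<zero>\<^sub>M X (susp T Y')" if "x \<in> Hom SJ.Q X Y'" for x
  proof
    assume "?D x = \<zero>\<^sub>M X Z"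
    then show "connecting x = \<zero>\<^sub>M X (susp T Y')"
      using SM.Q.iso_cancel_left[OF SM.q_iso[OF SM.cone_in_iso[OF i(4)]], of "connecting x" "\<zero>\<^sub>M X (susp T Y')"]
        that i(1-3) X ob by (simp add: Hom_iff)
  qed (use that i(1-3) X ob in \<open>simp add: Hom_iff\<close>)
  have "mv_diff T U V ` (Hom SU.Q X Y' \<times> Hom SV.Q X Y') = {z \<in> Hom SJ.Q X Y'. ?D z = \<zero>\<^sub>M X Z}"
    unfolding mv_exact_connecting using Di by blast
  then show "mv_diff T U V ` carrier (hom_group SU.Q X (shift T n Y) \<times>\<times> hom_group SV.Q X (shift T n Y)) =
      kernel (hom_group SJ.Q X (shift T n Y)) (hom_group SM.Q X (shift T (n + 1) Y))
       (\<lambda>x. SM.q (shift_iso T n Y) \<cdot>\<^sub>M connecting x)"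
    unfolding Y'_def Z_def i_def kernel_def by simp
  let ?K = "\<lambda>Y. {d \<in> Hom SM.Q X Y. mv_restrict T U V d = (\<zero>\<^sub>U X Y, \<zero>\<^sub>V X Y)}"
  have "?D ` Hom SJ.Q X Y' = ?K Z"
  proof (intro equalityI subsetI)
    fix d assume "d \<in> ?D ` Hom SJ.Q X Y'"
    then obtain z where z: "z \<in> Hom SJ.Q X Y'" "d = ?D z" by blast
    then have "connecting z \<in> ?K (susp T Y')" using mv_exact_induced[OF ob(1), of X] by blast
    then have "connecting z \<in> Arr SM.Q" "src SM.Q (connecting z) = X" "tgt SM.Q (connecting z) = susp T Y'"
      "MU.I (connecting z) = \<zero>\<^sub>U X (susp T Y')" "MV.I (connecting z) = \<zero>\<^sub>V X (susp T Y')"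
      by (simp_all add: Hom_iff mv_restrict_def)
    then show "d \<in> ?K Z" unfolding z(2) using i(1-3) X by (simp add: Hom_iff mv_restrict_def)
  next
    fix d assume "d \<in> ?K Z"
    then have d: "d \<in> Arr SM.Q" "src SM.Q d = X" "tgt SM.Q d = Z" "MU.I d = \<zero>\<^sub>U X Z" "MV.I d = \<zero>\<^sub>V X Z"
      by (simp_all add: Hom_iff mv_restrict_def)
    \<comment> \<open>An element in degree n + 1 is carried back along the inverse j of i to the
      suspension of the n-th shift, where exactness is known.\<close>
    have "SM.q j \<cdot>\<^sub>M d \<in> ?K (susp T Y')" using d j(1-3) X by (simp add: Hom_iff mv_restrict_def)
    then obtain z where z: "z \<in> Hom SJ.Q X Y'" "SM.q j \<cdot>\<^sub>M d = connecting z"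
      using mv_exact_induced[OF ob(1), of X] by blast
    have "?D z = SM.q (i \<cdot> j) \<cdot>\<^sub>M d" unfolding z(2)[symmetric] using i(1-3) j(1-3) d by simp
    then have "d = ?D z" unfolding j(5) using d ob by simp
    then show "d \<in> ?D ` Hom SJ.Q X Y'" using z(1) by blast
  qed
  then show "(\<lambda>x. SM.q (shift_iso T n Y) \<cdot>\<^sub>M connecting x) ` carrier (hom_group SJ.Q X (shift T n Y)) =
      kernel (hom_group SM.Q X (shift T (n + 1) Y))
       (hom_group SU.Q X (shift T (n + 1) Y) \<times>\<times> hom_group SV.Q X (shift T (n + 1) Y)) (mv_restrict T U V)"
    unfolding Y'_def Z_def i_def kernel_def by simp
qed

end

theorem theorem1:
  fixes T :: "('o, 'm) tri_struct"
    and U V :: "'o set"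
  assumes "triangulated_category T"
    and "thick T U"
    and "thick T V"
  shows "commuting_pair T U V \<longleftrightarrow>
    (\<exists>\<delta>. natural_connecting T U V \<delta> \<and>
         (\<forall>X \<in> Ob T. \<forall>Y \<in> Ob T. mayer_vietoris_exact T U V \<delta> X Y))"
proof -
  interpret thick_pair T U V
    using assms by (simp add: thick_pair_def thick_pair_axioms_def)
  show ?thesis
  proof
    assume "commuting_pair T U V"
    then interpret commuting_thick_pair T U V by unfold_locales
    show "\<exists>\<delta>. natural_connecting T U V \<delta> \<and> (\<forall>X \<in> Ob T. \<forall>Y \<in> Ob T. mayer_vietoris_exact T U V \<delta> X Y)"
      using natural_connecting mayer_vietoris by blast
  next
    assume "\<exists>\<delta>. natural_connecting T U V \<delta> \<and> (\<forall>X \<in> Ob T. \<forall>Y \<in> Ob T. mayer_vietoris_exact T U V \<delta> X Y)"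
    then show "commuting_pair T U V" using commuting_if_exact by blast
  qed
qed

end
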